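(* Consider the uncertain control system $\dot x(t)=f(x(t),w(t))+G(x(t))u(t)$ with $f:\mathbb R^{n_x}\times\mathbb R^{n_w}\to\mathbb R^{n_x}$ and $G:\mathbb R^{n_x}\to\mathbb R^{n_x\times n_u}$ twice continuously differentiable, control set $U\subseteq\mathbb R^{n_u}$ and disturbance set $W\subseteq\mathbb R^{n_w}$. Let $(q_w,Q_w)\in\mathbb R^{n_w}\times\mathbb S_+^{n_w}$ and $(q_u,Q_u)\in\mathbb R^{n_u}\times\mathbb S_+^{n_u}$ satisfy $W\subseteq\mathcal E(q_w,Q_w)$ and $\mathcal E(q_u,Q_u)\subseteq U$. Let $u_x\in\mathbb U$ be a given reference control with $u_x(t)\in\mathcal E(q_u,Q_u)$, let $\gamma:\mathbb R\to(0,1]$, and let $R_u:\mathbb R\to\mathbb S_+^{n_u}$ satisfy $$R_u(t)=[1-\gamma(t)]Q_u+[1-\gamma(t)^{-1}][u_x(t)-q_u][u_x(t)-q_u]^{\sf T}\succeq0 .$$ Let $q_x:[t_1,t_2]\to\mathbb R^{n_x}$ and $Q_x:[t_1,t_2]\to\mathbb S_+^{n_x}$ satisfy, on $[t_1,t_2]$, $$\dot q_x(t)=f(q_x(t),q_w)+G(q_x(t))u_x(t),$$ $$\dot Q_x(t)\succeq\Phi_g\big(q_x(t),Q_x(t),S(t),R_u(t),\lambda(t),\kappa(t)\big)$$ for some functions $\lambda,\kappa:[t_1,t_2]\to\mathbb R_{++}$ and $S:[t_1,t_2]\to\mathbb R^{n_x\times n_u}$ with $S(t)S(t)^{\sf T}\preceq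 I$, where $\Phi_g$ is the matrix-valued function given in the context, built with nonlinearity bounders $\Omega_n$ and $\Omega_G$ which are assumed to satisfy the bounding properties (N) and (G) of the context. Then $Y(t):=\mathcal E(q_x(t),Q_x(t))$ describes a robust forward invariant tube (RFIT) for the system on $[t_1,t_2]$.
   Context: $\mathbb R_{++}$: positive reals. $\mathbb S_+^n$: symmetric positive semi-definite $n\times n$ matrices; $\succeq,\preceq$ is the Loewner order; $Q^{1/2}$ is the symmetric square root. $\mathcal E(q,Q):=\{q+Q^{1/2}v\mid v^{\sf T}v\le1\}$ and $\mathcal E(Q):=\mathcal E(0,Q)$. $\mathbb U$ (resp. $\mathbb W$) is the set of Lebesgue-integrable functions on $\mathbb R$ with values in $U$ (resp. $W$) for all $t$. Differential equations and inequalities are in the usual Carathéodory sense (absolutely continuous functions, relations holding for almost every $t$). RFIT: $Y:[t_1,t_2]\to\Pi(\mathbb R^{n_x})$ (power set of $\mathbb R^{n_x}$) is called a robust forward invariant tube for the system on $[t_1,t_2]$ if there exists an integrable feedback control law $\mu:[t_1,t_2]\times\mathbb R^{n_x}\to U$ such that any solution $x$ of $\dot x(t)=f(x(t),w(t))+G(x(t))\mu(t,x(t))$, $t\in[t_1,t_2]$, with $x(t)\in Y(t)$ satisfies $x(t')\in Y(t')$, for all $t,t'\in[t_1,t_2]$ with $t'\ge t$ and all $w\in\mathbb W$. Linearization: $A(q_x(t)):=\frac{\partial f}{\partial x}(q_x(t),q_w)+\frac{\partial G}{\partial x}(q_x(t))u_x(t)$ (the second term is the Jacobian at $x=q_x(t)$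 of $x\mapsto G(x)u_x(t)$ with $u_x(t)$ held fixed), and $B(q_x(t)):=\frac{\partial f}{\partial w}(q_x(t),q_w)$. Remainder: write $x(t)=q_x(t)+\delta_x(t)$, $w(t)=q_w+\delta_w(t)$, $u(t)=u_x(t)+\delta_u(t)$. The function $n:\mathbb R\times\mathbb R^{n_x}\times\mathbb R^{n_w}\times\mathbb R^{n_u}\to\mathbb R^{n_x}$ is defined so that the system is equivalent to $$\dot\delta_x=A(q_x(t))\delta_x+B(q_x(t))\delta_w+G(q_x(t)+\delta_x)\delta_u+n(t,\delta_x,\delta_w,\delta_u).$$ (N) $\Omega_n:\mathbb R^{n_x}\times\mathbb S_+^{n_x}\to\mathbb S_+^{n_x}$ satisfies $n(t,\xi,\omega,\nu)\in\mathcal E(\Omega_n(q_x(t),Q_x(t)))$ for all $t\in[t_1,t_2]$, $\xi\in\mathcal E(Q_x(t))$, $\omega\in\mathcal E(Q_w)$, $\nu\in\mathcal E(Q_u)$. (G) $\Omega_G:\mathbb R^{n_x}\times\mathbb S_+^{n_x}\times\mathbb S_+^{n_u}\times\mathbb R^{n_x\times n_u}\to\mathbb S_+^{n_x}$ satisfies $$\Omega_G(q_x(t),Q_x(t),R_u(t),S_0)\succeq Q_x^{1/2}(t)S_0R_u^{1/2}(t)G(\xi)^{\sf T}+G(\xi)R_u^{1/2}(t)S_0^{\sf T}Q_x^{1/2}(t)-Q_x^{1/2}(t)S_0R_u^{1/2}(t)G(q_x(t))^{\sf T}-G(q_x(t))R_u^{1/2}(t)S_0^{\sf T}Q_x^{1/2}(t)$$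 for all $t\in[t_1,t_2]$, $\xi\in\mathcal E(q_x(t),Q_x(t))$ and $S_0\in\mathbb R^{n_x\times n_u}$ with $S_0S_0^{\sf T}\preceq I$. For $S_0\in\mathbb R^{n_x\times n_u}$ and $\lambda_0,\kappa_0>0$, the symmetric matrix $\Phi_g$ is $$\begin{aligned}\Phi_g(q_x(t),Q_x(t),S_0,R_u(t),\lambda_0,\kappa_0):=\ &A(q_x(t))Q_x(t)+Q_x(t)A(q_x(t))^{\sf T}+Q_x^{1/2}(t)S_0R_u^{1/2}(t)G(q_x(t))^{\sf T}\\&+G(q_x(t))R_u^{1/2}(t)S_0^{\sf T}Q_x^{1/2}(t)+\Big(\tfrac1{\lambda_0}+\tfrac1{\kappa_0}\Big)Q_x(t)+\Omega_G(q_x(t),Q_x(t),R_u(t),S_0)\\&+\lambda_0B(q_x(t))Q_wB(q_x(t))^{\sf T}+\kappa_0\Omega_n(q_x(t),Q_x(t)).\end{aligned}$$ *)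

theory Defs
  imports "HOL-Analysis.Analysis"
begin

definition psd :: "real^'n^'n \<Rightarrow> bool" where
  "psd M \<longleftrightarrow> transpose M = M \<and> (\<forall>v. 0 \<le> v \<bullet> (M *v v))"

definition loewner_le :: "real^'n^'n \<Rightarrow> real^'n^'n \<Rightarrow> bool"  (infix \<open>\<preceq>\<close> 50) where
  "M \<preceq> N \<longleftrightarrow> psd (N - M)"

(* Only meaningful for psd arguments, where such a root exists and is unique. *)
definition psd_sqrt :: "real^'n^'n \<Rightarrow> real^'n^'n" where
  "psd_sqrt Q = (THE R. psd R \<and> R ** R = Q)"

definition outer :: "real^'m \<Rightarrow> real^'n \<Rightarrow> real^'n^'m" where
  "outer a b = (\<chi> i j. a $ i * b $ j)"

definition ellipsoid :: "real^'n \<Rightarrow> real^'n^'n \<Rightarrow> (real^'n) set" where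
  "ellipsoid q Q = {q + psd_sqrt Q *v v | v. v \<bullet> v \<le> 1}"

definition twice_cont_diff :: "('a::real_normed_vector \<Rightarrow> 'b::real_normed_vector) \<Rightarrow> bool" where
  "twice_cont_diff f \<longleftrightarrow>
     (\<exists>(f' :: 'a \<Rightarrow> 'a \<Rightarrow>\<^sub>L 'b) (f'' :: 'a \<Rightarrow> 'a \<Rightarrow>\<^sub>L 'a \<Rightarrow>\<^sub>L 'b).
        (\<forall>x. (f has_derivative blinfun_apply (f' x)) (at x)) \<and>
        (\<forall>x. (f' has_derivative blinfun_apply (f'' x)) (at x)) \<and>
        continuous_on UNIV f'')"

(* A division is a finite family of non-overlapping nonempty compact intervals;
   Inf k and Sup k are the endpoints of such an interval k. *)
definition abs_continuous_on :: "real set \<Rightarrow> (real \<Rightarrow> 'a::real_normed_vector) \<Rightarrow> bool" where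
  "abs_continuous_on I x \<longleftrightarrow>
     (\<forall>\<epsilon>>0. \<exists>\<delta>>0. \<forall>\<D> T. \<D> division_of T \<and> T \<subseteq> I \<and> (\<Sum>k\<in>\<D>. Sup k - Inf k) < \<delta> \<longrightarrow>
        (\<Sum>k\<in>\<D>. norm (x (Sup k) - x (Inf k))) < \<epsilon>)"

(* Integrability over the real line is meant locally, i.e. over every compact interval;
   otherwise a nonzero constant signal would not be admissible. *)
definition signals :: "('a::euclidean_space) set \<Rightarrow> (real \<Rightarrow> 'a) set" where
  "signals V = {v. (\<forall>t. v t \<in> V) \<and> (\<forall>a b. v absolutely_integrable_on {a..b})}"

(* The feedback is locally integrable on its domain, and it also stays integrable
   along every continuous trajectory, so that the closed-loop input is integrable. *)
definition integrable_feedback ::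
  "real \<Rightarrow> real \<Rightarrow> ('b::euclidean_space) set \<Rightarrow> (real \<Rightarrow> 'a::euclidean_space \<Rightarrow> 'b) \<Rightarrow> bool" where
  "integrable_feedback t1 t2 U \<mu> \<longleftrightarrow>
     (\<forall>t\<in>{t1..t2}. \<forall>x. \<mu> t x \<in> U) \<and>
     (\<forall>K. compact K \<longrightarrow> (\<lambda>(t, x). \<mu> t x) absolutely_integrable_on ({t1..t2} \<times> K)) \<and>
     (\<forall>x. continuous_on {t1..t2} x \<longrightarrow> (\<lambda>t. \<mu> t (x t)) absolutely_integrable_on {t1..t2})"

definition caratheodory_solution ::
  "real \<Rightarrow> real \<Rightarrow> (real \<Rightarrow> 'a::real_normed_vector \<Rightarrow> 'a) \<Rightarrow> (real \<Rightarrow> 'a) \<Rightarrow> bool" where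
  "caratheodory_solution t1 t2 F x \<longleftrightarrow>
     abs_continuous_on {t1..t2} x \<and>
     (AE t\<in>{t1..t2} in lebesgue. (x has_vector_derivative F t (x t)) (at t within {t1..t2}))"

definition RFIT ::
  "((real^'nx) \<times> (real^'nw) \<Rightarrow> real^'nx) \<Rightarrow> (real^'nx \<Rightarrow> real^'nu^'nx) \<Rightarrow>
   (real^'nu) set \<Rightarrow> (real^'nw) set \<Rightarrow> real \<Rightarrow> real \<Rightarrow> (real \<Rightarrow> (real^'nx) set) \<Rightarrow> bool" where
  "RFIT f G U W t1 t2 Y \<longleftrightarrow>
     (\<exists>\<mu>. integrable_feedback t1 t2 U \<mu> \<and>
        (\<forall>w\<in>signals W. \<forall>x.
           caratheodory_solution t1 t2 (\<lambda>t y. f (y, w t) + G y *v \<mu> t y) x \<longrightarrow>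
           (\<forall>t\<in>{t1..t2}. \<forall>t'\<in>{t1..t2}. t \<le> t' \<and> x t \<in> Y t \<longrightarrow> x t' \<in> Y t')))"

(* Below, q, u, Q, R stand for the values at one time instant of the reference
   state, the reference control and the matrix functions Q_x and R_u. *)

definition lin_A ::
  "((real^'nx) \<times> (real^'nw) \<Rightarrow> real^'nx) \<Rightarrow> (real^'nx \<Rightarrow> real^'nu^'nx) \<Rightarrow>
   real^'nw \<Rightarrow> real^'nx \<Rightarrow> real^'nu \<Rightarrow> real^'nx^'nx" where
  "lin_A f G q\<^sub>w q u = jacobian (\<lambda>x. f (x, q\<^sub>w)) (at q) + jacobian (\<lambda>x. G x *v u) (at q)"

definition lin_B ::
  "((real^'nx) \<times> (real^'nw) \<Rightarrow> real^'nx) \<Rightarrow> real^'nw \<Rightarrow> real^'nx \<Rightarrow> real^'nw^'nx" where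
  "lin_B f q\<^sub>w q = jacobian (\<lambda>w. f (q, w)) (at q\<^sub>w)"

(* The deviation from the reference has velocity
     f (q + \<xi>, q\<^sub>w + \<omega>) + G (q + \<xi>) *v (u + \<nu>) - (f (q, q\<^sub>w) + G q *v u);
   the remainder is what is left of it after subtracting
     A \<xi> + B \<omega> + G (q + \<xi>) \<nu>. *)
definition remainder ::
  "((real^'nx) \<times> (real^'nw) \<Rightarrow> real^'nx) \<Rightarrow> (real^'nx \<Rightarrow> real^'nu^'nx) \<Rightarrow>
   real^'nw \<Rightarrow> real^'nx \<Rightarrow> real^'nu \<Rightarrow> real^'nx \<Rightarrow> real^'nw \<Rightarrow> real^'nu \<Rightarrow> real^'nx" where
  "remainder f G q\<^sub>w q u \<xi> \<omega> \<nu> =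
     (f (q + \<xi>, q\<^sub>w + \<omega>) + G (q + \<xi>) *v (u + \<nu>) - (f (q, q\<^sub>w) + G q *v u))
     - (lin_A f G q\<^sub>w q u *v \<xi> + lin_B f q\<^sub>w q *v \<omega> + G (q + \<xi>) *v \<nu>)"

definition feedback_term ::
  "real^'nx^'nx \<Rightarrow> real^'nu^'nx \<Rightarrow> real^'nu^'nu \<Rightarrow> real^'nu^'nx \<Rightarrow> real^'nx^'nx" where
  "feedback_term Q S R M =
     psd_sqrt Q ** S ** psd_sqrt R ** transpose M + M ** psd_sqrt R ** transpose S ** psd_sqrt Q"

definition Phi_g ::
  "((real^'nx) \<times> (real^'nw) \<Rightarrow> real^'nx) \<Rightarrow> (real^'nx \<Rightarrow> real^'nu^'nx) \<Rightarrow>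
   real^'nw \<Rightarrow> real^'nw^'nw \<Rightarrow>
   (real^'nx \<Rightarrow> real^'nx^'nx \<Rightarrow> real^'nx^'nx) \<Rightarrow>
   (real^'nx \<Rightarrow> real^'nx^'nx \<Rightarrow> real^'nu^'nu \<Rightarrow> real^'nu^'nx \<Rightarrow> real^'nx^'nx) \<Rightarrow>
   real^'nu \<Rightarrow>
   real^'nx \<Rightarrow> real^'nx^'nx \<Rightarrow> real^'nu^'nx \<Rightarrow> real^'nu^'nu \<Rightarrow> real \<Rightarrow> real \<Rightarrow> real^'nx^'nx" where
  "Phi_g f G q\<^sub>w Q\<^sub>w \<Omega>\<^sub>n \<Omega>\<^sub>G u q Q S R lam kap =
     lin_A f G q\<^sub>w q u ** Q + Q ** transpose (lin_A f G q\<^sub>w q u)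
     + feedback_term Q S R (G q)
     + (1 / lam + 1 / kap) *\<^sub>R Q
     + \<Omega>\<^sub>G q Q R S
     + lam *\<^sub>R (lin_B f q\<^sub>w q ** Q\<^sub>w ** transpose (lin_B f q\<^sub>w q))
     + kap *\<^sub>R \<Omega>\<^sub>n q Q"

end

theory Submission
  imports Defs
begin

text \<open>
  For a solution \<open>x\<close> let \<open>d t\<close> be the distance of \<open>x t\<close> from the ellipsoid \<open>E t\<close>. The feedback is
  \<open>u\<^sub>x t + N t (y - q\<^sub>x t)\<close>, evaluated at the projection \<open>y\<close> of the state onto \<open>E t\<close>. The matrix
  inequality bounds the outward normal velocity at \<open>y\<close> by the velocity of the support function of
  \<open>E t\<close>, so by Lipschitz continuity \<open>d\<close> grows at most like \<open>L d\<close>, and \<open>d = 0\<close> is preserved by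
  Gronwall's argument.

  Two points need care. First, \<open>Q\<^sub>x t\<close> may be singular, and the support function
  \<open>sqrt (c \<bullet> Q\<^sub>x t c)\<close> then need not be absolutely continuous in \<open>t\<close>. It is replaced by
  \<open>sqrt (c \<bullet> Q\<^sub>x t c + \<epsilon>)\<close>; the derivatives of the regularised distances are bounded above uniformly
  in \<open>\<epsilon>\<close>, which permits the passage to the limit \<open>\<epsilon> \<rightarrow> 0\<close> under the integral. Directions in the
  kernel of \<open>Q\<^sub>x t\<close> are handled by the fact that there the matrix inequality degenerates to an
  equality. Secondly, the obvious gain, built from \<open>S\<close> and \<open>R\<^sub>u\<close>, need not be measurable in \<open>t\<close>. It
  only serves to show that the set of suitable gains is nonempty; as these sets are closed and
  convex and depend on the data through a closed relation, their elements of minimal norm form a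
  measurable selection.
\<close>

section \<open>Square roots of positive semidefinite matrices\<close>

text \<open>The distance is tracked rather than a form with the inverse of Q_x, which a singular
  matrix lacks. At a boundary point q + Q e with e \<bullet> Q e = 1 and outward normal e, twice the
  normal velocity is compared with e \<bullet> D e, where D is the derivative of Q_x. Disturbance
  and remainder enter through square roots of quadratic forms; Young's inequality trades these for
  the terms of \<open>Phi_g\<close> with \<open>lam\<close> and \<open>kap\<close>, and the
  normalisation of e turns the leftover 1 / lam + 1 / kap into a multiple of Q. For k in the kernel
  of Q_x t, the form k \<bullet> Q_x s k is minimal at s = t, so its derivative vanishes there, and
  the matrix inequality then forces each semidefinite contribution to \<open>Phi_g\<close> to vanish
  on k. Evaluating the feedback at the projection keeps its values in the control set for all
  states; moreover the state and its projection share one control value, so their velocities differ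
  only through the Lipschitz dependence of f and G on the state. The feedback has to be fixed before
  disturbance and solution, hence its defining conditions are imposed for all disturbance values in
  the outer ellipsoid.\<close>

lemma symmetric_dot_swap:
  fixes Q :: "real^'n^'n"
  assumes "transpose Q = Q"
  shows "x \<bullet> (Q *v y) = (Q *v x) \<bullet> y"
  by (metis assms dot_lmul_matrix matrix_transpose_mul transpose_matrix_vector)

lemma transpose_dot: "x \<bullet> (transpose (A :: real^'n^'m) *v y) = (A *v x) \<bullet> y"
  by (metis dot_lmul_matrix inner_commute transpose_matrix_vector)

lemma dot_transpose: "x \<bullet> (A *v y) = (transpose (A :: real^'n^'m) *v x) \<bullet> y"
  by (metis dot_lmul_matrix transpose_matrix_vector)

lemma norm_matrix_vector_mult_le:
  fixes A :: "real^'n^'m"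
  shows "norm (A *v x) \<le> norm A * norm x"
proof -
  have "norm (A *v x) \<le> L2_set (\<lambda>i. norm (A $ i) * norm x) UNIV"
    unfolding norm_vec_def[of "A *v x"]
    by (rule L2_set_mono) (auto simp: matrix_vector_mul_component Cauchy_Schwarz_ineq2)
  also have "\<dots> = norm A * norm x"
    by (simp add: norm_vec_def[of A] L2_set_left_distrib)
  finally show ?thesis .
qed

lemma bounded_bilinear_matrix_vector_mult:
  "bounded_bilinear (\<lambda>(A :: real^'n^'m) x. A *v x)"
proof
  show "\<exists>K. \<forall>(A :: real^'n^'m) x. norm (A *v x) \<le> norm A * norm x * K"
    by (rule exI[of _ 1]) (simp add: norm_matrix_vector_mult_le)
qed (auto simp: matrix_vector_mult_add_rdistrib matrix_vector_right_distrib
       scaleR_matrix_vector_assoc matrix_vector_mult_scaleR)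

text \<open>First-order condition without calculus: for small h the linear term would decide the
  sign. The test value is the vertex -a/b when the parabola opens upward, and -a otherwise.\<close>

lemma quadratic_nonneg_imp_linear_zero:
  fixes a b :: real
  assumes "\<And>h. 0 \<le> 2 * h * a + h^2 * b"
  shows "a = 0"
proof -
  have "a^2 = 0"
  proof (cases "b \<le> 0")
    case True
    have "0 \<le> 2 * (-a) * a + (-a)^2 * b" by (rule assms)
    moreover have "(-a)^2 * b \<le> 0" using True by (simp add: mult_nonneg_nonpos)
    moreover have "2 * (-a) * a = - (2 * a^2)" by (simp add: power2_eq_square)
    ultimately have "a^2 \<le> 0" by linarith
    then show ?thesis by simp
  next
    case False
    then have b: "b > 0" by simp
    have "0 \<le> 2 * (-a/b) * a + (-a/b)^2 * b" by (rule assms)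
    also have "(-a/b)^2 * b = a^2 / b" using b by (simp add: power2_eq_square)
    also have "2 * (-a/b) * a = - (2 * (a^2 / b))" by (simp add: power2_eq_square)
    finally have "a^2 / b \<le> 0" by simp
    then have "a^2 \<le> 0" using b by (simp add: divide_le_0_iff)
    then show ?thesis by simp
  qed
  then show ?thesis by simp
qed

text \<open>A maximiser of the quadratic form on the unit sphere of an invariant subspace is an
  eigenvector, and its orthogonal complement in the subspace is again invariant.\<close>

lemma symmetric_eigenbasis:
  fixes Q :: "real^'n^'n"
  assumes sym: "transpose Q = Q"
    and "subspace S" and "\<And>x. x \<in> S \<Longrightarrow> Q *v x \<in> S"
  shows "\<exists>B. B \<subseteq> S \<and> finite B \<and> pairwise orthogonal B \<and> span B = S \<and>
           (\<forall>b\<in>B. norm b = 1 \<and> (\<exists>l. Q *v b = l *\<^sub>R b))"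
  using assms(2,3)
proof (induction "dim S" arbitrary: S rule: less_induct)
  case less
  show ?case
  proof (cases "S = {0}")
    case True
    then show ?thesis by (intro exI[of _ "{}"]) auto
  next
    case False
    have S0: "0 \<in> S" using less.prems subspace_0 by blast
    then obtain x where x: "x \<in> S" "x \<noteq> 0" using False by auto
    let ?C = "sphere 0 1 \<inter> S"
    have "compact ?C"
      using closed_subspace[OF less.prems(1)] by (simp add: compact_Int_closed)
    moreover have "x /\<^sub>R norm x \<in> ?C" using x less.prems(1) by (simp add: subspace_scale)
    then have "?C \<noteq> {}" by blast
    moreover have "continuous_on ?C (\<lambda>v. v \<bullet> (Q *v v))"
      by (intro continuous_on_inner continuous_on_id linear_continuous_on) simp
    ultimately obtain b where b: "b \<in> ?C" "\<And>v. v \<in> ?C \<Longrightarrow> v \<bullet> (Q *v v) \<le> b \<bullet> (Q *v b)"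
      using continuous_attains_sup[of ?C "\<lambda>v. v \<bullet> (Q *v v)"] by blast
    define l where "l = b \<bullet> (Q *v b)"
    have bS: "b \<in> S" and nb: "norm b = 1" using b(1) by auto
    have le: "v \<bullet> (Q *v v) \<le> l * (v \<bullet> v)" if "v \<in> S" for v
    proof (cases "v = 0")
      case False
      have "(v /\<^sub>R norm v) \<in> ?C" using False that less.prems(1) by (simp add: subspace_scale)
      from b(2)[OF this] have "v \<bullet> (Q *v v) / (norm v)^2 \<le> l"
        by (simp add: l_def matrix_vector_mult_scaleR divide_inverse power2_eq_square ac_simps)
      then show ?thesis using False by (simp add: pos_divide_le_eq power2_norm_eq_inner)
    qed simp
    have "(Q *v b - l *\<^sub>R b) \<bullet> v = 0" if "v \<in> S" for v
    proof -
      have "0 \<le> 2 * h * ((l *\<^sub>R b - Q *v b) \<bullet> v) + h^2 * (l * (v \<bullet> v) - v \<bullet> (Q *v v))" for h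
      proof -
        have "b + h *\<^sub>R v \<in> S" using bS that less.prems(1) by (simp add: subspace_add subspace_scale)
        from le[OF this] show ?thesis
          using symmetric_dot_swap[OF sym, of b v] nb l_def
          by (simp add: matrix_vector_right_distrib matrix_vector_mult_scaleR inner_add_left inner_add_right
              inner_diff_left power2_eq_square algebra_simps norm_eq_1 inner_commute)
      qed
      from quadratic_nonneg_imp_linear_zero[OF this] show ?thesis by (simp add: inner_diff_left)
    qed
    moreover have "Q *v b - l *\<^sub>R b \<in> S"
      using bS less.prems by (simp add: subspace_diff subspace_scale)
    ultimately have "(Q *v b - l *\<^sub>R b) \<bullet> (Q *v b - l *\<^sub>R b) = 0" by blast
    then have eig: "Q *v b = l *\<^sub>R b" by simp
    define T where "T = S \<inter> {v. b \<bullet> v = 0}"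
    have subT: "subspace T" unfolding T_def
      by (rule subspace_inter[OF less.prems(1) subspace_hyperplane])
    have "b \<notin> T" using nb by (auto simp: T_def)
    then have "T \<subset> S" using bS unfolding T_def by blast
    then have dimT: "dim T < dim S"
      using subT less.prems(1) dim_psubset by (metis span_eq_iff)
    have invT: "Q *v v \<in> T" if "v \<in> T" for v
      using that less.prems(2) symmetric_dot_swap[OF sym, of b v] eig by (auto simp: T_def)
    obtain B where B: "B \<subseteq> T" "finite B" "pairwise orthogonal B" "span B = T"
      "\<forall>b\<in>B. norm b = 1 \<and> (\<exists>l. Q *v b = l *\<^sub>R b)"
      using less.hyps[OF dimT subT invT] by blast
    have "span (insert b B) = S"
    proof
      show "span (insert b B) \<subseteq> S"
        using bS B(1) less.prems(1) by (intro span_minimal) (auto simp: T_def)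
      show "S \<subseteq> span (insert b B)"
      proof
        fix v assume v: "v \<in> S"
        have "v - (b \<bullet> v) *\<^sub>R b \<in> T"
          using v bS less.prems(1) nb
          by (auto simp: T_def subspace_diff subspace_scale inner_diff_right norm_eq_1)
        then show "v \<in> span (insert b B)" using B(4) by (subst span_insert) auto
      qed
    qed
    moreover have "pairwise orthogonal (insert b B)"
      using B(1,3) by (auto simp: pairwise_insert T_def orthogonal_def inner_commute)
    ultimately show ?thesis
      using B bS nb eig by (intro exI[of _ "insert b B"]) (auto simp: T_def)
  qed
qed

text \<open>Functional calculus on an orthonormal eigenbasis: \<open>F g\<close> applies g to the
  eigenvalues. Besides the root, a left factor X is produced that recovers the root from Q even when
  Q is singular.\<close>

lemma psd_sqrt_aux:
  fixes Q :: "real^'n^'n"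
  assumes Q: "psd Q"
  shows "\<exists>P X. psd P \<and> P ** P = Q \<and> X ** Q = P \<and> (\<forall>R. psd R \<and> R ** R = Q \<longrightarrow> R = P)"
proof -
  have sym: "transpose Q = Q" and nonneg: "\<And>v. 0 \<le> v \<bullet> (Q *v v)"
    using Q by (auto simp: psd_def)
  obtain B where B: "finite B" "pairwise orthogonal B" "span B = UNIV"
    "\<And>b. b \<in> B \<Longrightarrow> norm b = 1" "\<forall>b\<in>B. \<exists>l. Q *v b = l *\<^sub>R b"
    using symmetric_eigenbasis[OF sym subspace_UNIV] by auto
  then obtain l where l: "\<And>b. b \<in> B \<Longrightarrow> Q *v b = l b *\<^sub>R b" by metis
  have l0: "0 \<le> l b" if "b \<in> B" for b
    using nonneg[of b] l[OF that] B(4)[OF that] by (simp add: norm_eq_1)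
  define F where "F g = (\<Sum>b\<in>B. g (l b) *\<^sub>R outer b b)" for g :: "real \<Rightarrow> real"
  have F: "F g *v x = (\<Sum>b\<in>B. (g (l b) * (b \<bullet> x)) *\<^sub>R b)" for g x
  proof -
    have "outer b b *v x = (b \<bullet> x) *\<^sub>R b" for b :: "real^'n"
      by (simp add: vec_eq_iff outer_def matrix_vector_mult_def inner_vec_def sum_distrib_left
          sum_distrib_right mult.assoc mult.commute mult.left_commute)
    note outer = this
    show ?thesis
      unfolding F_def
      using B(1) by (induction B rule: finite_induct)
        (simp_all add: matrix_vector_mult_add_rdistrib scaleR_matrix_vector_assoc[symmetric] outer)
  qed
  have Fb: "F g *v b = g (l b) *\<^sub>R b" if "b \<in> B" for g b
  proof -
    have "(\<Sum>c\<in>B. (g (l c) * (c \<bullet> b)) *\<^sub>R c) = (\<Sum>c\<in>B. if c = b then g (l b) *\<^sub>R b else 0)"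
      using B(2,4) that by (intro sum.cong) (auto simp: pairwise_def orthogonal_def norm_eq_1)
    then show ?thesis using that B(1) by (simp add: F)
  qed
  have eqI: "M = N" if "\<And>b. b \<in> B \<Longrightarrow> M *v b = N *v b" for M N :: "real^'n^'n"
  proof -
    have "M *v x = N *v x" for x
      by (rule linear_eq_on[OF matrix_vector_mul_linear matrix_vector_mul_linear])
        (use B(3) that in auto)
    then show ?thesis by (simp add: matrix_eq)
  qed
  \<comment> \<open>Since 1 / 0 = 0, \<open>?X\<close> is the pseudo-inverse of the root: it inverts
    on the range and vanishes on the kernel.\<close>
  let ?P = "F sqrt" and ?X = "F (\<lambda>x. 1 / sqrt x)"
  have psdP: "psd ?P" unfolding psd_def
  proof
    have "transpose (outer b b) = outer b b" for b :: "real^'n"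
      by (simp add: outer_def transpose_def vec_eq_iff mult.commute)
    then show "transpose ?P = ?P"
      unfolding F_def by (simp add: transpose_def vec_eq_iff outer_def mult.commute)
    show "\<forall>v. 0 \<le> v \<bullet> (?P *v v)"
    proof
      fix v
      have "v \<bullet> (?P *v v) = (\<Sum>b\<in>B. sqrt (l b) * (b \<bullet> v)^2)"
        by (simp add: F inner_sum_right inner_commute power2_eq_square mult.assoc)
      also have "\<dots> \<ge> 0" using l0 by (intro sum_nonneg) auto
      finally show "0 \<le> v \<bullet> (?P *v v)" .
    qed
  qed
  have sq: "?P ** ?P = Q"
    by (rule eqI) (simp add: matrix_vector_mul_assoc[symmetric] Fb matrix_vector_mult_scaleR l l0)
  have X: "?X ** Q = ?P"
  proof (rule eqI)
    fix b assume b: "b \<in> B"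
    have "l b / sqrt (l b) = sqrt (l b)" using real_div_sqrt[OF l0[OF b]] .
    then show "(?X ** Q) *v b = ?P *v b"
      using b by (simp add: matrix_vector_mul_assoc[symmetric] Fb matrix_vector_mult_scaleR l)
  qed
  have "R = ?P" if R: "psd R" "R ** R = Q" for R
  proof (rule eqI)
    fix b assume b: "b \<in> B"
    have symR: "transpose R = R" using R by (simp add: psd_def)
    have RR: "R *v (R *v b) = l b *\<^sub>R b" using R(2) l[OF b] by (metis matrix_vector_mul_assoc)
    have "R *v b = sqrt (l b) *\<^sub>R b"
    proof (cases "l b = 0")
      case True
      then have "(R *v b) \<bullet> (R *v b) = 0"
        using RR symmetric_dot_swap[OF symR, of b "R *v b"] by simp
      then show ?thesis using True by simp
    next
      case False
      then have pos: "sqrt (l b) > 0" using l0[OF b] by simp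
      \<comment> \<open>\<open>y\<close> measures how far b is from being an eigenvector of R for
        the positive root. It satisfies R y = - sqrt (l b) y, which a semidefinite R allows only for
        y = 0.\<close>
      define y where "y = R *v b - sqrt (l b) *\<^sub>R b"
      have "R *v y = - sqrt (l b) *\<^sub>R y"
        using RR l0[OF b] by (simp add: y_def matrix_vector_mult_diff_distrib matrix_vector_mult_scaleR algebra_simps)
      then have "y \<bullet> (R *v y) = - sqrt (l b) * (y \<bullet> y)" by simp
      moreover have "0 \<le> y \<bullet> (R *v y)" using R(1) by (simp add: psd_def)
      ultimately have "sqrt (l b) * (y \<bullet> y) \<le> 0" by simp
      then have "y \<bullet> y \<le> 0" using pos by (simp add: mult_le_0_iff)
      then have "y = 0" by (metis inner_ge_zero inner_eq_zero_iff order_antisym)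
      then show ?thesis by (simp add: y_def)
    qed
    then show "R *v b = ?P *v b" using Fb[OF b] by simp
  qed
  with psdP sq X show ?thesis by blast
qed

lemma psd_psd_sqrt: "psd Q \<Longrightarrow> psd (psd_sqrt Q)"
  and psd_sqrt_square: "psd Q \<Longrightarrow> psd_sqrt Q ** psd_sqrt Q = Q"
proof -
  assume "psd Q"
  then obtain P where P: "psd P \<and> P ** P = Q" "\<forall>R. psd R \<and> R ** R = Q \<longrightarrow> R = P"
    using psd_sqrt_aux by blast
  have "psd_sqrt Q = P" unfolding psd_sqrt_def
    by (rule the_equality) (rule P(1), erule P(2)[rule_format])
  then show "psd (psd_sqrt Q)" "psd_sqrt Q ** psd_sqrt Q = Q" using P(1) by simp_all
qed

lemma psd_sqrt_left_factor:
  assumes "psd Q"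
  obtains X where "X ** Q = psd_sqrt Q"
  using psd_sqrt_aux[OF assms] psd_psd_sqrt[OF assms] psd_sqrt_square[OF assms] by metis

text \<open>Transposing X Q = P, with P the root of Q, gives Q X^T = P, so X^T X is the required
  matrix. It serves to split a vector linearly into a kernel part and a part controlled by its image
  under Q.\<close>

lemma psd_generalized_inverse:
  assumes "psd Q"
  obtains X where "\<And>v. Q *v (X *v (Q *v v)) = Q *v v"
proof -
  obtain X where X: "X ** Q = psd_sqrt Q" using psd_sqrt_left_factor[OF assms] .
  have "transpose Q = Q" "transpose (psd_sqrt Q) = psd_sqrt Q"
    using assms psd_psd_sqrt by (auto simp: psd_def)
  then have "Q ** transpose X = psd_sqrt Q"
    by (metis X matrix_transpose_mul)
  then have "Q ** (transpose X ** X) ** Q = Q"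
    using X psd_sqrt_square[OF assms] by (metis matrix_mul_assoc)
  then have "Q *v ((transpose X ** X) *v (Q *v v)) = Q *v v" for v
    by (metis matrix_vector_mul_assoc)
  then show thesis by (rule that)
qed

section \<open>Calculus with a semidefinite matrix and its root\<close>

lemma psd_dot_swap: "psd Q \<Longrightarrow> x \<bullet> (Q *v y) = (Q *v x) \<bullet> y"
  by (simp add: psd_def symmetric_dot_swap)

lemma psd_nonneg: "psd Q \<Longrightarrow> 0 \<le> x \<bullet> (Q *v x)"
  by (simp add: psd_def)

lemma psd_sqrt_mult: "psd Q \<Longrightarrow> psd_sqrt Q *v (psd_sqrt Q *v x) = Q *v x"
  by (simp add: matrix_vector_mul_assoc psd_sqrt_square)

lemma norm_psd_sqrt_mult: "psd Q \<Longrightarrow> norm (psd_sqrt Q *v x) = sqrt (x \<bullet> (Q *v x))"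
  by (metis norm_eq_sqrt_inner psd_dot_swap psd_psd_sqrt psd_sqrt_mult)

lemma psd_sqrt_mult_eq_0_iff: "psd Q \<Longrightarrow> psd_sqrt Q *v x = 0 \<longleftrightarrow> x \<bullet> (Q *v x) = 0"
  by (metis norm_eq_zero norm_psd_sqrt_mult real_sqrt_eq_0_iff)

lemma psd_form_eq_0_iff:
  assumes "psd Q"
  shows "x \<bullet> (Q *v x) = 0 \<longleftrightarrow> Q *v x = 0"
proof
  assume "x \<bullet> (Q *v x) = 0"
  then have "psd_sqrt Q *v x = 0" by (simp add: psd_sqrt_mult_eq_0_iff assms)
  then have "psd_sqrt Q *v (psd_sqrt Q *v x) = 0" by simp
  then show "Q *v x = 0" by (simp only: psd_sqrt_mult[OF assms])
qed simp

lemma psd_Cauchy_Schwarz: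
  assumes "psd Q"
  shows "x \<bullet> (Q *v y) \<le> sqrt (x \<bullet> (Q *v x)) * sqrt (y \<bullet> (Q *v y))"
proof -
  have "x \<bullet> (Q *v y) = (psd_sqrt Q *v x) \<bullet> (psd_sqrt Q *v y)"
    by (metis assms psd_dot_swap psd_psd_sqrt psd_sqrt_mult)
  also have "\<dots> \<le> norm (psd_sqrt Q *v x) * norm (psd_sqrt Q *v y)" by (rule norm_cauchy_schwarz)
  finally show ?thesis by (simp add: norm_psd_sqrt_mult assms)
qed

lemma ellipsoid_eq_image: "ellipsoid q Q = (\<lambda>v. q + psd_sqrt Q *v v) ` cball 0 1"
  unfolding ellipsoid_def by (auto simp: norm_eq_sqrt_inner)
  

section \<open>Ellipsoids\<close>

lemma dot_matrix_vector_mult_le: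
  fixes A :: "real^'n^'m"
  shows "\<bar>x \<bullet> (A *v y)\<bar> \<le> norm x * norm A * norm y"
proof -
  have "\<bar>x \<bullet> (A *v y)\<bar> \<le> norm x * norm (A *v y)" by (rule Cauchy_Schwarz_ineq2)
  also have "\<dots> \<le> norm x * (norm A * norm y)"
    by (intro mult_left_mono norm_matrix_vector_mult_le) simp
  finally show ?thesis by (simp add: mult.assoc)
qed

lemma compact_ellipsoid: "compact (ellipsoid q Q)"
  unfolding ellipsoid_eq_image
  by (intro compact_continuous_image continuous_on_add continuous_on_const linear_continuous_on) auto

lemma closed_ellipsoid: "closed (ellipsoid q Q)"
  by (simp add: compact_ellipsoid compact_imp_closed)

lemma convex_ellipsoid: "convex (ellipsoid q Q)"
proof -
  have "ellipsoid q Q = (+) q ` ((*v) (psd_sqrt Q) ` cball 0 1)"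
    unfolding ellipsoid_eq_image by (simp add: image_image)
  then show ?thesis
    by (simp add: convex_translation convex_linear_image matrix_vector_mul_linear)
qed

lemma center_in_ellipsoid: "q \<in> ellipsoid q Q"
  unfolding ellipsoid_def by (auto intro!: exI[of _ 0])

lemma ellipsoid_0_iff: "y - q \<in> ellipsoid 0 Q \<longleftrightarrow> y \<in> ellipsoid q Q"
  unfolding ellipsoid_def by (auto simp: algebra_simps)

lemma ellipsoidI:
  assumes "psd Q" "z \<bullet> (Q *v z) \<le> 1"
  shows "q + Q *v z \<in> ellipsoid q Q"
proof -
  have "norm (psd_sqrt Q *v z) \<le> 1"
    using assms by (simp add: norm_psd_sqrt_mult)
  then show ?thesis
    unfolding ellipsoid_eq_image using psd_sqrt_mult[OF assms(1), of z]
    by (auto intro!: image_eqI[of _ _ "psd_sqrt Q *v z"])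
qed

text \<open>Converse of \<open>ellipsoidI\<close>; both avoid the root, whose dependence on Q is
  awkward. A representing vector v may have a component in the kernel of the root. Removing it
  leaves m, which represents the same point, has norm at most 1 by orthogonality, and is the root
  applied to some z.\<close>

lemma ellipsoidE:
  assumes "psd Q" "y \<in> ellipsoid q Q"
  obtains z where "y = q + Q *v z" "z \<bullet> (Q *v z) \<le> 1"
proof -
  let ?P = "psd_sqrt Q"
  obtain v where v: "norm v \<le> 1" "y = q + ?P *v v"
    using assms(2) by (auto simp: ellipsoid_eq_image)
  obtain X where X: "X ** Q = ?P" using psd_sqrt_left_factor[OF assms(1)] .
  have "transpose Q = Q" "transpose ?P = ?P"
    using assms psd_psd_sqrt by (auto simp: psd_def)
  then have QX: "Q ** transpose X = ?P" by (metis X matrix_transpose_mul)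
  define z where "z = transpose X *v v"
  have Qz: "Q *v z = ?P *v v" by (simp only: z_def matrix_vector_mul_assoc QX)
  define m where "m = ?P *v z"
  have Pm: "?P *v (v - m) = 0"
    using Qz psd_sqrt_mult[OF assms(1), of z] by (simp add: m_def matrix_vector_mult_diff_distrib)
  have "m \<bullet> (v - m) = 0"
    using Pm psd_dot_swap[OF psd_psd_sqrt[OF assms(1)], of z "v - m"] by (simp add: m_def)
  then have "m \<bullet> m = m \<bullet> v" by (simp add: inner_diff_right)
  also have "\<dots> \<le> norm m * norm v" by (rule norm_cauchy_schwarz)
  also have "\<dots> \<le> norm m * 1" using v by (intro mult_left_mono) auto
  finally have "norm m \<le> 1"
    by (cases "norm m = 0") (auto simp: power2_norm_eq_inner[symmetric] power2_eq_square)
  then have "z \<bullet> (Q *v z) \<le> 1"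
    using norm_psd_sqrt_mult[OF assms(1), of z] by (simp add: m_def)
  with Qz v(2) show thesis by (intro that[of z]) auto
qed

lemma ellipsoid_support_le:
  assumes "psd Q" "y \<in> ellipsoid q Q"
  shows "c \<bullet> (y - q) \<le> sqrt (c \<bullet> (Q *v c))"
proof -
  obtain z where z: "y = q + Q *v z" "z \<bullet> (Q *v z) \<le> 1" using ellipsoidE[OF assms] .
  have "c \<bullet> (y - q) \<le> sqrt (c \<bullet> (Q *v c)) * sqrt (z \<bullet> (Q *v z))"
    using psd_Cauchy_Schwarz[OF assms(1), of c z] z(1) by simp
  also have "\<dots> \<le> sqrt (c \<bullet> (Q *v c)) * 1"
    using z(2) psd_nonneg[OF assms(1)] by (intro mult_left_mono) auto
  finally show ?thesis by simp
qed

lemma ellipsoid_support_attained: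
  assumes "psd Q"
  obtains y where "y \<in> ellipsoid q Q" "c \<bullet> (y - q) = sqrt (c \<bullet> (Q *v c))"
    "y = q + Q *v (c /\<^sub>R sqrt (c \<bullet> (Q *v c)))"
proof -
  let ?s = "sqrt (c \<bullet> (Q *v c))"
  let ?y = "q + Q *v (c /\<^sub>R ?s)"
  have nn: "0 \<le> c \<bullet> (Q *v c)" by (rule psd_nonneg[OF assms])
  have sq: "?s * ?s = c \<bullet> (Q *v c)" using nn by simp
  \<comment> \<open>For a vanishing support value, division by zero makes the scaled direction 0 and
    the witness is the centre.\<close>
  have "(c /\<^sub>R ?s) \<bullet> (Q *v (c /\<^sub>R ?s)) = (if ?s = 0 then 0 else 1)"
    using nn by (simp add: matrix_vector_mult_scaleR inverse_eq_divide)
  then have "?y \<in> ellipsoid q Q" by (intro ellipsoidI[OF assms]) (auto split: if_splits)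
  moreover have "c \<bullet> (?y - q) = ?s"
    using nn sq by (cases "?s = 0") (auto simp: matrix_vector_mult_scaleR field_simps)
  ultimately show thesis using that by blast
qed

text \<open>A point outside is cut off by a separating hyperplane, and the support point in the
  direction of its normal contradicts the inequality. Each of these scalar conditions is continuous
  in the centre and the matrix, so membership passes to limits.\<close>

lemma ellipsoid_iff_support:
  assumes "psd Q"
  shows "y \<in> ellipsoid q Q \<longleftrightarrow> (\<forall>c. c \<bullet> (y - q) \<le> sqrt (c \<bullet> (Q *v c)))"
proof
  assume R: "\<forall>c. c \<bullet> (y - q) \<le> sqrt (c \<bullet> (Q *v c))"
  show "y \<in> ellipsoid q Q"
  proof (rule ccontr)
    assume "y \<notin> ellipsoid q Q"
    then obtain a b where ab: "a \<bullet> y < b" "\<And>x. x \<in> ellipsoid q Q \<Longrightarrow> b < a \<bullet> x"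
      using separating_hyperplane_closed_point[OF convex_ellipsoid closed_ellipsoid] by metis
    obtain x where x: "x \<in> ellipsoid q Q" "(-a) \<bullet> (x - q) = sqrt ((-a) \<bullet> (Q *v (-a)))"
      using ellipsoid_support_attained[OF assms, of q "-a"] by metis
    have "(-a) \<bullet> (y - q) \<le> (-a) \<bullet> (x - q)" using R[rule_format, of "-a"] x(2) by simp
    with ab(1) ab(2)[OF x(1)] show False by (simp add: inner_diff_right)
  qed
qed (use ellipsoid_support_le[OF assms] in blast)

lemma ellipsoid_norm_le:
  assumes "psd Q" "y \<in> ellipsoid q Q"
  shows "norm (y - q) \<le> sqrt (norm Q)"
proof -
  let ?c = "y - q"
  have "norm ?c * norm ?c \<le> sqrt (?c \<bullet> (Q *v ?c))"
    using ellipsoid_support_le[OF assms, of ?c] by (simp add: power2_norm_eq_inner[symmetric] power2_eq_square)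
  also have "\<dots> \<le> sqrt (norm ?c * norm Q * norm ?c)"
    using dot_matrix_vector_mult_le[of ?c Q ?c] by simp
  also have "\<dots> = sqrt (norm Q) * norm ?c" by (simp add: real_sqrt_mult)
  finally show ?thesis by (cases "norm ?c = 0") auto
qed

text \<open>With \<open>\<alpha> = d \<bullet> a\<close> and \<open>\<beta>\<^sup>2 = d \<bullet> Q d\<close>, the claim is that the square root of
  \<open>(1 - \<gamma>) \<beta>\<^sup>2 - (1 / \<gamma> - 1) \<alpha>\<^sup>2\<close> is at most \<open>\<beta> - \<alpha>\<close>, and the difference of the squares is
  \<open>(\<gamma> \<beta> - \<alpha>)\<^sup>2 / \<gamma>\<close>.\<close>

lemma ellipsoid_control_split:
  fixes Q :: "real^'n^'n"
  assumes Q: "psd Q" and R: "psd R" and u: "u \<in> ellipsoid q Q" and g: "0 < g" "g \<le> 1"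
    and Req: "R = (1 - g) *\<^sub>R Q + (1 - inverse g) *\<^sub>R outer (u - q) (u - q)"
    and v: "v \<in> ellipsoid 0 R"
  shows "u + v \<in> ellipsoid q Q" "v \<in> ellipsoid 0 Q"
proof -
  have form: "d \<bullet> (R *v d) = (1 - g) * (d \<bullet> (Q *v d)) + (1 - inverse g) * (d \<bullet> (u - q))^2" for d
  proof -
    have "outer (u - q) (u - q) *v d = (d \<bullet> (u - q)) *\<^sub>R (u - q)"
      by (simp add: vec_eq_iff outer_def matrix_vector_mult_def inner_vec_def sum_distrib_left
          sum_distrib_right mult.assoc mult.commute mult.left_commute)
    then show ?thesis unfolding Req
      by (simp add: matrix_vector_mult_add_rdistrib scaleR_matrix_vector_assoc[symmetric]
          inner_add_right power2_eq_square)
  qed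
  have ig: "1 - inverse g \<le> 0" using g by (simp add: one_le_inverse)
  have dv: "d \<bullet> v \<le> sqrt (d \<bullet> (R *v d))" for d using ellipsoid_support_le[OF R v] by simp
  show "u + v \<in> ellipsoid q Q"
    unfolding ellipsoid_iff_support[OF Q]
  proof
    fix d
    define al be where "al = d \<bullet> (u - q)" and "be = sqrt (d \<bullet> (Q *v d))"
    have be: "be^2 = d \<bullet> (Q *v d)" by (simp add: be_def psd_nonneg[OF Q])
    have le: "al \<le> be" unfolding al_def be_def by (rule ellipsoid_support_le[OF Q u])
    have "(be - al)^2 - d \<bullet> (R *v d) = (g * be - al)^2 / g"
      unfolding form be[symmetric] al_def[symmetric] using g
      by (simp add: power2_eq_square field_simps)
    moreover have "(g * be - al)^2 / g \<ge> 0" using g by simp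
    ultimately have "sqrt (d \<bullet> (R *v d)) \<le> be - al"
      using le by (intro real_le_lsqrt) (auto simp: psd_nonneg[OF R])
    with dv[of d] have "d \<bullet> v \<le> be - al" by linarith
    then show "d \<bullet> (u + v - q) \<le> sqrt (d \<bullet> (Q *v d))"
      by (simp add: al_def be_def inner_diff_right inner_add_right)
  qed
  show "v \<in> ellipsoid 0 Q"
    unfolding ellipsoid_iff_support[OF Q]
  proof
    fix d
    have "d \<bullet> (R *v d) \<le> 1 * (d \<bullet> (Q *v d)) + 0"
      unfolding form using g ig psd_nonneg[OF Q, of d]
      by (intro add_mono mult_right_mono mult_nonpos_nonneg) auto
    then show "d \<bullet> (v - 0) \<le> sqrt (d \<bullet> (Q *v d))"
      using dv[of d] by (simp add: order_trans[OF _ real_sqrt_le_mono])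
  qed
qed

lemma closest_point_ellipsoid_in: "closest_point (ellipsoid q Q) x \<in> ellipsoid q Q"
  by (intro closest_point_in_set closed_ellipsoid) (use center_in_ellipsoid in blast)

text \<open>The direction from the projection to the point is an outer normal there, so the
  projection is a support point. If c \<bullet> Q c is positive the support point is unique: with e
  the normalised c, expanding (z - e) \<bullet> Q (z - e) gives at most 1 - 2 + 1 = 0. If it is 0,
  the functional c is constant on the ellipsoid and does not determine the projection.\<close>

lemma closest_point_ellipsoid_support:
  fixes Q :: "real^'n^'n"
  assumes Q: "psd Q" and x: "x \<notin> ellipsoid q Q"
  defines "y \<equiv> closest_point (ellipsoid q Q) x"
  defines "c \<equiv> (x - y) /\<^sub>R norm (x - y)"
  shows "norm c = 1" "c \<bullet> (x - y) = norm (x - y)" "sqrt (c \<bullet> (Q *v c)) \<le> c \<bullet> (y - q)"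
    "0 < c \<bullet> (Q *v c) \<Longrightarrow> y = q + Q *v (c /\<^sub>R sqrt (c \<bullet> (Q *v c)))"
proof -
  have yE: "y \<in> ellipsoid q Q" unfolding y_def by (rule closest_point_ellipsoid_in)
  have d: "0 < norm (x - y)" using yE x by auto
  then show c: "norm c = 1" by (simp add: c_def)
  show "c \<bullet> (x - y) = norm (x - y)"
    using d by (simp add: c_def power2_norm_eq_inner[symmetric] power2_eq_square)
  obtain y' where y': "y' \<in> ellipsoid q Q" "c \<bullet> (y' - q) = sqrt (c \<bullet> (Q *v c))"
    using ellipsoid_support_attained[OF Q] by metis
  have "(x - y) \<bullet> (y' - y) \<le> 0"
    unfolding y_def by (rule closest_point_dot[OF convex_ellipsoid closed_ellipsoid y'(1)])
  then have "c \<bullet> (y' - y) \<le> 0" using d by (simp add: c_def mult_le_0_iff)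
  then show ge: "sqrt (c \<bullet> (Q *v c)) \<le> c \<bullet> (y - q)" using y'(2) by (simp add: inner_diff_right)
  assume pos: "0 < c \<bullet> (Q *v c)"
  define s where "s = sqrt (c \<bullet> (Q *v c))"
  have s: "0 < s" "s * s = c \<bullet> (Q *v c)" using pos by (auto simp: s_def)
  obtain z where z: "y = q + Q *v z" "z \<bullet> (Q *v z) \<le> 1" using ellipsoidE[OF Q yE] .
  let ?e = "c /\<^sub>R s"
  have ee: "?e \<bullet> (Q *v ?e) = 1" using s pos by (simp add: matrix_vector_mult_scaleR field_simps)
  have "s \<le> c \<bullet> (Q *v z)" using ge z(1) by (simp add: s_def)
  then have "1 \<le> ?e \<bullet> (Q *v z)" using s(1) by (simp add: field_simps)
  moreover have "z \<bullet> (Q *v ?e) = ?e \<bullet> (Q *v z)"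
    using psd_dot_swap[OF Q, of z ?e] by (simp add: inner_commute)
  ultimately have "(z - ?e) \<bullet> (Q *v (z - ?e)) \<le> 0"
    using z(2) ee by (simp add: matrix_vector_mult_diff_distrib inner_diff_left inner_diff_right)
  then have "(z - ?e) \<bullet> (Q *v (z - ?e)) = 0" using psd_nonneg[OF Q, of "z - ?e"] by linarith
  then have "Q *v (z - ?e) = 0" by (simp only: psd_form_eq_0_iff[OF Q])
  then show "y = q + Q *v (c /\<^sub>R sqrt (c \<bullet> (Q *v c)))"
    using z(1) by (simp add: s_def matrix_vector_mult_diff_distrib)
qed

section \<open>Absolutely continuous functions\<close>

lemma abs_continuous_onD:
  assumes "abs_continuous_on I x" "0 < e"
  obtains d where "0 < d"
    "\<And>\<D> T. \<lbrakk>\<D> division_of T; T \<subseteq> I; (\<Sum>k\<in>\<D>. Sup k - Inf k) < d\<rbrakk> \<Longrightarrow>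
      (\<Sum>k\<in>\<D>. norm (x (Sup k) - x (Inf k))) < e"
  using assms unfolding abs_continuous_on_def by metis

lemma abs_continuous_on_subset:
  "abs_continuous_on I x \<Longrightarrow> J \<subseteq> I \<Longrightarrow> abs_continuous_on J x"
  unfolding abs_continuous_on_def by (meson order_trans)

lemma division_of_real_endpoints:
  fixes k :: "real set"
  assumes "\<D> division_of T" "T \<subseteq> I" "k \<in> \<D>"
  shows "Sup k \<in> I" "Inf k \<in> I"
proof -
  obtain u v where k: "k = cbox u v" "k \<noteq> {}" "k \<subseteq> T"
    using assms(1,3) by (metis division_ofD(2,3,4))
  then have "u \<le> v" by auto
  then have "Sup k = v" "Inf k = u" using k(1) by auto
  then show "Sup k \<in> I" "Inf k \<in> I" using k \<open>u \<le> v\<close> assms(2) by auto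
qed

lemma abs_continuous_on_dominated:
  assumes x: "abs_continuous_on I x" and y: "abs_continuous_on I y" and K: "0 \<le> K"
    and le: "\<And>s t. s \<in> I \<Longrightarrow> t \<in> I \<Longrightarrow> norm (z t - z s) \<le> K * (norm (x t - x s) + norm (y t - y s))"
  shows "abs_continuous_on I z"
  unfolding abs_continuous_on_def
proof (intro allI impI)
  fix e :: real assume e: "0 < e"
  \<comment> \<open>\<open>K + 1\<close> keeps the quotient meaningful for \<open>K = 0\<close> and
    makes the final bound strict.\<close>
  define e' where "e' = e / (K + 1) / 2"
  have e': "0 < e'" using e K by (simp add: e'_def)
  obtain d1 where d1: "0 < d1" "\<And>\<D> T. \<lbrakk>\<D> division_of T; T \<subseteq> I; (\<Sum>k\<in>\<D>. Sup k - Inf k) < d1\<rbrakk> \<Longrightarrow>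
      (\<Sum>k\<in>\<D>. norm (x (Sup k) - x (Inf k))) < e'"
    using abs_continuous_onD[OF x e'] by blast
  obtain d2 where d2: "0 < d2" "\<And>\<D> T. \<lbrakk>\<D> division_of T; T \<subseteq> I; (\<Sum>k\<in>\<D>. Sup k - Inf k) < d2\<rbrakk> \<Longrightarrow>
      (\<Sum>k\<in>\<D>. norm (y (Sup k) - y (Inf k))) < e'"
    using abs_continuous_onD[OF y e'] by blast
  show "\<exists>d>0. \<forall>\<D> T. \<D> division_of T \<and> T \<subseteq> I \<and> (\<Sum>k\<in>\<D>. Sup k - Inf k) < d \<longrightarrow>
        (\<Sum>k\<in>\<D>. norm (z (Sup k) - z (Inf k))) < e"
  proof (intro exI[of _ "min d1 d2"] conjI allI impI)
    fix \<D> T assume D: "\<D> division_of T \<and> T \<subseteq> I \<and> (\<Sum>k\<in>\<D>. Sup k - Inf k) < min d1 d2"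
    have "(\<Sum>k\<in>\<D>. norm (z (Sup k) - z (Inf k)))
      \<le> (\<Sum>k\<in>\<D>. K * (norm (x (Sup k) - x (Inf k)) + norm (y (Sup k) - y (Inf k))))"
      using D by (intro sum_mono le) (auto intro: division_of_real_endpoints)
    also have "\<dots> = K * ((\<Sum>k\<in>\<D>. norm (x (Sup k) - x (Inf k))) + (\<Sum>k\<in>\<D>. norm (y (Sup k) - y (Inf k))))"
      by (simp add: sum_distrib_left[symmetric] sum.distrib)
    also have "\<dots> \<le> K * (e' + e')"
      using D d1(2)[of \<D> T] d2(2)[of \<D> T] K by (intro mult_left_mono add_mono) auto
    also have "e' + e' = e / (K + 1)" unfolding e'_def by (rule field_sum_of_halves)
    also have "K * (e / (K + 1)) = e * (K / (K + 1))" by simp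
    also have "\<dots> < e * 1" using K e by (intro mult_strict_left_mono) (auto simp: field_simps)
    finally show "(\<Sum>k\<in>\<D>. norm (z (Sup k) - z (Inf k))) < e" by simp
  qed (use d1 d2 in auto)
qed

lemma abs_continuous_on_diff:
  "abs_continuous_on I x \<Longrightarrow> abs_continuous_on I y \<Longrightarrow> abs_continuous_on I (\<lambda>t. x t - y t)"
proof (rule abs_continuous_on_dominated[where K = 1])
  show "norm (x t - y t - (x s - y s)) \<le> 1 * (norm (x t - x s) + norm (y t - y s))" for s t
    using norm_triangle_ineq4[of "x t - x s" "y t - y s"] by (simp add: algebra_simps)
qed auto

lemma abs_continuous_on_imp_continuous_on:
  fixes x :: "real \<Rightarrow> 'a::real_normed_vector"
  assumes "abs_continuous_on {a..b} x"
  shows "continuous_on {a..b} x"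
proof (rule continuous_onI)
  fix t e :: real assume t: "t \<in> {a..b}" and e: "0 < e"
  obtain d where d: "0 < d" "\<And>\<D> T. \<lbrakk>\<D> division_of T; T \<subseteq> {a..b}; (\<Sum>k\<in>\<D>. Sup k - Inf k) < d\<rbrakk> \<Longrightarrow>
      (\<Sum>k\<in>\<D>. norm (x (Sup k) - x (Inf k))) < e"
    using abs_continuous_onD[OF assms e] by blast
  have seg: "norm (x v - x u) < e" if "u \<in> {a..b}" "v \<in> {a..b}" "u \<le> v" "v - u < d" for u v
  proof -
    have "{cbox u v} division_of cbox u v" using that by (intro division_of_self) auto
    from d(2)[OF this] that show ?thesis by simp
  qed
  have "dist (x s) (x t) \<le> e" if "s \<in> {a..b}" "dist s t < d" for s
    using seg[of s t] seg[of t s] t that by (cases "s \<le> t") (auto simp: dist_norm norm_minus_commute)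
  then show "\<exists>d>0. \<forall>s\<in>{a..b}. dist s t < d \<longrightarrow> dist (x s) (x t) \<le> e" using d(1) by blast
qed

text \<open>Tagged intervals whose tag lies in the exceptional null set are controlled by absolute
  continuity, the others by differentiability at the tag.\<close>

theorem has_integral_derivative_abs_continuous:
  fixes x :: "real \<Rightarrow> 'a::banach"
  assumes ac: "abs_continuous_on {a..b} x" and ab: "a \<le> b" and N: "negligible N"
    and vd: "\<And>t. t \<in> {a..b} - N \<Longrightarrow> (x has_vector_derivative x' t) (at t within {a..b})"
  shows "(x' has_integral (x b - x a)) {a..b}"
proof (rule has_integral_spike[OF N])
  \<comment> \<open>With value 0 on \<open>N\<close>, an interval tagged in \<open>N\<close>
    contributes nothing to the Riemann sum and leaves only its increment of \<open>x\<close> to be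
    estimated.\<close>
  define g where "g t = (if t \<in> N then 0 else x' t)" for t
  show "x' t = g t" if "t \<in> {a..b} - N" for t using that by (simp add: g_def)
  show "(g has_integral x b - x a) {a..b}"
    unfolding has_integral_real
  proof (intro allI impI)
    fix e0 :: real assume e0: "0 < e0"
    define e where "e = e0 / 2 / (b - a + 1)"
    have e: "0 < e" using e0 ab by (simp add: e_def)
    have "\<forall>t. \<exists>d>0. t \<in> {a..b} - N \<longrightarrow>
         (\<forall>y\<in>{a..b}. norm (y-t) < d \<longrightarrow> norm (x y - x t - (y-t) *\<^sub>R x' t) \<le> e * norm (y-t))"
      using vd[unfolded has_vector_derivative_def has_derivative_within_alt] e by (meson zero_less_one)
    then obtain d where d: "\<And>t. 0 < d t"
      "\<And>t y. \<lbrakk>t \<in> {a..b} - N; y \<in> {a..b}; norm (y-t) < d t\<rbrakk>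
                 \<Longrightarrow> norm (x y - x t - (y-t) *\<^sub>R x' t) \<le> e * norm (y-t)"
      by metis
    obtain r where r: "0 < r" "\<And>\<D> T. \<lbrakk>\<D> division_of T; T \<subseteq> {a..b}; (\<Sum>k\<in>\<D>. Sup k - Inf k) < r\<rbrakk> \<Longrightarrow>
      (\<Sum>k\<in>\<D>. norm (x (Sup k) - x (Inf k))) < e"
      using abs_continuous_onD[OF ac e] by blast
    \<comment> \<open>The gauge will confine intervals tagged in \<open>N\<close> to this open set,
      so their total length stays below the modulus \<open>r\<close> of absolute continuity.\<close>
    obtain V where V: "open V" "N \<subseteq> V" "V \<in> lmeasurable" "measure lebesgue V < r"
    proof -
      have nN: "N \<in> sets lebesgue" "emeasure lebesgue N = 0"
        using N by (auto simp: negligible_iff_null_sets)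
      obtain V where V: "open V" "N \<subseteq> V" "V - N \<in> lmeasurable" "emeasure lebesgue (V - N) < ennreal r"
        using sets_lebesgue_outer_open[OF nN(1) r(1)] by metis
      have "N \<in> lmeasurable" using N negligible_iff_measure by blast
      then have "(V - N) \<union> N \<in> lmeasurable" using V(3) by blast
      moreover have VN: "(V - N) \<union> N = V" using V(2) by blast
      ultimately have "V \<in> lmeasurable" by simp
      moreover have "emeasure lebesgue V = emeasure lebesgue (V - N)"
        using V(3) N by (metis VN emeasure_Un_null_set fmeasurableD negligible_iff_null_sets)
      ultimately show thesis
        using V by (intro that[of V]) (simp_all add: emeasure_eq_measure2 r(1) ennreal_less_iff)
    qed
    have "\<forall>t. \<exists>\<rho>>0. t \<in> N \<longrightarrow> ball t \<rho> \<subseteq> V"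
      using V(1,2) by (meson open_contains_ball subsetD zero_less_one)
    then obtain \<rho> where \<rho>: "\<And>t. 0 < \<rho> t" "\<And>t. t \<in> N \<Longrightarrow> ball t (\<rho> t) \<subseteq> V" by metis
    let ?\<gamma> = "\<lambda>t. ball t (min (d t) (\<rho> t))"
    show "\<exists>\<gamma>. gauge \<gamma> \<and> (\<forall>\<D>. \<D> tagged_division_of {a..b} \<and> \<gamma> fine \<D> \<longrightarrow>
        norm ((\<Sum>(t,k)\<in>\<D>. measure lborel k *\<^sub>R g t) - (x b - x a)) < e0)"
    proof (intro exI[of _ ?\<gamma>] conjI allI impI)
      show "gauge ?\<gamma>" using d(1) \<rho>(1) by (intro gauge_ball_dependent) simp
      fix p assume p: "p tagged_division_of {a..b} \<and> ?\<gamma> fine p"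
      then have ptag: "p tagged_division_of {a..b}" and fine: "?\<gamma> fine p" by auto
      have fin: "finite p" using ptag by blast
      have ba: "b - a = (\<Sum>(t,k)\<in>p. Sup k - Inf k)" "x b - x a = (\<Sum>(t,k)\<in>p. x (Sup k) - x (Inf k))"
        using additive_tagged_division_1[OF ab ptag, of "\<lambda>x. x"]
          additive_tagged_division_1[OF ab ptag, of x] by auto
      define pN where "pN = {tk \<in> p. fst tk \<in> N}"
      have K: "\<exists>u v. k = {u..v} \<and> u \<le> v \<and> t \<in> {u..v} \<and> u \<in> {a..b} \<and> v \<in> {a..b} \<and>
          Sup k = v \<and> Inf k = u \<and> measure lborel k = v - u \<and> u \<in> ?\<gamma> t \<and> v \<in> ?\<gamma> t" if tk: "(t, k) \<in> p" for t k
      proof -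
        obtain u v where k: "k = cbox u v" "t \<in> k" "k \<subseteq> {a..b}"
          using ptag tk by (metis tagged_division_ofD(2-4))
        then have uv: "u \<le> v" by auto
        have "k \<subseteq> ?\<gamma> t" using fine tk by (auto simp: fine_def)
        then have "u \<in> ?\<gamma> t" "v \<in> ?\<gamma> t" using uv k(1) by auto
        then show ?thesis using k uv by auto
      qed
      have nonneg: "0 \<le> Sup k - Inf k" if "(t, k) \<in> p" for t k using K[OF that] by auto
      have "norm (\<Sum>(t,k)\<in>p - pN. measure lborel k *\<^sub>R g t - (x (Sup k) - x (Inf k)))
          \<le> (\<Sum>(t,k)\<in>p - pN. e * (Sup k - Inf k))"
      proof (rule sum_norm_le, safe)
        fix t k assume tk: "(t, k) \<in> p" and "(t, k) \<notin> pN"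
        then have tN: "t \<notin> N" by (auto simp: pN_def)
        obtain u v where k: "k = {u..v}" "u \<le> v" "t \<in> {u..v}" "u \<in> {a..b}" "v \<in> {a..b}"
          "Sup k = v" "Inf k = u" "measure lborel k = v - u" "u \<in> ?\<gamma> t" "v \<in> ?\<gamma> t"
          using K[OF tk] by metis
        have t: "t \<in> {a..b} - N" using k tN by auto
        have "measure lborel k *\<^sub>R g t - (x (Sup k) - x (Inf k))
            = (x u - x t - (u - t) *\<^sub>R x' t) - (x v - x t - (v - t) *\<^sub>R x' t)"
          using tN k by (simp add: g_def algebra_simps)
        also have "norm \<dots> \<le> norm (x u - x t - (u - t) *\<^sub>R x' t) + norm (x v - x t - (v - t) *\<^sub>R x' t)"
          by (rule norm_triangle_ineq4)
        also have "\<dots> \<le> e * norm (u - t) + e * norm (v - t)"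
          using k t by (intro add_mono d(2)) (auto simp: dist_real_def)
        also have "\<dots> = e * (Sup k - Inf k)" using k by (simp add: algebra_simps)
        finally show "norm (measure lborel k *\<^sub>R g t - (x (Sup k) - x (Inf k))) \<le> e * (Sup k - Inf k)" .
      qed
      also have "\<dots> \<le> (\<Sum>(t,k)\<in>p. e * (Sup k - Inf k))"
        using fin nonneg e by (intro sum_mono2) auto
      also have "\<dots> = e * (b - a)" by (simp add: ba(1) sum_distrib_left case_prod_unfold)
      finally have 1: "norm (\<Sum>(t,k)\<in>p - pN. measure lborel k *\<^sub>R g t - (x (Sup k) - x (Inf k))) \<le> e * (b - a)" .
      have pN: "pN tagged_division_of \<Union>(snd ` pN)"
      proof (rule tagged_partial_division_of_Union_self[OF tagged_partial_division_subset])
        show "p tagged_partial_division_of {a..b}" using ptag by (simp add: tagged_division_of_def)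
      qed (simp add: pN_def)
      note div = division_of_tagged_division[OF pN]
      have sub: "\<Union>(snd ` pN) \<subseteq> {a..b}"
        using tagged_division_ofD(3)[OF ptag] by (fastforce simp: pN_def)
      have subV: "\<Union>(snd ` pN) \<subseteq> V"
      proof safe
        fix t k s assume tk: "(t, k) \<in> pN" "s \<in> snd (t, k)"
        then have "k \<subseteq> ?\<gamma> t" using fine by (auto simp: fine_def pN_def)
        then have "s \<in> ball t (\<rho> t)" using tk by auto
        then show "s \<in> V" using \<rho>(2)[of t] tk by (auto simp: pN_def)
      qed
      have "(\<Sum>k\<in>snd ` pN. Sup k - Inf k) = (\<Sum>k\<in>snd ` pN. measure lebesgue k)"
      proof (rule sum.cong[OF refl])
        fix k assume "k \<in> snd ` pN"
        then obtain t where "(t, k) \<in> p" by (auto simp: pN_def)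
        from K[OF this] obtain u v where "k = {u..v}" "u \<le> v" by metis
        then show "Sup k - Inf k = measure lebesgue k" by simp
      qed
      also have "\<dots> = measure lebesgue (\<Union>(snd ` pN))" by (rule content_division[OF div])
      also have "\<dots> \<le> measure lebesgue V"
        using subV V(3) lmeasurable_division[OF div] by (intro measure_mono_fmeasurable) auto
      finally have "(\<Sum>k\<in>snd ` pN. norm (x (Sup k) - x (Inf k))) < e"
        using r(2)[OF div sub] V(4) by simp
      moreover have "(\<Sum>(t,k)\<in>pN. norm (x (Sup k) - x (Inf k))) = (\<Sum>k\<in>snd ` pN. norm (x (Sup k) - x (Inf k)))"
      proof -
        \<comment> \<open>Passing from a sum over tagged intervals to one over intervals requires a
          function vanishing on degenerate boxes. Points do so by themselves; the empty box, where
          \<open>Sup\<close> and \<open>Inf\<close> say nothing, is set to 0.\<close>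
        let ?n = "\<lambda>k. if k = {} then 0 else norm (x (Sup k) - x (Inf k))"
        have ne: "k \<noteq> {}" if "(t, k) \<in> pN" for t k using K[of t k] that by (auto simp: pN_def)
        have "(\<Sum>(t,k)\<in>pN. norm (x (Sup k) - x (Inf k))) = (\<Sum>(t,k)\<in>pN. ?n k)"
          using ne by (intro sum.cong) auto
        also have "\<dots> = (\<Sum>k\<in>snd ` pN. ?n k)"
          by (rule sum.over_tagged_division_lemma[OF pN]) auto
        also have "\<dots> = (\<Sum>k\<in>snd ` pN. norm (x (Sup k) - x (Inf k)))"
          using ne by (intro sum.cong) auto
        finally show ?thesis .
      qed
      moreover have "norm (\<Sum>(t,k)\<in>pN. measure lborel k *\<^sub>R g t - (x (Sup k) - x (Inf k)))
          \<le> (\<Sum>(t,k)\<in>pN. norm (x (Sup k) - x (Inf k)))"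
        by (rule sum_norm_le) (auto simp: pN_def g_def norm_minus_commute)
      ultimately have 2: "norm (\<Sum>(t,k)\<in>pN. measure lborel k *\<^sub>R g t - (x (Sup k) - x (Inf k))) < e" by linarith
      have "(\<Sum>(t,k)\<in>p. measure lborel k *\<^sub>R g t) - (x b - x a)
          = (\<Sum>(t,k)\<in>p. measure lborel k *\<^sub>R g t - (x (Sup k) - x (Inf k)))"
        by (simp add: ba(2) sum_subtractf case_prod_unfold)
      also have "\<dots> = (\<Sum>(t,k)\<in>p - pN. measure lborel k *\<^sub>R g t - (x (Sup k) - x (Inf k)))
          + (\<Sum>(t,k)\<in>pN. measure lborel k *\<^sub>R g t - (x (Sup k) - x (Inf k)))"
        using fin by (intro sum.subset_diff) (auto simp: pN_def)
      finally have "norm ((\<Sum>(t,k)\<in>p. measure lborel k *\<^sub>R g t) - (x b - x a)) < e * (b - a) + e"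
        using 1 2 by (simp add: order_le_less_trans[OF norm_triangle_ineq add_le_less_mono])
      also have "\<dots> = e * (b - a + 1)" by (simp add: algebra_simps)
      also have "\<dots> = e0 / 2" using ab by (intro nonzero_eq_divide_eq[THEN iffD1] e_def) simp
      finally show "norm ((\<Sum>(t,k)\<in>p. measure lborel k *\<^sub>R g t) - (x b - x a)) < e0" using e0 by simp
    qed
  qed
qed

lemmas tendsto_matrix_vector_mult [tendsto_intros] =
  bounded_bilinear.tendsto[OF bounded_bilinear_matrix_vector_mult]
lemmas continuous_on_matrix_vector_mult [continuous_intros] =
  bounded_bilinear.continuous_on[OF bounded_bilinear_matrix_vector_mult]

text \<open>The projection has a closed graph: a limit of points of the ellipsoids lies in the limit
  ellipsoid by the support function criterion, and every point of the limit ellipsoid is a limit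
  of such points by rescaling.\<close>

lemma continuous_on_closest_point_ellipsoid:
  fixes q :: "real \<Rightarrow> real^'n"
  assumes I: "compact I" and q: "continuous_on I q" and Q: "continuous_on I Q"
    and psd: "\<And>t. t \<in> I \<Longrightarrow> psd (Q t)"
  shows "continuous_on (I \<times> UNIV) (\<lambda>(t, x). closest_point (ellipsoid (q t) (Q t)) x)"
proof -
  let ?f = "\<lambda>(t, x). closest_point (ellipsoid (q t) (Q t)) x"
  have "continuous_on I (\<lambda>t. norm (q t) + sqrt (norm (Q t)))"
    by (intro continuous_intros q Q)
  then obtain R where R: "\<And>t. t \<in> I \<Longrightarrow> norm (q t) + sqrt (norm (Q t)) \<le> R"
    using compact_continuous_image[OF _ I] compact_imp_bounded bounded_real
    by (metis (no_types, lifting) abs_le_D1 imageI)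
  show ?thesis
  proof (rule continuous_from_closed_graph)
    \<comment> \<open>A closed graph yields continuity only for values in a compact set; the
      ellipsoids over the compact set of times all lie in one ball.\<close>
    show "compact (cball (0::real^'n) R)" by simp
    show "?f \<in> I \<times> UNIV \<rightarrow> cball 0 R"
    proof (clarsimp simp: Pi_def)
      fix t and x :: "real^'n" assume t: "t \<in> I"
      have "norm (closest_point (ellipsoid (q t) (Q t)) x - q t) \<le> sqrt (norm (Q t))"
        by (rule ellipsoid_norm_le[OF psd[OF t] closest_point_ellipsoid_in])
      then show "norm (closest_point (ellipsoid (q t) (Q t)) x) \<le> R"
        using R[OF t] norm_triangle_sub[of "closest_point (ellipsoid (q t) (Q t)) x" "q t"] by linarith
    qed
    show "closed ((\<lambda>p. (p, ?f p)) ` (I \<times> UNIV))"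
      unfolding closed_sequential_limits
    proof (intro allI impI, elim conjE)
      fix h l assume h: "\<forall>n. h n \<in> (\<lambda>p. (p, ?f p)) ` (I \<times> UNIV)" and lim: "h \<longlonglongrightarrow> l"
      obtain t x y where l: "l = ((t, x), y)" by (metis surj_pair)
      define T X where "T n = fst (fst (h n))" and "X n = snd (fst (h n))" for n
      define Y where "Y n = closest_point (ellipsoid (q (T n)) (Q (T n))) (X n)" for n
      have hn: "T n \<in> I" "h n = ((T n, X n), Y n)" for n
        using h[rule_format, of n] by (auto simp: T_def X_def Y_def)
      have T: "T \<longlonglongrightarrow> t" and X: "X \<longlonglongrightarrow> x" and Y: "Y \<longlonglongrightarrow> y"
        using tendsto_fst[OF tendsto_fst[OF lim]] tendsto_snd[OF tendsto_fst[OF lim]] tendsto_snd[OF lim]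
        by (simp_all add: hn(2) l)
      have tI: "t \<in> I" using closed_sequentially[OF compact_imp_closed[OF I] hn(1) T] .
      have qT: "(\<lambda>n. q (T n)) \<longlonglongrightarrow> q t" and QT: "(\<lambda>n. Q (T n)) \<longlonglongrightarrow> Q t"
        using continuous_on_tendsto_compose[OF q T tI] continuous_on_tendsto_compose[OF Q T tI] hn(1)
        by auto
      have YE: "Y n \<in> ellipsoid (q (T n)) (Q (T n))" for n unfolding Y_def by (rule closest_point_ellipsoid_in)
      have yE: "y \<in> ellipsoid (q t) (Q t)"
        unfolding ellipsoid_iff_support[OF psd[OF tI]]
      proof
        fix c
        show "c \<bullet> (y - q t) \<le> sqrt (c \<bullet> (Q t *v c))"
        proof (rule LIMSEQ_le)
          show "(\<lambda>n. c \<bullet> (Y n - q (T n))) \<longlonglongrightarrow> c \<bullet> (y - q t)" by (intro tendsto_intros Y qT)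
          show "(\<lambda>n. sqrt (c \<bullet> (Q (T n) *v c))) \<longlonglongrightarrow> sqrt (c \<bullet> (Q t *v c))" by (intro tendsto_intros QT)
          show "\<exists>N. \<forall>n\<ge>N. c \<bullet> (Y n - q (T n)) \<le> sqrt (c \<bullet> (Q (T n) *v c))"
            using ellipsoid_support_le[OF psd[OF hn(1)] YE] by blast
        qed
      qed
      have "y = closest_point (ellipsoid (q t) (Q t)) x"
      proof (rule closest_point_unique[OF convex_ellipsoid closed_ellipsoid yE], rule ballI)
        fix v assume "v \<in> ellipsoid (q t) (Q t)"
        then obtain z where z: "v = q t + Q t *v z" "z \<bullet> (Q t *v z) \<le> 1"
          using ellipsoidE[OF psd[OF tI]] by metis
        define m where "m n = max 1 (sqrt (z \<bullet> (Q (T n) *v z)))" for n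
        define v' where "v' n = q (T n) + Q (T n) *v (z /\<^sub>R m n)" for n
        have "m \<longlonglongrightarrow> max 1 (sqrt (z \<bullet> (Q t *v z)))" unfolding m_def by (intro tendsto_intros QT)
        then have "m \<longlonglongrightarrow> 1" using z(2) by (simp add: max_absorb1)
        then have "v' \<longlonglongrightarrow> q t + Q t *v (z /\<^sub>R 1)"
          unfolding v'_def by (intro tendsto_intros QT qT) auto
        then have v': "v' \<longlonglongrightarrow> v" using z(1) by simp
        have "v' n \<in> ellipsoid (q (T n)) (Q (T n))" for n
          unfolding v'_def
        proof (rule ellipsoidI[OF psd[OF hn(1)]])
          have "z \<bullet> (Q (T n) *v z) \<le> m n * m n"
            using psd_nonneg[OF psd[OF hn(1)], of z n]
            by (metis abs_of_nonneg m_def max.cobounded2 mult_mono' real_sqrt_ge_zero real_sqrt_mult_self)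
          moreover have "1 \<le> m n" by (simp add: m_def)
          ultimately show "(z /\<^sub>R m n) \<bullet> (Q (T n) *v (z /\<^sub>R m n)) \<le> 1"
            by (simp add: matrix_vector_mult_scaleR field_simps)
        qed
        then have "dist (X n) (Y n) \<le> dist (X n) (v' n)" for n
          unfolding Y_def by (intro closest_point_le closed_ellipsoid)
        then show "dist x y \<le> dist x v"
          using LIMSEQ_le[OF tendsto_dist[OF X Y] tendsto_dist[OF X v']] by blast
      qed
      then show "l \<in> (\<lambda>p. (p, ?f p)) ` (I \<times> UNIV)" using tI l by auto
    qed
  qed
qed

section \<open>The regularised distance from an ellipsoid\<close>

text \<open>Dual formula for the distance from a convex set: the largest excess over the support
  function among unit directions. \<open>\<xi>\<close> is the position relative to the centre of the
  ellipsoid with matrix \<open>P\<close>; inside the ellipsoid the value is at most 0.\<close>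

definition signed_dist :: "real^'n \<Rightarrow> real^'n^'n \<Rightarrow> real" where
  "signed_dist \<xi> P = (SUP c\<in>sphere 0 1. c \<bullet> \<xi> - sqrt (c \<bullet> (P *v c)))"

lemma signed_dist_attained:
  fixes \<xi> :: "real^'n"
  obtains c where "norm c = 1" "signed_dist \<xi> P = c \<bullet> \<xi> - sqrt (c \<bullet> (P *v c))"
    "\<And>c'. norm c' = 1 \<Longrightarrow> c' \<bullet> \<xi> - sqrt (c' \<bullet> (P *v c')) \<le> signed_dist \<xi> P"
proof -
  let ?F = "\<lambda>c. c \<bullet> \<xi> - sqrt (c \<bullet> (P *v c))"
  have "continuous_on (sphere 0 1) ?F" by (intro continuous_intros)
  moreover have "sphere (0::real^'n) 1 \<noteq> {}" by (simp add: sphere_eq_empty)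
  ultimately obtain c where c: "c \<in> sphere 0 1" "\<And>c'. c' \<in> sphere 0 1 \<Longrightarrow> ?F c' \<le> ?F c"
    using continuous_attains_sup[of "sphere 0 1" ?F] by auto
  have "signed_dist \<xi> P = ?F c"
    unfolding signed_dist_def
    by (rule cSup_eq_maximum) (use c in auto)
  then show thesis using c that by auto
qed

lemma signed_dist_upper:
  "norm c = 1 \<Longrightarrow> c \<bullet> \<xi> - sqrt (c \<bullet> (P *v c)) \<le> signed_dist \<xi> P"
  by (metis signed_dist_attained)

lemma sqrt_diff_le:
  assumes "0 < e" "e \<le> a" "e \<le> b"
  shows "\<bar>sqrt a - sqrt b\<bar> \<le> \<bar>a - b\<bar> / sqrt e"
proof -
  have "a - b = (sqrt a - sqrt b) * (sqrt a + sqrt b)"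
    using assms by (simp add: algebra_simps)
  then have "\<bar>a - b\<bar> = \<bar>sqrt a - sqrt b\<bar> * \<bar>sqrt a + sqrt b\<bar>"
    by (simp only: abs_mult)
  also have "\<dots> \<ge> \<bar>sqrt a - sqrt b\<bar> * sqrt e"
  proof (rule mult_left_mono)
    have "0 \<le> sqrt b" "sqrt e \<le> sqrt a" using assms by auto
    then show "sqrt e \<le> \<bar>sqrt a + sqrt b\<bar>" by linarith
  qed simp
  finally show ?thesis using assms by (simp add: pos_le_divide_eq)
qed

text \<open>Inserting the maximising direction of one argument into the other leaves a difference of
  support functions. The lower bound \<open>e\<close> keeps the root Lipschitz, and this is how
  regularisation restores absolute continuity in time.\<close>

lemma signed_dist_lipschitz:
  assumes e: "0 < e" and P: "\<And>c. norm c = 1 \<Longrightarrow> e \<le> c \<bullet> (P *v c)"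
    and P': "\<And>c. norm c = 1 \<Longrightarrow> e \<le> c \<bullet> (P' *v c)"
  shows "\<bar>signed_dist \<xi> P - signed_dist \<xi>' P'\<bar> \<le> norm (\<xi> - \<xi>') + norm (P - P') / sqrt e"
proof -
  have *: "signed_dist \<xi> P - signed_dist \<xi>' P' \<le> norm (\<xi> - \<xi>') + norm (P - P') / sqrt e"
    if P: "\<And>c. norm c = 1 \<Longrightarrow> e \<le> c \<bullet> (P *v c)"
      and P': "\<And>c. norm c = 1 \<Longrightarrow> e \<le> c \<bullet> (P' *v c)" for \<xi> \<xi>' and P P' :: "real^'a^'a"
  proof -
    obtain c where c: "norm c = 1" "signed_dist \<xi> P = c \<bullet> \<xi> - sqrt (c \<bullet> (P *v c))"
      using signed_dist_attained by metis
    have "signed_dist \<xi> P - signed_dist \<xi>' P'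
        \<le> c \<bullet> (\<xi> - \<xi>') + \<bar>sqrt (c \<bullet> (P *v c)) - sqrt (c \<bullet> (P' *v c))\<bar>"
      using c(2) signed_dist_upper[OF c(1), of \<xi>' P'] by (simp add: inner_diff_right)
    also have "\<dots> \<le> norm (\<xi> - \<xi>') + \<bar>c \<bullet> (P *v c) - c \<bullet> (P' *v c)\<bar> / sqrt e"
      using norm_cauchy_schwarz[of c "\<xi> - \<xi>'"] c(1) P[OF c(1)] P'[OF c(1)] e
      by (intro add_mono sqrt_diff_le) auto
    also have "c \<bullet> (P *v c) - c \<bullet> (P' *v c) = c \<bullet> ((P - P') *v c)"
      by (simp add: matrix_vector_mult_diff_rdistrib inner_diff_right)
    also have "\<bar>c \<bullet> ((P - P') *v c)\<bar> \<le> norm (P - P')"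
      using dot_matrix_vector_mult_le[of c "P - P'" c] c(1) by simp
    finally show ?thesis using e by (simp add: divide_right_mono)
  qed
  show ?thesis
    using *[OF P P', of \<xi> \<xi>'] *[OF P' P, of \<xi>' \<xi>] by (simp add: norm_minus_commute abs_le_iff)
qed

text \<open>First order condition for the maximiser, in the form of a homogeneous minimisation problem
  on the whole space.\<close>

lemma signed_dist_maximizer:
  fixes P :: "real^'n^'n"
  assumes sym: "transpose P = P" and c: "norm c = 1" "signed_dist \<xi> P = c \<bullet> \<xi> - sqrt (c \<bullet> (P *v c))"
    and pos: "0 < c \<bullet> (P *v c)"
  shows "\<xi> = P *v (c /\<^sub>R sqrt (c \<bullet> (P *v c))) + signed_dist \<xi> P *\<^sub>R c"
proof -
  let ?s = "sqrt (c \<bullet> (P *v c))" and ?\<phi> = "signed_dist \<xi> P"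
  have ge: "0 \<le> ?\<phi> * norm v - v \<bullet> \<xi> + sqrt (v \<bullet> (P *v v))" for v
  proof (cases "v = 0")
    case False
    have "(v /\<^sub>R norm v) \<bullet> \<xi> - sqrt ((v /\<^sub>R norm v) \<bullet> (P *v (v /\<^sub>R norm v))) \<le> ?\<phi>"
      using False by (intro signed_dist_upper) simp
    also have "(v /\<^sub>R norm v) \<bullet> (P *v (v /\<^sub>R norm v)) = (v \<bullet> (P *v v)) / (norm v)^2"
      by (simp add: matrix_vector_mult_scaleR divide_inverse power2_eq_square)
    also have "sqrt ((v \<bullet> (P *v v)) / (norm v)^2) = sqrt (v \<bullet> (P *v v)) / norm v"
      by (simp add: real_sqrt_divide)
    finally have "(v \<bullet> \<xi> - sqrt (v \<bullet> (P *v v))) / norm v \<le> ?\<phi>"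
      by (simp add: divide_inverse algebra_simps)
    then show ?thesis using False by (simp add: pos_divide_le_eq)
  qed simp
  have "(P *v (c /\<^sub>R ?s) + ?\<phi> *\<^sub>R c - \<xi>) \<bullet> v = 0" for v
  proof -
    \<comment> \<open>The nonnegative functional of \<open>ge\<close>, expanded along the line
      through \<open>c\<close> with direction \<open>v\<close>. It is 0 at the maximiser, hence
      minimal there, and differentiable because both radicands are positive at 0.\<close>
    let ?h = "\<lambda>\<tau>. ?\<phi> * sqrt (1 + 2 * \<tau> * (c \<bullet> v) + \<tau>^2 * (v \<bullet> v)) - (c \<bullet> \<xi> + \<tau> * (v \<bullet> \<xi>))
      + sqrt (c \<bullet> (P *v c) + 2 * \<tau> * (v \<bullet> (P *v c)) + \<tau>^2 * (v \<bullet> (P *v v)))"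
    have h: "?h \<tau> = ?\<phi> * norm (c + \<tau> *\<^sub>R v) - (c + \<tau> *\<^sub>R v) \<bullet> \<xi> + sqrt ((c + \<tau> *\<^sub>R v) \<bullet> (P *v (c + \<tau> *\<^sub>R v)))" for \<tau>
    proof -
      have "(c + \<tau> *\<^sub>R v) \<bullet> (c + \<tau> *\<^sub>R v) = 1 + 2 * \<tau> * (c \<bullet> v) + \<tau>^2 * (v \<bullet> v)"
        using c(1) by (simp add: inner_add_left inner_add_right norm_eq_1 power2_eq_square inner_commute algebra_simps)
      moreover have "(c + \<tau> *\<^sub>R v) \<bullet> (P *v (c + \<tau> *\<^sub>R v))
          = c \<bullet> (P *v c) + 2 * \<tau> * (v \<bullet> (P *v c)) + \<tau>^2 * (v \<bullet> (P *v v))"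
        using symmetric_dot_swap[OF sym, of c v]
        by (simp add: inner_add_left inner_add_right matrix_vector_right_distrib matrix_vector_mult_scaleR
            power2_eq_square inner_commute algebra_simps)
      ultimately show ?thesis by (simp add: norm_eq_sqrt_inner inner_add_left)
    qed
    have "(?h has_real_derivative (?\<phi> * (c \<bullet> v) - v \<bullet> \<xi> + (v \<bullet> (P *v c)) / ?s)) (at 0)"
      using pos by (auto intro!: derivative_eq_intros simp: field_simps)
    moreover have "\<forall>\<tau>. \<bar>0 - \<tau>\<bar> < 1 \<longrightarrow> ?h 0 \<le> ?h \<tau>"
    proof (intro allI impI)
      fix \<tau>
      have "?h 0 = 0" using c(2) by simp
      also have "0 \<le> ?h \<tau>" unfolding h by (rule ge)
      finally show "?h 0 \<le> ?h \<tau>" .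
    qed
    ultimately have "?\<phi> * (c \<bullet> v) - v \<bullet> \<xi> + (v \<bullet> (P *v c)) / ?s = 0"
      by (intro DERIV_local_min[where d = 1]) auto
    then show ?thesis
      by (simp add: inner_add_left inner_diff_left matrix_vector_mult_scaleR inner_commute divide_inverse algebra_simps)
  qed
  then have "P *v (c /\<^sub>R ?s) + ?\<phi> *\<^sub>R c - \<xi> = 0" by (metis inner_eq_zero_iff)
  then show ?thesis by simp
qed

lemma has_real_derivative_sandwich:
  fixes l u f :: "real \<Rightarrow> real"
  assumes l: "(l has_real_derivative D) (at t within S)" and u: "(u has_real_derivative D) (at t within S)"
    and eq: "l t = f t" "u t = f t" and le: "\<And>s. s \<in> S \<Longrightarrow> l s \<le> f s \<and> f s \<le> u s"
  shows "(f has_real_derivative D) (at t within S)"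
  unfolding has_field_derivative_def has_derivative_within_alt
proof (intro conjI allI impI)
  fix e :: real assume e: "0 < e"
  obtain d1 where d1: "0 < d1" "\<And>y. \<lbrakk>y \<in> S; norm (y - t) < d1\<rbrakk> \<Longrightarrow> norm (l y - l t - D * (y - t)) \<le> e * norm (y - t)"
    using l e unfolding has_field_derivative_def has_derivative_within_alt by blast
  obtain d2 where d2: "0 < d2" "\<And>y. \<lbrakk>y \<in> S; norm (y - t) < d2\<rbrakk> \<Longrightarrow> norm (u y - u t - D * (y - t)) \<le> e * norm (y - t)"
    using u e unfolding has_field_derivative_def has_derivative_within_alt by blast
  show "\<exists>d>0. \<forall>y\<in>S. norm (y - t) < d \<longrightarrow> norm (f y - f t - D * (y - t)) \<le> e * norm (y - t)"
  proof (intro exI[of _ "min d1 d2"] conjI ballI impI)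
    fix y assume y: "y \<in> S" "norm (y - t) < min d1 d2"
    show "norm (f y - f t - D * (y - t)) \<le> e * norm (y - t)"
      using d1(2)[of y] d2(2)[of y] y le[OF y(1)] eq by (simp add: abs_le_iff)
  qed (use d1 d2 in auto)
qed (rule bounded_linear_mult_right)

text \<open>The signed distance is squeezed between the value at the fixed direction \<open>c\<close> and the
  distance to the support point in direction \<open>c\<close>, which have the same derivative.\<close>

lemma signed_dist_has_derivative:
  fixes \<xi> :: "real \<Rightarrow> real^'n"
  assumes \<xi>: "(\<xi> has_vector_derivative \<xi>') (at t within I)"
    and P: "(P has_vector_derivative D) (at t within I)"
    and psd: "\<And>s. s \<in> I \<Longrightarrow> psd (P s)" and pos: "\<And>s c. s \<in> I \<Longrightarrow> norm c = 1 \<Longrightarrow> 0 < c \<bullet> (P s *v c)"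
    and t: "t \<in> I" and phi: "0 < signed_dist (\<xi> t) (P t)"
    and c: "norm c = 1" "signed_dist (\<xi> t) (P t) = c \<bullet> \<xi> t - sqrt (c \<bullet> (P t *v c))"
  shows "((\<lambda>s. signed_dist (\<xi> s) (P s)) has_real_derivative
           (c \<bullet> \<xi>' - (c \<bullet> (D *v c)) / (2 * sqrt (c \<bullet> (P t *v c))))) (at t within I)"
proof (rule has_real_derivative_sandwich)
  let ?s = "\<lambda>s. sqrt (c \<bullet> (P s *v c))"
  let ?\<eta> = "\<lambda>s. \<xi> s - inverse (?s s) *\<^sub>R (P s *v c)"
  have Pt: "0 < c \<bullet> (P t *v c)" using pos[OF t c(1)] .
  have dP: "((\<lambda>s. P s *v c) has_vector_derivative D *v c) (at t within I)"
    by (rule bounded_linear.has_vector_derivative[OF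
          bounded_bilinear.bounded_linear_left[OF bounded_bilinear_matrix_vector_mult] P])
  have "((\<lambda>s. c \<bullet> (P s *v c)) has_vector_derivative c \<bullet> (D *v c)) (at t within I)"
    by (rule bounded_linear.has_vector_derivative[OF bounded_linear_inner_right dP])
  then have dc: "((\<lambda>s. c \<bullet> (P s *v c)) has_real_derivative c \<bullet> (D *v c)) (at t within I)"
    by (simp add: has_real_derivative_iff_has_vector_derivative)
  have ds: "(?s has_real_derivative (c \<bullet> (D *v c)) / (2 * ?s t)) (at t within I)"
    using dc Pt by (auto intro!: derivative_eq_intros simp: field_simps)
  have "((\<lambda>s. c \<bullet> \<xi> s) has_vector_derivative c \<bullet> \<xi>') (at t within I)"
    by (rule bounded_linear.has_vector_derivative[OF bounded_linear_inner_right \<xi>])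
  then have "((\<lambda>s. c \<bullet> \<xi> s) has_real_derivative c \<bullet> \<xi>') (at t within I)"
    by (simp add: has_real_derivative_iff_has_vector_derivative)
  from DERIV_diff[OF this ds]
  show "((\<lambda>s. c \<bullet> \<xi> s - ?s s) has_real_derivative
           (c \<bullet> \<xi>' - (c \<bullet> (D *v c)) / (2 * ?s t))) (at t within I)" .
  have eta: "?\<eta> t = signed_dist (\<xi> t) (P t) *\<^sub>R c"
  proof -
    have "transpose (P t) = P t" using psd[OF t] by (simp add: psd_def)
    from signed_dist_maximizer[OF this c Pt]
    have "\<xi> t - P t *v (c /\<^sub>R ?s t) = signed_dist (\<xi> t) (P t) *\<^sub>R c"
      by (metis add_diff_cancel_left')
    then show ?thesis by (simp only: matrix_vector_mult_scaleR)
  qed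
  have di: "((\<lambda>s. inverse (?s s)) has_real_derivative - ((c \<bullet> (D *v c)) / (2 * ?s t) / (?s t)^2)) (at t within I)"
  proof (rule DERIV_cong[OF DERIV_inverse_fun[OF ds]])
    show "?s t \<noteq> 0" using Pt by simp
    show "- ((c \<bullet> (D *v c)) / (2 * ?s t) * inverse ((?s t)^Suc (Suc 0))) = - ((c \<bullet> (D *v c)) / (2 * ?s t) / (?s t)^2)"
      unfolding numeral_2_eq_2 by (simp only: divide_inverse)
  qed
  let ?\<eta>' = "\<xi>' - (inverse (?s t) *\<^sub>R (D *v c) + (- ((c \<bullet> (D *v c)) / (2 * ?s t) / (?s t)^2)) *\<^sub>R (P t *v c))"
  have "(?\<eta> has_vector_derivative ?\<eta>') (at t within I)"
    by (intro has_vector_derivative_diff \<xi> has_vector_derivative_scaleR di dP)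
  then have "(?\<eta> has_derivative (\<lambda>h. h *\<^sub>R ?\<eta>')) (at t within I)"
    by (simp add: has_vector_derivative_def)
  \<comment> \<open>A positive signed distance keeps \<open>?\<eta> t\<close> away from the origin,
    where the norm has no derivative.\<close>
  moreover have "(norm has_derivative (\<lambda>h. h \<bullet> sgn (?\<eta> t))) (at (?\<eta> t))"
    using phi c(1) by (intro has_derivative_norm) (auto simp: eta)
  ultimately have "((\<lambda>s. norm (?\<eta> s)) has_derivative (\<lambda>h. (h *\<^sub>R ?\<eta>') \<bullet> sgn (?\<eta> t))) (at t within I)"
    by (rule has_derivative_in_compose[OF _ has_derivative_at_withinI])
  moreover have "sgn (?\<eta> t) = c"
    unfolding eta using phi c(1) by (simp add: sgn_scaleR sgn_div_norm)
  moreover have "?\<eta>' \<bullet> c = c \<bullet> \<xi>' - (c \<bullet> (D *v c)) / (2 * ?s t)"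
  proof -
    have sq: "?s t * ?s t = c \<bullet> (P t *v c)" using Pt by simp
    have "?\<eta>' \<bullet> c = c \<bullet> \<xi>' - (inverse (?s t) * (c \<bullet> (D *v c))
        + - ((c \<bullet> (D *v c)) / (2 * ?s t) / (?s t)^2) * (c \<bullet> (P t *v c)))"
      unfolding inner_commute[of _ c] by (simp only: inner_diff_right inner_add_right inner_scaleR_right)
    also have "\<dots> = c \<bullet> \<xi>' - (inverse (?s t) * (c \<bullet> (D *v c))
        + - ((c \<bullet> (D *v c)) / (2 * ?s t) / (?s t * ?s t)) * (?s t * ?s t))"
      unfolding sq power2_eq_square ..
    also have "\<dots> = c \<bullet> \<xi>' - (c \<bullet> (D *v c)) / (2 * ?s t)"
    proof -
      have "x - (inverse r * d + - (d / (2 * r) / (r * r)) * (r * r)) = x - d / (2 * r)" if "r \<noteq> 0" for x d r :: real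
        using that by (simp add: field_simps)
      from this[of "?s t"] Pt show ?thesis by (metis less_numeral_extra(3) real_sqrt_eq_0_iff)
    qed
    finally show ?thesis .
  qed
  ultimately show "((\<lambda>s. norm (?\<eta> s)) has_real_derivative
           (c \<bullet> \<xi>' - (c \<bullet> (D *v c)) / (2 * ?s t))) (at t within I)"
    unfolding has_field_derivative_def by (simp add: mult.commute[of _ "_ - _"] mult_commute_abs)
  show "c \<bullet> \<xi> t - ?s t = signed_dist (\<xi> t) (P t)" using c(2) by simp
  show "norm (?\<eta> t) = signed_dist (\<xi> t) (P t)" unfolding eta using c(1) phi by simp
  show "c \<bullet> \<xi> s - ?s s \<le> signed_dist (\<xi> s) (P s) \<and> signed_dist (\<xi> s) (P s) \<le> norm (?\<eta> s)" if s: "s \<in> I" for s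
  proof
    show "c \<bullet> \<xi> s - ?s s \<le> signed_dist (\<xi> s) (P s)" by (rule signed_dist_upper[OF c(1)])
    obtain b where b: "norm b = 1" "signed_dist (\<xi> s) (P s) = b \<bullet> \<xi> s - sqrt (b \<bullet> (P s *v b))"
      using signed_dist_attained by metis
    have "b \<bullet> (P s *v c) \<le> sqrt (b \<bullet> (P s *v b)) * ?s s" by (rule psd_Cauchy_Schwarz[OF psd[OF s]])
    then have "inverse (?s s) * (b \<bullet> (P s *v c)) \<le> sqrt (b \<bullet> (P s *v b))"
      using pos[OF s c(1)] by (simp add: field_simps)
    then have "signed_dist (\<xi> s) (P s) \<le> b \<bullet> ?\<eta> s" by (simp add: b(2) inner_diff_right)
    also have "\<dots> \<le> norm (?\<eta> s)" using norm_cauchy_schwarz[of b "?\<eta> s"] b(1) by simp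
    finally show "signed_dist (\<xi> s) (P s) \<le> norm (?\<eta> s)" .
  qed
qed

section \<open>Regularisation by a multiple of the identity, and its limit\<close>

lemma regularized_form: "c \<bullet> (((Q :: real^'n^'n) + e *\<^sub>R mat 1) *v c) = c \<bullet> (Q *v c) + e * (c \<bullet> c)"
  by (simp add: matrix_vector_mult_add_rdistrib scaleR_matrix_vector_assoc[symmetric] inner_add_right)

lemma psd_regularized: "psd Q \<Longrightarrow> 0 \<le> e \<Longrightarrow> psd (Q + e *\<^sub>R mat 1)"
proof -
  assume "psd Q" "0 \<le> e"
  moreover have "transpose (Q + e *\<^sub>R mat 1) = transpose Q + e *\<^sub>R mat 1"
    by (simp add: transpose_def mat_def vec_eq_iff)
  ultimately show ?thesis by (simp add: psd_def regularized_form)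
qed

text \<open>Regularisation enlarges the support function, so it can only bring the ellipsoid closer
  to the point.\<close>

lemma signed_dist_regularized_le:
  fixes Q :: "real^'n^'n"
  assumes Q: "psd Q" and e: "0 < e" and y: "y \<in> ellipsoid q Q"
  shows "signed_dist (x - q) (Q + e *\<^sub>R mat 1) \<le> norm (x - y)"
proof -
  let ?P = "Q + e *\<^sub>R mat 1"
  obtain c where c: "norm c = 1" "signed_dist (x - q) ?P = c \<bullet> (x - q) - sqrt (c \<bullet> (?P *v c))"
    using signed_dist_attained by metis
  have "c \<bullet> (y - q) \<le> sqrt (c \<bullet> (Q *v c))" by (rule ellipsoid_support_le[OF Q y])
  also have "\<dots> \<le> sqrt (c \<bullet> (?P *v c))" using e by (simp add: regularized_form)
  finally have "signed_dist (x - q) ?P \<le> c \<bullet> (x - y)" by (simp add: c(2) inner_diff_right)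
  also have "\<dots> \<le> norm (x - y)" using norm_cauchy_schwarz[of c "x - y"] c(1) by simp
  finally show ?thesis .
qed

text \<open>Tested with the outer normal at the projection, the support function grows by at most
  sqrt e because the root is subadditive.\<close>

lemma signed_dist_regularized_ge:
  fixes Q :: "real^'n^'n"
  assumes Q: "psd Q" and e: "0 < e" and x: "x \<notin> ellipsoid q Q"
  shows "norm (x - closest_point (ellipsoid q Q) x) - sqrt e \<le> signed_dist (x - q) (Q + e *\<^sub>R mat 1)"
proof -
  let ?P = "Q + e *\<^sub>R mat 1" and ?y = "closest_point (ellipsoid q Q) x"
  define c where "c = (x - ?y) /\<^sub>R norm (x - ?y)"
  note c = closest_point_ellipsoid_support[OF Q x, folded c_def]
  have "sqrt (c \<bullet> (?P *v c)) \<le> sqrt (c \<bullet> (Q *v c)) + sqrt e"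
    using psd_nonneg[OF Q, of c] e c(1) by (simp add: regularized_form norm_eq_1 sqrt_add_le_add_sqrt)
  moreover have "c \<bullet> (x - q) = norm (x - ?y) + c \<bullet> (?y - q)" using c(2) by (simp add: inner_diff_right)
  ultimately show ?thesis using c(3) signed_dist_upper[OF c(1), of "x - q" ?P] by linarith
qed

text \<open>The first-order condition displays the point as a vector q + Q z of the original
  ellipsoid plus a multiple r of the maximising direction. Since r tends to the true distance, these
  vectors nearly minimise the distance over a convex set, so they converge to the projection, and
  the directions to the normal.\<close>

lemma regularized_maximizer_tendsto:
  fixes Q :: "real^'n^'n"
  assumes Q: "psd Q" and x: "x \<notin> ellipsoid q Q"
    and e: "\<And>n. 0 < e n" "e \<longlonglongrightarrow> 0"
    and c: "\<And>n. norm (c n) = 1"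
      "\<And>n. signed_dist (x - q) (Q + e n *\<^sub>R mat 1) = c n \<bullet> (x - q) - sqrt (c n \<bullet> ((Q + e n *\<^sub>R mat 1) *v c n))"
  defines "y \<equiv> closest_point (ellipsoid q Q) x"
  shows "c \<longlonglongrightarrow> (x - y) /\<^sub>R norm (x - y)"
    and "(\<lambda>n. Q *v (c n /\<^sub>R sqrt (c n \<bullet> (Q *v c n) + e n))) \<longlonglongrightarrow> y - q"
proof -
  define s where "s n = sqrt (c n \<bullet> (Q *v c n) + e n)" for n
  define z where "z n = c n /\<^sub>R s n" for n
  define \<phi> where "\<phi> n = signed_dist (x - q) (Q + e n *\<^sub>R mat 1)" for n
  \<comment> \<open>The identity part of the regularised matrix contributes e / s in the direction
    of \<open>c n\<close>. It is at most sqrt e, as s is at least sqrt e.\<close>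
  define r where "r n = \<phi> n + e n / s n" for n
  define d where "d = norm (x - y)"
  have yE: "y \<in> ellipsoid q Q" unfolding y_def by (rule closest_point_ellipsoid_in)
  have d: "0 < d" unfolding d_def using yE x by auto
  have form: "c n \<bullet> ((Q + e n *\<^sub>R mat 1) *v c n) = c n \<bullet> (Q *v c n) + e n" for n
    using c(1)[of n] by (simp add: regularized_form norm_eq_1)
  have s: "sqrt (e n) \<le> s n" "0 < s n" for n
    using psd_nonneg[OF Q, of "c n"] e(1)[of n] by (auto simp: s_def add_nonneg_pos)
  have es: "0 \<le> e n / s n" "e n / s n \<le> sqrt (e n)" for n
  proof -
    show "0 \<le> e n / s n" using e(1)[of n] s(2)[of n] by simp
    have "e n = sqrt (e n) * sqrt (e n)" using e(1)[of n] by simp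
    also have "\<dots> \<le> sqrt (e n) * s n" using s(1)[of n] e(1)[of n] by (intro mult_left_mono) auto
    finally show "e n / s n \<le> sqrt (e n)" using s(2)[of n] by (simp add: pos_divide_le_eq)
  qed
  have zE: "q + Q *v z n \<in> ellipsoid q Q" for n
  proof (rule ellipsoidI[OF Q])
    have "c n \<bullet> (Q *v c n) \<le> s n * s n"
      using psd_nonneg[OF Q, of "c n"] e(1)[of n] by (simp add: s_def)
    then show "z n \<bullet> (Q *v z n) \<le> 1"
      using s(2)[of n] by (simp add: z_def matrix_vector_mult_scaleR field_simps)
  qed
  have xz: "x - (q + Q *v z n) = r n *\<^sub>R c n" for n
  proof -
    have "transpose (Q + e n *\<^sub>R mat 1) = Q + e n *\<^sub>R mat 1"
      using psd_regularized[OF Q, of "e n"] e(1)[of n] by (simp add: psd_def)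
    from signed_dist_maximizer[OF this c, unfolded form]
    have "x - q = (Q + e n *\<^sub>R mat 1) *v z n + \<phi> n *\<^sub>R c n"
      using psd_nonneg[OF Q, of "c n"] e(1)[of n] by (simp add: z_def s_def \<phi>_def add_nonneg_pos)
    also have "\<dots> = Q *v z n + r n *\<^sub>R c n"
      by (simp add: matrix_vector_mult_add_rdistrib scaleR_matrix_vector_assoc[symmetric] z_def r_def
          matrix_vector_mult_scaleR algebra_simps divide_inverse)
    finally show ?thesis by (simp add: algebra_simps)
  qed
  have "d - sqrt (e n) \<le> r n \<and> r n \<le> d + sqrt (e n)" for n
    using signed_dist_regularized_ge[OF Q e(1) x, of n] signed_dist_regularized_le[OF Q e(1) yE, of x n] es[of n]
    unfolding \<phi>_def[symmetric] d_def y_def[symmetric] r_def by linarith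
  moreover have "(\<lambda>n. sqrt (e n)) \<longlonglongrightarrow> 0" using tendsto_real_sqrt[OF e(2)] by simp
  then have "(\<lambda>n. d - sqrt (e n)) \<longlonglongrightarrow> d" "(\<lambda>n. d + sqrt (e n)) \<longlonglongrightarrow> d"
    using tendsto_diff[OF tendsto_const[of d]] tendsto_add[OF tendsto_const[of d]] by fastforce+
  ultimately have r: "r \<longlonglongrightarrow> d"
    by (intro tendsto_sandwich[of "\<lambda>n. d - sqrt (e n)" r sequentially "\<lambda>n. d + sqrt (e n)"]) auto
  have "(norm (q + Q *v z n - y))^2 \<le> (r n)^2 - d^2" for n
  proof -
    let ?v = "q + Q *v z n"
    have "(x - y) \<bullet> (?v - y) \<le> 0"
      unfolding y_def by (rule closest_point_dot[OF convex_ellipsoid closed_ellipsoid zE])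
    moreover have "(norm (x - ?v))^2 = (norm (x - y))^2 + (norm (?v - y))^2 - 2 * ((x - y) \<bullet> (?v - y))"
      unfolding power2_norm_eq_inner by (simp add: inner_diff_left inner_diff_right inner_commute algebra_simps)
    moreover have "(norm (x - ?v))^2 = (r n)^2" unfolding xz using c(1)[of n] by simp
    ultimately show ?thesis unfolding d_def by linarith
  qed
  moreover have "(\<lambda>n. (r n)^2 - d^2) \<longlonglongrightarrow> 0" using r by (auto intro!: tendsto_eq_intros)
  ultimately have "(\<lambda>n. (norm (q + Q *v z n - y))^2) \<longlonglongrightarrow> 0"
    by (intro tendsto_sandwich[of "\<lambda>_. 0" "\<lambda>n. (norm (q + Q *v z n - y))^2" sequentially "\<lambda>n. (r n)^2 - d^2"]) auto
  then have "(\<lambda>n. sqrt ((norm (q + Q *v z n - y))^2)) \<longlonglongrightarrow> sqrt 0" by (rule tendsto_real_sqrt)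
  then have "(\<lambda>n. norm (q + Q *v z n - y)) \<longlonglongrightarrow> 0" by simp
  then have zlim: "(\<lambda>n. q + Q *v z n) \<longlonglongrightarrow> y"
    by (simp add: tendsto_norm_zero_iff Lim_null[symmetric])
  from tendsto_diff[OF this tendsto_const[of q]]
  show "(\<lambda>n. Q *v (c n /\<^sub>R sqrt (c n \<bullet> (Q *v c n) + e n))) \<longlonglongrightarrow> y - q"
    by (simp add: z_def s_def)
  have "(\<lambda>n. (x - (q + Q *v z n)) /\<^sub>R r n) \<longlonglongrightarrow> (x - y) /\<^sub>R d"
    using d by (intro tendsto_intros zlim r) auto
  moreover have "\<forall>\<^sub>F n in sequentially. (x - (q + Q *v z n)) /\<^sub>R r n = c n"
    using order_tendstoD(1)[OF r d] by eventually_elim (simp add: xz)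
  ultimately show "c \<longlonglongrightarrow> (x - y) /\<^sub>R norm (x - y)"
    unfolding d_def by (rule Lim_transform_eventually)
qed

text \<open>If \<open>Q c\<^sub>0 = 0\<close>, the quotient is indeterminate in the limit. Splitting off the kernel
  component of \<open>c n\<close>, on which \<open>D\<close> vanishes as a quadratic form, removes the singularity.\<close>

lemma regularized_derivative_tendsto:
  fixes Q D :: "real^'n^'n"
  assumes Q: "psd Q" and D: "transpose D = D" and ker: "\<And>k. Q *v k = 0 \<Longrightarrow> k \<bullet> (D *v k) = 0"
    and e: "\<And>n. 0 < e n" "e \<longlonglongrightarrow> 0" and c: "c \<longlonglongrightarrow> c0"
    and lim: "(\<lambda>n. Q *v (c n /\<^sub>R sqrt (c n \<bullet> (Q *v c n) + e n))) \<longlonglongrightarrow> Q *v v"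
    and pos: "0 < c0 \<bullet> (Q *v c0) \<Longrightarrow> c0 \<bullet> g - (c0 \<bullet> (D *v c0)) / (2 * sqrt (c0 \<bullet> (Q *v c0))) \<le> B"
    and deg: "\<And>z. Q *v c0 = 0 \<Longrightarrow> Q *v z = Q *v v \<Longrightarrow> c0 \<bullet> g - z \<bullet> (D *v c0) \<le> B"
  obtains l where "l \<le> B"
    "(\<lambda>n. c n \<bullet> g - (c n \<bullet> (D *v c n)) / (2 * sqrt (c n \<bullet> (Q *v c n) + e n))) \<longlonglongrightarrow> l"
proof (cases "Q *v c0 = 0")
  case False
  then have c0: "0 < c0 \<bullet> (Q *v c0)"
    using psd_nonneg[OF Q, of c0] psd_form_eq_0_iff[OF Q, of c0] by simp
  have "(\<lambda>n. c n \<bullet> g - (c n \<bullet> (D *v c n)) / (2 * sqrt (c n \<bullet> (Q *v c n) + e n)))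
      \<longlonglongrightarrow> c0 \<bullet> g - (c0 \<bullet> (D *v c0)) / (2 * sqrt (c0 \<bullet> (Q *v c0) + 0))"
    using c0 by (intro tendsto_intros c e) auto
  then show thesis using pos[OF c0] that by simp
next
  case True
  obtain X where X: "\<And>v. Q *v (X *v (Q *v v)) = Q *v v" using psd_generalized_inverse[OF Q] by blast
  define s where "s n = sqrt (c n \<bullet> (Q *v c n) + e n)" for n
  have s: "0 < s n" for n using psd_nonneg[OF Q, of "c n"] e(1)[of n] by (auto simp: s_def add_nonneg_pos)
  \<comment> \<open>\<open>c n /\<^sub>R s n\<close> itself may be unbounded; \<open>z n\<close>
    depends only on its image under \<open>Q\<close>, whose limit is assumed.\<close>
  define z where "z n = X *v (Q *v (c n /\<^sub>R s n))" for n
  define b where "b n = X *v (Q *v c n)" for n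
  have zb: "b n = s n *\<^sub>R z n" for n using s[of n] by (simp add: b_def z_def matrix_vector_mult_scaleR)
  have "(c n \<bullet> (D *v c n)) / (2 * s n) = z n \<bullet> (D *v c n) - (z n \<bullet> (D *v b n)) / 2" for n
  proof -
    define k where "k = c n - b n"
    have ck: "c n = k + b n" by (simp add: k_def)
    have "Q *v k = 0" by (simp add: k_def b_def matrix_vector_mult_diff_distrib X)
    then have k: "k \<bullet> (D *v k) = 0" by (rule ker)
    have "k \<bullet> (D *v b n) = b n \<bullet> (D *v k)" using symmetric_dot_swap[OF D, of "b n" k] by (simp add: inner_commute)
    \<comment> \<open>In the expansion of c = k + b the only term without a factor b is k \<bullet>
      D k = 0. As b is s times z, the small denominator cancels.\<close>
    then have "c n \<bullet> (D *v c n) = 2 * (b n \<bullet> (D *v c n)) - b n \<bullet> (D *v b n)"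
      unfolding ck using k by (simp add: matrix_vector_right_distrib inner_add_left inner_add_right)
    also have "\<dots> = s n * (2 * (z n \<bullet> (D *v c n)) - z n \<bullet> (D *v b n))"
      unfolding zb[of n] by (simp add: matrix_vector_mult_scaleR algebra_simps)
    finally show ?thesis using s[of n] by (simp add: field_simps)
  qed
  then have eq: "c n \<bullet> g - (c n \<bullet> (D *v c n)) / (2 * s n)
      = c n \<bullet> g - (z n \<bullet> (D *v c n) - (z n \<bullet> (D *v b n)) / 2)" for n by simp
  have z: "z \<longlonglongrightarrow> X *v (Q *v v)" unfolding z_def s_def by (intro tendsto_intros lim)
  have b: "b \<longlonglongrightarrow> X *v (Q *v c0)" unfolding b_def by (intro tendsto_intros c)
  have "(\<lambda>n. c n \<bullet> g - (c n \<bullet> (D *v c n)) / (2 * s n))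
      \<longlonglongrightarrow> c0 \<bullet> g - ((X *v (Q *v v)) \<bullet> (D *v c0) - ((X *v (Q *v v)) \<bullet> (D *v (X *v (Q *v c0)))) / 2)"
    unfolding eq by (intro tendsto_intros c z b) simp
  then have "(\<lambda>n. c n \<bullet> g - (c n \<bullet> (D *v c n)) / (2 * s n)) \<longlonglongrightarrow> c0 \<bullet> g - (X *v (Q *v v)) \<bullet> (D *v c0)"
    by (simp add: True)
  then show thesis using deg[OF True X] that by (simp add: s_def)
qed

section \<open>Invariance of a moving ellipsoid\<close>

locale moving_ellipsoid =
  fixes a b :: real and x q :: "real \<Rightarrow> real^'n" and Q :: "real \<Rightarrow> real^'n^'n" and L V :: real
  assumes ac_x: "abs_continuous_on {a..b} x" and ac_q: "abs_continuous_on {a..b} q"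
    and ac_Q: "abs_continuous_on {a..b} Q"
    and psd_Q: "\<And>t. t \<in> {a..b} \<Longrightarrow> psd (Q t)"
    and L_nonneg: "0 \<le> L" and V_nonneg: "0 \<le> V"
begin

definition "E t = ellipsoid (q t) (Q t)"
definition "proj t = closest_point (E t) (x t)"
definition "dist_E t = norm (x t - proj t)"

definition admissible :: "real \<Rightarrow> real^'n \<Rightarrow> real^'n^'n \<Rightarrow> bool" where
  "admissible t g D \<longleftrightarrow>
     ((\<lambda>s. x s - q s) has_vector_derivative g) (at t within {a..b}) \<and>
     (Q has_vector_derivative D) (at t within {a..b}) \<and>
     transpose D = D \<and> norm g \<le> V \<and>
     (\<forall>c. norm c = 1 \<longrightarrow> - (c \<bullet> (D *v c)) \<le> 2 * V * sqrt (c \<bullet> (Q t *v c))) \<and>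
     (\<forall>k. Q t *v k = 0 \<longrightarrow> k \<bullet> (D *v k) = 0) \<and>
     (x t \<notin> E t \<longrightarrow> (let c = (x t - proj t) /\<^sub>R dist_E t in
        (0 < c \<bullet> (Q t *v c) \<longrightarrow> c \<bullet> g \<le> L * dist_E t + (c \<bullet> (D *v c)) / (2 * sqrt (c \<bullet> (Q t *v c)))) \<and>
        (\<forall>z. Q t *v c = 0 \<longrightarrow> proj t = q t + Q t *v z \<longrightarrow> c \<bullet> g \<le> L * dist_E t + z \<bullet> (D *v c))))"

lemma proj_in: "proj t \<in> E t"
  unfolding proj_def E_def by (rule closest_point_ellipsoid_in)

lemma dist_E_pos: "x t \<notin> E t \<Longrightarrow> 0 < dist_E t"
  using proj_in[of t] by (auto simp: dist_E_def)

lemma dist_E_nonneg: "0 \<le> dist_E t"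
  by (simp add: dist_E_def)

lemma dist_E_eq_0: "x t \<in> E t \<Longrightarrow> dist_E t = 0"
  by (simp add: dist_E_def proj_def closest_point_self)

lemma continuous_on_dist_E: "continuous_on {a..b} dist_E"
proof -
  note cx = abs_continuous_on_imp_continuous_on[OF ac_x]
  have "continuous_on {a..b} (\<lambda>t. (t, x t))" by (intro continuous_intros cx)
  then have "continuous_on {a..b} (\<lambda>t. (\<lambda>(t, x). closest_point (ellipsoid (q t) (Q t)) x) (t, x t))"
  proof (rule continuous_on_compose2[rotated])
    show "continuous_on ({a..b} \<times> UNIV) (\<lambda>(t, x). closest_point (ellipsoid (q t) (Q t)) x)"
      by (intro continuous_on_closest_point_ellipsoid abs_continuous_on_imp_continuous_on ac_q ac_Q psd_Q
          compact_Icc)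
  qed auto
  then show ?thesis unfolding dist_E_def proj_def E_def by (intro continuous_intros cx) simp
qed

text \<open>The fundamental theorem is applied to the regularised distances; only the positive part
  of their excess over L times the distance has to disappear in the limit.\<close>

lemma dist_E_growth:
  assumes adm: "AE t in lebesgue. t \<in> {a..b} \<longrightarrow> (\<exists>g D. admissible t g D)"
    and r: "{r1..r2} \<subseteq> {a..b}" "r1 \<le> r2" and out: "\<And>t. t \<in> {r1..r2} \<Longrightarrow> x t \<notin> E t"
  shows "dist_E r2 - dist_E r1 \<le> integral {r1..r2} (\<lambda>t. L * dist_E t)"
proof -
  let ?I = "{r1..r2}"
  have cd: "continuous_on ?I dist_E" by (rule continuous_on_subset[OF continuous_on_dist_E r(1)])
  obtain t0 where t0: "t0 \<in> ?I" "\<And>t. t \<in> ?I \<Longrightarrow> dist_E t0 \<le> dist_E t"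
    using continuous_attains_inf[OF _ _ cd] r(2) by auto
  define m where "m = dist_E t0 / 2"
  have m: "0 < m" using dist_E_pos[OF out[OF t0(1)]] by (simp add: m_def)
  \<comment> \<open>The scale \<open>m^2\<close> makes the regularisation error at most half the
    minimal distance, so the regularised distances stay positive and their derivative formula
    applies.\<close>
  define e where "e n = m^2 / Suc n" for n
  have e: "0 < e n" for n using m by (simp add: e_def)
  have e0: "e \<longlonglongrightarrow> 0" unfolding e_def by (rule LIMSEQ_Suc[OF lim_const_over_n])
  have em: "sqrt (e n) \<le> m" for n
  proof -
    have "e n \<le> m^2" by (simp add: e_def divide_le_eq mult_le_cancel_left1)
    then show ?thesis using m by (simp add: real_le_lsqrt)
  qed
  define P where "P n t = Q t + e n *\<^sub>R mat 1" for n t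
  define \<phi> where "\<phi> n t = signed_dist (x t - q t) (P n t)" for n t
  have psdP: "psd (P n t)" if "t \<in> {a..b}" for n t
    unfolding P_def using psd_regularized[OF psd_Q[OF that]] e[of n] by simp
  have formP: "c \<bullet> (P n t *v c) = c \<bullet> (Q t *v c) + e n" if "norm c = 1" for c n t
    using that by (simp add: P_def regularized_form norm_eq_1)
  have geP: "e n \<le> c \<bullet> (P n t *v c)" if "norm c = 1" "t \<in> {a..b}" for c n t
    using psd_nonneg[OF psd_Q[OF that(2)], of c] by (simp add: formP[OF that(1)])
  have phi_le: "\<phi> n t \<le> dist_E t" if "t \<in> {a..b}" for n t
    unfolding \<phi>_def P_def dist_E_def
    by (rule signed_dist_regularized_le[OF psd_Q[OF that] e]) (use proj_in[of t] in \<open>simp add: E_def\<close>)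
  have phi_ge: "dist_E t - sqrt (e n) \<le> \<phi> n t" if "t \<in> ?I" for n t
    unfolding \<phi>_def P_def dist_E_def proj_def E_def
    using out[OF that] that r(1) by (intro signed_dist_regularized_ge psd_Q e) (auto simp: E_def)
  have phi_pos: "0 < \<phi> n t" if "t \<in> ?I" for n t
    using phi_ge[OF that, of n] em[of n] t0(2)[OF that] m by (simp add: m_def)
  have acphi: "abs_continuous_on ?I (\<phi> n)" for n
  proof (rule abs_continuous_on_dominated)
    show "abs_continuous_on ?I (\<lambda>t. x t - q t)" "abs_continuous_on ?I Q"
      by (intro abs_continuous_on_subset[OF _ r(1)] abs_continuous_on_diff ac_x ac_q ac_Q)+
    show "0 \<le> 1 + 1 / sqrt (e n)" using e[of n] by simp
    fix s t assume st: "s \<in> ?I" "t \<in> ?I"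
    have "norm (\<phi> n t - \<phi> n s) \<le> norm (x t - q t - (x s - q s)) + norm (P n t - P n s) / sqrt (e n)"
      unfolding \<phi>_def real_norm_def using st r(1) by (intro signed_dist_lipschitz e geP) auto
    also have "norm (P n t - P n s) = norm (Q t - Q s)" by (simp add: P_def)
    also have "norm (x t - q t - (x s - q s)) + norm (Q t - Q s) / sqrt (e n)
        \<le> (1 + 1 / sqrt (e n)) * (norm (x t - q t - (x s - q s)) + norm (Q t - Q s))"
      using e[of n] by (simp add: algebra_simps)
    finally show "norm (\<phi> n t - \<phi> n s) \<le> (1 + 1 / sqrt (e n)) * (norm (x t - q t - (x s - q s)) + norm (Q t - Q s))" .
  qed
  \<comment> \<open>The directions are picked pointwise. Integrability of the expression
    \<open>\<psi>\<close> built from them follows because it is almost everywhere the derivative of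
    \<open>\<phi>\<close>.\<close>
  have "\<forall>n t. \<exists>c. norm c = 1 \<and> \<phi> n t = c \<bullet> (x t - q t) - sqrt (c \<bullet> (P n t *v c))"
    unfolding \<phi>_def by (metis signed_dist_attained)
  then obtain c where c: "\<And>n t. norm (c n t) = 1"
    "\<And>n t. \<phi> n t = c n t \<bullet> (x t - q t) - sqrt (c n t \<bullet> (P n t *v c n t))" by metis
  obtain N where N: "negligible N" "\<And>t. t \<in> {a..b} - N \<Longrightarrow> \<exists>g D. admissible t g D"
  proof -
    obtain N where "N \<in> null_sets lebesgue" "{t. \<not> (t \<in> {a..b} \<longrightarrow> (\<exists>g D. admissible t g D))} \<subseteq> N"
      using adm by (auto simp: eventually_ae_filter)
    then show thesis by (intro that[of N]) (auto simp: negligible_iff_null_sets)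
  qed
  then obtain g D where gD: "\<And>t. t \<in> {a..b} - N \<Longrightarrow> admissible t (g t) (D t)" by metis
  define \<psi> where "\<psi> n t = (if t \<in> N then 0 else
    c n t \<bullet> g t - (c n t \<bullet> (D t *v c n t)) / (2 * sqrt (c n t \<bullet> (Q t *v c n t) + e n)))" for n t
  have int_psi: "(\<psi> n has_integral \<phi> n r2 - \<phi> n r1) ?I" for n
  proof (rule has_integral_derivative_abs_continuous[OF acphi r(2) N(1)])
    fix t assume t: "t \<in> ?I - N"
    then have tab: "t \<in> {a..b} - N" using r(1) by auto
    have adm: "((\<lambda>s. x s - q s) has_vector_derivative g t) (at t within {a..b})"
      "(Q has_vector_derivative D t) (at t within {a..b})"
      using gD[OF tab] by (auto simp: admissible_def)
    have "(P n has_vector_derivative D t) (at t within {a..b})"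
      unfolding P_def using has_vector_derivative_add[OF adm(2) has_vector_derivative_const] by simp
    from signed_dist_has_derivative[OF adm(1) this psdP _ _ _ c(1) c(2)[unfolded \<phi>_def]]
    have "(\<phi> n has_real_derivative \<psi> n t) (at t within {a..b})"
      unfolding \<phi>_def \<psi>_def using tab t phi_pos[of t n] order_less_le_trans[OF e geP]
      by (simp add: formP[OF c(1)] \<phi>_def)
    then show "(\<phi> n has_vector_derivative \<psi> n t) (at t within ?I)"
      using has_vector_derivative_within_subset[OF _ r(1)]
      by (simp add: has_real_derivative_iff_has_vector_derivative)
  qed
  have psi_le: "\<psi> n t \<le> 2 * V" if "t \<in> ?I" for n t
  proof (cases "t \<in> N")
    case False
    then have tab: "t \<in> {a..b} - N" using that r(1) by auto
    let ?c = "c n t"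
    define s where "s = sqrt (?c \<bullet> (Q t *v ?c) + e n)"
    have Qc: "0 \<le> ?c \<bullet> (Q t *v ?c)" using psd_nonneg[OF psd_Q] tab by simp
    have s: "0 < s" "sqrt (?c \<bullet> (Q t *v ?c)) \<le> s" using Qc e[of n] by (auto simp: s_def add_nonneg_pos)
    have adm: "norm (g t) \<le> V" "- (?c \<bullet> (D t *v ?c)) \<le> 2 * V * sqrt (?c \<bullet> (Q t *v ?c))"
      using gD[OF tab] c(1) by (auto simp: admissible_def)
    have "?c \<bullet> g t \<le> V" using norm_cauchy_schwarz[of ?c "g t"] c(1)[of n t] adm(1) by simp
    moreover have "- (?c \<bullet> (D t *v ?c)) \<le> 2 * V * s"
      using adm(2) mult_left_mono[OF s(2), of "2 * V"] V_nonneg by linarith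
    then have "- ((?c \<bullet> (D t *v ?c)) / (2 * s)) \<le> V" using s(1) by (simp add: field_simps)
    ultimately show ?thesis using False by (simp add: \<psi>_def s_def)
  qed (simp add: \<psi>_def V_nonneg)
  \<comment> \<open>The derivatives are dominated from above only; their positive excess lies
    between 0 and 2 V, so dominated convergence applies to it.\<close>
  define h where "h n t = max 0 (\<psi> n t - L * dist_E t)" for n t
  have int_d: "(\<lambda>t. L * dist_E t) absolutely_integrable_on ?I"
    by (intro absolutely_integrable_continuous_real continuous_intros cd)
  have lim_h: "(\<lambda>n. h n t) \<longlonglongrightarrow> 0" if t: "t \<in> ?I" for t
  proof (cases "t \<in> N")
    case True
    then show ?thesis using mult_nonneg_nonneg[OF L_nonneg dist_E_nonneg] by (simp add: h_def \<psi>_def max_absorb1)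
  next
    case False
    then have tab: "t \<in> {a..b} - N" and tab': "t \<in> {a..b}" using t r(1) by auto
    note adm = gD[OF tab, unfolded admissible_def Let_def]
    define c0 where "c0 = (x t - proj t) /\<^sub>R dist_E t"
    have adm_out: "0 < c0 \<bullet> (Q t *v c0) \<Longrightarrow> c0 \<bullet> g t \<le> L * dist_E t + (c0 \<bullet> (D t *v c0)) / (2 * sqrt (c0 \<bullet> (Q t *v c0)))"
      "\<And>z. Q t *v c0 = 0 \<Longrightarrow> proj t = q t + Q t *v z \<Longrightarrow> c0 \<bullet> g t \<le> L * dist_E t + z \<bullet> (D t *v c0)"
      using adm out[OF t] unfolding c0_def by blast+
    have xE: "x t \<notin> ellipsoid (q t) (Q t)" using out[OF t] by (simp add: E_def)
    note lims = regularized_maximizer_tendsto[OF psd_Q[OF tab'] xE e e0 c(1) c(2)[unfolded \<phi>_def P_def],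
        folded E_def, folded proj_def, folded dist_E_def, folded c0_def]
    obtain v where v: "proj t = q t + Q t *v v"
      using ellipsoidE[OF psd_Q[OF tab'] proj_in[of t, unfolded E_def]] by metis
    obtain l where l: "l \<le> L * dist_E t"
      "(\<lambda>n. c n t \<bullet> g t - (c n t \<bullet> (D t *v c n t)) / (2 * sqrt (c n t \<bullet> (Q t *v c n t) + e n))) \<longlonglongrightarrow> l"
    proof (rule regularized_derivative_tendsto[where g = "g t" and D = "D t" and v = v
          and B = "L * dist_E t", OF psd_Q[OF tab'] _ _ e e0 lims(1)])
      show "(\<lambda>n. Q t *v (c n t /\<^sub>R sqrt (c n t \<bullet> (Q t *v c n t) + e n))) \<longlonglongrightarrow> Q t *v v"
        using lims(2) v by simp
      show "c0 \<bullet> g t - z \<bullet> (D t *v c0) \<le> L * dist_E t" if "Q t *v c0 = 0" "Q t *v z = Q t *v v" for z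
        using adm_out(2)[of z] that v by simp
    qed (use adm adm_out(1) in auto)
    have "(\<lambda>n. \<psi> n t) \<longlonglongrightarrow> l" using l(2) False by (simp add: \<psi>_def)
    then have "(\<lambda>n. h n t) \<longlonglongrightarrow> max 0 (l - L * dist_E t)" unfolding h_def by (intro tendsto_intros)
    then show ?thesis using l(1) by (simp add: max_absorb1)
  qed
  have h_bound: "norm (h n t) \<le> 2 * V" if "t \<in> ?I" for n t
    using psi_le[OF that, of n] V_nonneg mult_nonneg_nonneg[OF L_nonneg dist_E_nonneg[of t]]
    by (simp add: h_def)
  \<comment> \<open>An integrable function with an upper bound is absolutely integrable, as the
    difference from the bound is nonnegative. This makes the maximum in \<open>h\<close>
    integrable.\<close>
  have int_psi_abs: "\<psi> n absolutely_integrable_on ?I" for n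
  proof -
    have "(\<lambda>t. 2 * V - \<psi> n t) integrable_on ?I"
      by (intro integrable_diff integrable_const_ivl has_integral_integrable[OF int_psi])
    then have "(\<lambda>t. 2 * V - \<psi> n t) absolutely_integrable_on ?I"
      by (rule nonnegative_absolutely_integrable_1) (use psi_le in auto)
    moreover have "(\<lambda>t. 2 * V) absolutely_integrable_on ?I" by simp
    ultimately have "(\<lambda>t. 2 * V - (2 * V - \<psi> n t)) absolutely_integrable_on ?I"
      by (rule set_integral_diff(1)[rotated])
    then show ?thesis by simp
  qed
  have int_h: "h n integrable_on ?I" for n
    unfolding h_def
    by (intro set_lebesgue_integral_eq_integral(1) absolutely_integrable_max_1 set_integral_diff(1)
        int_psi_abs int_d absolutely_integrable_on_const) auto
  have "(\<lambda>n. integral ?I (h n)) \<longlonglongrightarrow> integral ?I (\<lambda>_. 0)"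
    by (rule dominated_convergence(2)[where h = "\<lambda>_. 2 * V"])
       (use int_h h_bound lim_h in \<open>auto intro: integrable_const_ivl\<close>)
  then have lim_int: "(\<lambda>n. integral ?I (\<lambda>t. L * dist_E t) + integral ?I (h n)) \<longlonglongrightarrow> integral ?I (\<lambda>t. L * dist_E t)"
    by (auto intro!: tendsto_eq_intros)
  have lim_phi: "(\<lambda>n. \<phi> n t) \<longlonglongrightarrow> dist_E t" if "t \<in> ?I" for t
  proof (rule tendsto_sandwich)
    have "(\<lambda>n. dist_E t - sqrt (e n)) \<longlonglongrightarrow> dist_E t - sqrt 0" by (intro tendsto_intros e0)
    then show "(\<lambda>n. dist_E t - sqrt (e n)) \<longlonglongrightarrow> dist_E t" by simp
    show "\<forall>\<^sub>F n in sequentially. dist_E t - sqrt (e n) \<le> \<phi> n t" using phi_ge[OF that] by simp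
    show "\<forall>\<^sub>F n in sequentially. \<phi> n t \<le> dist_E t" using phi_le that r(1) by auto
  qed simp
  have le: "\<phi> n r2 - \<phi> n r1 \<le> integral ?I (\<lambda>t. L * dist_E t) + integral ?I (h n)" for n
  proof -
    have id: "(\<lambda>t. L * dist_E t) integrable_on ?I"
      by (rule set_lebesgue_integral_eq_integral(1)[OF int_d])
    have "\<phi> n r2 - \<phi> n r1 = integral ?I (\<psi> n)" using integral_unique[OF int_psi] by simp
    also have "\<dots> \<le> integral ?I (\<lambda>t. L * dist_E t + h n t)"
      by (intro integral_le has_integral_integrable[OF int_psi] integrable_add id int_h) (simp add: h_def)
    also have "\<dots> = integral ?I (\<lambda>t. L * dist_E t) + integral ?I (h n)"
      by (intro integral_add id int_h)
    finally show ?thesis .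
  qed
  show ?thesis
    by (rule LIMSEQ_le[OF tendsto_diff[OF lim_phi lim_phi] lim_int]) (use le r(2) in auto)
qed

text \<open>The growth estimate holds only outside the ellipsoid, so it cannot start at the last
  contact time r0. It is used backwards: if the maximal distance M on a short interval after r0
  occurs at r1, the distance is at least M / 2 on all of (r0, r1], against continuity at r0.\<close>

theorem invariant:
  assumes adm: "AE t in lebesgue. t \<in> {a..b} \<longrightarrow> (\<exists>g D. admissible t g D)"
    and st: "s \<in> {a..b}" "t \<in> {a..b}" "s \<le> t" and start: "x s \<in> E s"
  shows "x t \<in> E t"
proof (rule ccontr)
  assume out: "x t \<notin> E t"
  have xE: "x r \<in> E r \<longleftrightarrow> dist_E r = 0" for r
    using dist_E_eq_0 dist_E_pos by (metis less_irrefl)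
  let ?Z = "{s..t} \<inter> dist_E -` {0}"
  have sub: "{s..t} \<subseteq> {a..b}" using st by auto
  have cd: "continuous_on {s..t} dist_E" by (rule continuous_on_subset[OF continuous_on_dist_E sub])
  have "closed ?Z" by (rule continuous_closed_preimage[OF cd]) auto
  moreover have "bounded ?Z" by (rule bounded_subset[of "{s..t}"]) auto
  ultimately have "compact ?Z" by (simp add: compact_eq_bounded_closed)
  moreover have "s \<in> ?Z" using start st(3) xE by auto
  ultimately obtain r0 where r0: "r0 \<in> ?Z" "\<And>r. r \<in> ?Z \<Longrightarrow> r \<le> r0"
    using compact_attains_sup[of ?Z] by blast
  have r0t: "r0 < t" using r0(1) out xE[of t] by (cases "r0 = t") auto
  have pos: "0 < dist_E r" if "r0 < r" "r \<le> t" for r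
    using r0(2)[of r] r0(1) that dist_E_nonneg[of r] by (cases "dist_E r = 0") auto
  \<comment> \<open>Chosen so that L times the length is at most 1/2; the added 1 covers L =
    0.\<close>
  define \<delta> where "\<delta> = min (t - r0) (1 / (2 * L + 1))"
  have \<delta>: "0 < \<delta>" "r0 + \<delta> \<le> t" "L * \<delta> \<le> 1 / 2"
  proof -
    show "0 < \<delta>" "r0 + \<delta> \<le> t" using r0t L_nonneg by (auto simp: \<delta>_def)
    have "L * \<delta> \<le> L * (1 / (2 * L + 1))" using L_nonneg by (intro mult_left_mono) (auto simp: \<delta>_def)
    also have "\<dots> \<le> 1 / 2" using L_nonneg by (simp add: divide_le_eq)
    finally show "L * \<delta> \<le> 1 / 2" .
  qed
  have sub0: "{r0..r0 + \<delta>} \<subseteq> {s..t}" using r0(1) \<delta> by auto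
  obtain r1 where r1: "r1 \<in> {r0..r0 + \<delta>}" "\<And>r. r \<in> {r0..r0 + \<delta>} \<Longrightarrow> dist_E r \<le> dist_E r1"
    using continuous_attains_sup[OF _ _ continuous_on_subset[OF cd sub0]] \<delta>(1) by auto
  have M: "0 < dist_E r1" using r1(2)[of "r0 + \<delta>"] pos[of "r0 + \<delta>"] \<delta> by auto
  then have r01: "r0 < r1" using r1(1) r0(1) by (cases "r0 = r1") auto
  have half: "dist_E r1 / 2 \<le> dist_E r" if r: "r0 < r" "r \<le> r1" for r
  proof -
    have rsub: "{r..r1} \<subseteq> {a..b}" "{r..r1} \<subseteq> {r0..r0 + \<delta>}" using r r1(1) sub0 sub by auto
    have "dist_E r1 - dist_E r \<le> integral {r..r1} (\<lambda>t. L * dist_E t)"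
      using r r1(1) \<delta>(2) pos xE by (intro dist_E_growth[OF adm rsub(1)]) (auto simp: less_le)
    also have "\<dots> \<le> integral {r..r1} (\<lambda>t. L * dist_E r1)"
      using rsub r1(2) L_nonneg
      by (intro integral_le integrable_continuous_real continuous_intros continuous_on_subset[OF continuous_on_dist_E])
         (auto intro!: mult_left_mono)
    also have "\<dots> = (r1 - r) * (L * dist_E r1)" using r by simp
    also have "\<dots> \<le> \<delta> * (L * dist_E r1)"
      using r r1(1) M L_nonneg by (intro mult_right_mono) auto
    also have "\<dots> = L * \<delta> * dist_E r1" by simp
    also have "\<dots> \<le> 1 / 2 * dist_E r1" using \<delta>(3) M by (intro mult_right_mono) auto
    finally show ?thesis by simp
  qed
  have "r0 \<in> {a..b}" using r0(1) sub by auto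
  then obtain d where d: "0 < d" "\<And>r. r \<in> {a..b} \<Longrightarrow> dist r r0 < d \<Longrightarrow> dist (dist_E r) (dist_E r0) < dist_E r1 / 2"
    using continuous_on_dist_E M unfolding continuous_on_iff by (metis half_gt_zero)
  define r where "r = min r1 (r0 + d / 2)"
  have r: "r0 < r" "r \<le> r1" "dist r r0 < d" "r \<in> {a..b}"
    using r01 d(1) r1(1) sub0 sub r0(1) by (auto simp: r_def dist_real_def min_def)
  have "dist_E r < dist_E r1 / 2" using d(2)[OF r(4,3)] r0(1) dist_E_nonneg[of r] by (simp add: dist_real_def)
  with half[OF r(1,2)] show False by simp
qed

end

section \<open>Measurable selection of feedback gains\<close>

text \<open>The element of minimal norm is a Borel selection: it lies in a closed set \<open>C\<close> iff for every
  rational \<open>r\<close>, whenever the slice meets the ball of radius \<open>r\<close>, it does so inside \<open>C\<close>; and slices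
  meeting a compact set form a closed set of parameters.\<close>

lemma borel_min_norm_selection:
  fixes K :: "('p::euclidean_space \<times> 'k::euclidean_space) set"
  assumes K: "closed K" and conv: "\<And>p. convex {k. (p, k) \<in> K}"
  obtains \<sigma> where "\<sigma> \<in> borel_measurable borel" "\<And>p k. (p, k) \<in> K \<Longrightarrow> (p, \<sigma> p) \<in> K"
    "{p. \<exists>k. (p, k) \<in> K} \<in> sets borel"
proof -
  define A where "A r C = {p. \<exists>k. k \<in> C \<inter> cball 0 r \<and> (p, k) \<in> K}" for r and C :: "'k set"
  have closedA: "closed (A r C)" if "closed C" for r C
  proof -
    have "compact (C \<inter> cball 0 r)" using that by (simp add: closed_Int_compact)
    moreover have "closed {(k, p). (p, k) \<in> K}"
    proof -
      have "{(k, p). (p, k) \<in> K} = prod.swap -` K" by auto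
      then show ?thesis using K by (simp add: closed_vimage continuous_on_swap)
    qed
    ultimately have "closed {p. \<exists>k. k \<in> C \<inter> cball 0 r \<and> (k, p) \<in> {(k, p). (p, k) \<in> K}}"
      by (rule closed_compact_projection)
    then show ?thesis by (simp add: A_def)
  qed
  define Dom where "Dom = {p. \<exists>k. (p, k) \<in> K}"
  have "Dom = (\<Union>n::nat. A (real n) UNIV)"
    by (auto simp: Dom_def A_def) (meson real_arch_simple)
  then have Dom: "Dom \<in> sets borel" using closedA[OF closed_UNIV] by auto
  define sl where "sl p = {k. (p, k) \<in> K}" for p
  have closed_sl: "closed (sl p)" for p
  proof -
    have "sl p = Pair p -` K" by (auto simp: sl_def)
    then show ?thesis using K by (simp add: closed_vimage continuous_on_Pair)
  qed
  \<comment> \<open>With a constant default, the part of a preimage outside \<open>Dom\<close> is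
    either empty or all of the complement.\<close>
  define \<sigma> where "\<sigma> p = (if p \<in> Dom then closest_point (sl p) 0 else 0)" for p
  have in_sl: "\<sigma> p \<in> sl p" if "p \<in> Dom" for p
    using that closest_point_in_set[OF closed_sl, of p 0] by (auto simp: \<sigma>_def Dom_def sl_def)
  have min: "norm (\<sigma> p) \<le> norm k" if "k \<in> sl p" for p k
    using that closest_point_le[OF closed_sl that, of 0] by (auto simp: \<sigma>_def Dom_def sl_def)
  have strict: "norm (\<sigma> p) < norm k" if "k \<in> sl p" "k \<noteq> \<sigma> p" for p k
  proof -
    have "\<sigma> p = closest_point (sl p) 0" using that by (auto simp: \<sigma>_def Dom_def sl_def)
    then show ?thesis
      using closest_point_lt[OF _ closed_sl that(1), of 0] conv[of p] that(2) by (simp add: sl_def)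
  qed
  have pre: "\<sigma> -` C = (Dom - (\<Union>r\<in>\<rat>. A r UNIV - A r C)) \<union> (if 0 \<in> C then - Dom else {})" if C: "closed C" for C
  proof -
    have "\<sigma> p \<in> C \<longleftrightarrow> (\<forall>r\<in>\<rat>. p \<in> A r UNIV \<longrightarrow> p \<in> A r C)" if p: "p \<in> Dom" for p
    proof
      assume "\<sigma> p \<in> C"
      then show "\<forall>r\<in>\<rat>. p \<in> A r UNIV \<longrightarrow> p \<in> A r C"
        using in_sl[OF p] min[of _ p] by (auto simp: A_def sl_def) (meson order_trans)
    next
      assume R: "\<forall>r\<in>\<rat>. p \<in> A r UNIV \<longrightarrow> p \<in> A r C"
      show "\<sigma> p \<in> C"
      proof (rule ccontr)
        assume no: "\<sigma> p \<notin> C"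
        have inA: "p \<in> A r UNIV" if "norm (\<sigma> p) \<le> r" for r
          using in_sl[OF p] that by (auto simp: A_def sl_def)
        obtain r where "r \<in> \<rat>" "norm (\<sigma> p) < r" by (meson Rats_dense_in_real gt_ex)
        then have ne: "sl p \<inter> C \<noteq> {}" using R inA[of r] by (auto simp: A_def sl_def)
        have clo: "closed (sl p \<inter> C)" using closed_sl C by auto
        define k where "k = closest_point (sl p \<inter> C) 0"
        have k: "k \<in> sl p \<inter> C" unfolding k_def by (rule closest_point_in_set[OF clo ne])
        then have "norm (\<sigma> p) < norm k" using strict no by auto
        \<comment> \<open>A rational radius between the least norm in the slice and the least norm
          in its part inside \<open>C\<close>: the ball of this radius meets the slice but not
          inside \<open>C\<close>.\<close>
        then obtain r where r: "r \<in> \<rat>" "norm (\<sigma> p) < r" "r < norm k" by (meson Rats_dense_in_real)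
        then have "p \<in> A r C" using R inA[of r] by auto
        then obtain k' where "k' \<in> sl p \<inter> C" "norm k' \<le> r" by (auto simp: A_def sl_def)
        then show False using closest_point_le[OF clo, of k' 0] r(3) by (simp add: k_def)
      qed
    qed
    note inC = this
    have out: "\<sigma> p = 0" if "p \<notin> Dom" for p using that by (simp add: \<sigma>_def)
    show ?thesis
    proof (rule set_eqI)
      fix p
      show "p \<in> \<sigma> -` C \<longleftrightarrow> p \<in> (Dom - (\<Union>r\<in>\<rat>. A r UNIV - A r C)) \<union> (if 0 \<in> C then - Dom else {})"
        using inC[of p] out[of p] by (cases "p \<in> Dom") auto
    qed
  qed
  have "\<sigma> \<in> borel_measurable borel"
  proof (rule borel_measurableI)
    fix S :: "'k set" assume "open S"
    then have C: "closed (- S)" by (simp add: closed_def)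
    have AA: "A r UNIV \<in> sets borel" "A r (- S) \<in> sets borel" for r
      using closedA[OF closed_UNIV] closedA[OF C] by auto
    have "\<sigma> -` (- S) \<in> sets borel"
      unfolding pre[OF C] using Dom AA countable_rat by (auto intro!: sets.countable_UN' sets.Diff sets.Un sets.compl_sets)
    then have "UNIV - \<sigma> -` (- S) \<in> sets borel" by (intro sets.Diff) auto
    moreover have "UNIV - \<sigma> -` (- S) = \<sigma> -` S" by auto
    ultimately show "\<sigma> -` S \<inter> space borel \<in> sets borel" by simp
  qed
  moreover have "(p, \<sigma> p) \<in> K" if "(p, k) \<in> K" for p k
    using in_sl[of p] that by (auto simp: Dom_def sl_def)
  ultimately show thesis using Dom that unfolding Dom_def by blast
qed

text \<open>Retraction onto the vectors with z \<bullet> Q z <= 1, continuous in Q. It lets a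
  quantifier range over all vectors instead of a set depending on Q; vectors with a larger form land
  on the boundary, where the form is 1.\<close>

definition rescale :: "real^'n^'n \<Rightarrow> real^'n \<Rightarrow> real^'n" where
  "rescale Q z = z /\<^sub>R max 1 (sqrt (z \<bullet> (Q *v z)))"

lemma rescale_form_le:
  assumes "psd Q"
  shows "rescale Q z \<bullet> (Q *v rescale Q z) \<le> 1"
proof -
  let ?m = "max 1 (sqrt (z \<bullet> (Q *v z)))"
  have "z \<bullet> (Q *v z) = sqrt (z \<bullet> (Q *v z)) * sqrt (z \<bullet> (Q *v z))"
    using psd_nonneg[OF assms, of z] by simp
  also have "\<dots> \<le> ?m * ?m" using psd_nonneg[OF assms, of z] by (intro mult_mono) auto
  finally have "(z \<bullet> (Q *v z)) / (?m * ?m) \<le> 1" by (simp add: divide_le_eq_1)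
  then show ?thesis
    by (simp add: rescale_def matrix_vector_mult_scaleR divide_inverse ac_simps)
qed

lemma rescale_id: "z \<bullet> (Q *v z) \<le> 1 \<Longrightarrow> rescale Q z = z"
  by (simp add: rescale_def max_absorb1)

lemma norm_rescale_le: "norm (rescale Q z) \<le> norm z"
  by (simp add: rescale_def divide_inverse[symmetric] inverse_eq_divide divide_le_eq mult_le_cancel_left1 max.coboundedI1)

lemma continuous_on_rescale [continuous_intros]:
  "continuous_on S g \<Longrightarrow> continuous_on S (\<lambda>p. rescale (g p) z)"
  unfolding rescale_def by (intro continuous_intros) auto

text \<open>Velocity relative to the moving centre, so that only the change of shape has to be
  compared with it.\<close>

definition velocity ::
  "((real^'nx) \<times> (real^'nw) \<Rightarrow> real^'nx) \<Rightarrow> (real^'nx \<Rightarrow> real^'nu^'nx) \<Rightarrow> real^'nw \<Rightarrow>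
   real^'nx \<Rightarrow> real^'nu \<Rightarrow> real^'nx^'nu \<Rightarrow> real^'nx \<Rightarrow> real^'nw \<Rightarrow> real^'nx" where
  "velocity f G q\<^sub>w q u N y w =
     f (y, w) + G y *v (u + N *v (y - q)) - (f (q, q\<^sub>w) + G q *v u)"

text \<open>The parameter \<open>(q, Q, D, u)\<close> is related to the gains \<open>N\<close> for which the feedback
  \<open>u + N (y - q)\<close> is admissible on the ellipsoid and does not leave it to first order when \<open>D\<close> is
  the derivative of \<open>Q\<close>. The last conjunct says that the velocity is compatible with \<open>D\<close> on the
  kernel of \<open>Q\<close>; the slack constant \<open>C\<close> and the use of \<open>rescale\<close> make the relation closed.\<close>

definition feedback_gains ::
  "((real^'nx) \<times> (real^'nw) \<Rightarrow> real^'nx) \<Rightarrow> (real^'nx \<Rightarrow> real^'nu^'nx) \<Rightarrow> real^'nw \<Rightarrow> (real^'nw) set \<Rightarrow>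
   (real^'nu) set \<Rightarrow>
   (((real^'nx) \<times> (real^'nx^'nx) \<times> (real^'nx^'nx) \<times> (real^'nu)) \<times> ((real^'nx^'nu) \<times> real)) set" where
  "feedback_gains f G q\<^sub>w W U = {p. case p of ((q, Q, D, u), (N, C)) \<Rightarrow>
     (\<forall>z. u + N *v (Q *v rescale Q z) \<in> U) \<and>
     (\<forall>c. \<forall>w\<in>W. 1 < c \<bullet> (Q *v c) \<longrightarrow>
        2 * (rescale Q c \<bullet> velocity f G q\<^sub>w q u N (q + Q *v rescale Q c) w)
          \<le> rescale Q c \<bullet> (D *v rescale Q c)) \<and>
     (\<forall>c z. \<forall>w\<in>W. c \<bullet> velocity f G q\<^sub>w q u N (q + Q *v rescale Q z) w - rescale Q z \<bullet> (D *v c)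
        \<le> C * ((1 + norm z) * norm (Q *v c)))}"

lemma velocity_convex:
  assumes "a + b = 1"
  shows "velocity f G q\<^sub>w q u (a *\<^sub>R N1 + b *\<^sub>R N2) y w
    = a *\<^sub>R velocity f G q\<^sub>w q u N1 y w + b *\<^sub>R velocity f G q\<^sub>w q u N2 y w"
proof -
  have v: "v = a *\<^sub>R v + b *\<^sub>R v" for v :: "real^'k"
    using assms by (metis scaleR_left_distrib scaleR_one)
  show ?thesis
    unfolding velocity_def
    by (subst v[of "f (y, w)"], subst v[of u], subst v[of "f (q, q\<^sub>w) + G q *v u"])
       (simp add: matrix_vector_right_distrib matrix_vector_mult_add_rdistrib
        scaleR_matrix_vector_assoc[symmetric] matrix_vector_mult_scaleR algebra_simps)
qed

text \<open>The velocity is affine in the gain and the slack enters linearly; keeping the slack as a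
  coordinate of the selected object preserves this.\<close>

lemma convex_feedback_gains:
  assumes "convex U"
  shows "convex {k. (p, k) \<in> feedback_gains f G q\<^sub>w W U}"
proof (rule convexI)
  fix k1 k2 and a b :: real
  assume k: "k1 \<in> {k. (p, k) \<in> feedback_gains f G q\<^sub>w W U}" "k2 \<in> {k. (p, k) \<in> feedback_gains f G q\<^sub>w W U}"
    and ab: "0 \<le> a" "0 \<le> b" "a + b = 1"
  obtain q Q D u where p: "p = (q, Q, D, u)" by (metis surj_pair)
  obtain N1 C1 N2 C2 where N: "k1 = (N1, C1)" "k2 = (N2, C2)" by (metis surj_pair)
  note k = k[unfolded p N feedback_gains_def, simplified]
  have eq: "y = a * y + b * y" for y :: real using ab(3) by (metis distrib_right mult_1)
  have comb: "a * x1 + b * x2 \<le> a * y1 + b * y2" if "x1 \<le> y1" "x2 \<le> y2" for x1 x2 y1 y2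
    using that ab by (intro add_mono mult_left_mono) auto
  have "u + (a *\<^sub>R N1 + b *\<^sub>R N2) *v (Q *v rescale Q z) \<in> U" for z
  proof -
    have "a *\<^sub>R (u + N1 *v (Q *v rescale Q z)) + b *\<^sub>R (u + N2 *v (Q *v rescale Q z)) \<in> U"
      using k ab by (intro convexD[OF assms]) auto
    moreover have "a *\<^sub>R u + b *\<^sub>R u = u" using ab(3) by (metis scaleR_left_distrib scaleR_one)
    ultimately show ?thesis
      by (simp add: matrix_vector_mult_add_rdistrib scaleR_matrix_vector_assoc[symmetric] algebra_simps)
         (metis (no_types, lifting) add.assoc)
  qed
  moreover have "2 * (rescale Q c \<bullet> velocity f G q\<^sub>w q u (a *\<^sub>R N1 + b *\<^sub>R N2) (q + Q *v rescale Q c) w)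
          \<le> rescale Q c \<bullet> (D *v rescale Q c)" if "w \<in> W" "1 < c \<bullet> (Q *v c)" for c w
  proof -
    have "a * (2 * (rescale Q c \<bullet> velocity f G q\<^sub>w q u N1 (q + Q *v rescale Q c) w))
        + b * (2 * (rescale Q c \<bullet> velocity f G q\<^sub>w q u N2 (q + Q *v rescale Q c) w))
        \<le> a * (rescale Q c \<bullet> (D *v rescale Q c)) + b * (rescale Q c \<bullet> (D *v rescale Q c))"
      using k that by (intro comb) auto
    then show ?thesis
      unfolding velocity_convex[OF ab(3)] eq[symmetric]
      by (simp add: inner_add_right algebra_simps)
  qed
  moreover have "c \<bullet> velocity f G q\<^sub>w q u (a *\<^sub>R N1 + b *\<^sub>R N2) (q + Q *v rescale Q z) w - rescale Q z \<bullet> (D *v c)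
        \<le> (a * C1 + b * C2) * ((1 + norm z) * norm (Q *v c))" if "w \<in> W" for c z w
  proof -
    have "a * (c \<bullet> velocity f G q\<^sub>w q u N1 (q + Q *v rescale Q z) w - rescale Q z \<bullet> (D *v c))
        + b * (c \<bullet> velocity f G q\<^sub>w q u N2 (q + Q *v rescale Q z) w - rescale Q z \<bullet> (D *v c))
        \<le> a * (C1 * ((1 + norm z) * norm (Q *v c))) + b * (C2 * ((1 + norm z) * norm (Q *v c)))"
      using k that by (intro comb) auto
    then show ?thesis
      unfolding velocity_convex[OF ab(3)]
      by (subst eq[of "rescale Q z \<bullet> (D *v c)"]) (simp add: inner_add_right algebra_simps)
  qed
  ultimately show "a *\<^sub>R k1 + b *\<^sub>R k2 \<in> {k. (p, k) \<in> feedback_gains f G q\<^sub>w W U}"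
    by (simp add: p N feedback_gains_def)
qed

lemma closed_feedback_gains:
  fixes f :: "(real^'nx) \<times> (real^'nw) \<Rightarrow> real^'nx" and G :: "real^'nx \<Rightarrow> real^'nu^'nx"
  assumes f: "continuous_on UNIV f" and G: "continuous_on UNIV G" and U: "closed U"
  shows "closed (feedback_gains f G q\<^sub>w W U)"
proof -
  let ?q = "\<lambda>p. fst (fst p)" and ?Q = "\<lambda>p. fst (snd (fst p))" and ?D = "\<lambda>p. fst (snd (snd (fst p)))"
    and ?u = "\<lambda>p. snd (snd (snd (fst p)))" and ?N = "\<lambda>p. fst (snd p)" and ?C = "\<lambda>p. snd (snd p)"
  have eq: "feedback_gains f G q\<^sub>w W U =
     {p. \<forall>z. ?u p + ?N p *v (?Q p *v rescale (?Q p) z) \<in> U} \<inter>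
     {p. \<forall>c w. w \<in> W \<longrightarrow> 1 < c \<bullet> (?Q p *v c) \<longrightarrow>
        2 * (rescale (?Q p) c \<bullet> velocity f G q\<^sub>w (?q p) (?u p) (?N p) (?q p + ?Q p *v rescale (?Q p) c) w)
          \<le> rescale (?Q p) c \<bullet> (?D p *v rescale (?Q p) c)} \<inter>
     {p. \<forall>c z w. w \<in> W \<longrightarrow> c \<bullet> velocity f G q\<^sub>w (?q p) (?u p) (?N p) (?q p + ?Q p *v rescale (?Q p) z) w
          - rescale (?Q p) z \<bullet> (?D p *v c) \<le> ?C p * ((1 + norm z) * norm (?Q p *v c))}"
    by (auto simp: feedback_gains_def)
  have vel: "continuous_on UNIV (\<lambda>p. velocity f G q\<^sub>w (?q p) (?u p) (?N p) (?q p + ?Q p *v rescale (?Q p) z) w)"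
    for z w
    unfolding velocity_def
    by (intro continuous_intros continuous_on_compose2[OF f] continuous_on_compose2[OF G]) auto
  have 1: "closed {p. ?u p + ?N p *v (?Q p *v rescale (?Q p) z) \<in> U}" for z
  proof -
    have "closed ((\<lambda>p. ?u p + ?N p *v (?Q p *v rescale (?Q p) z)) -` U)"
      by (intro closed_vimage U continuous_intros)
    then show ?thesis by (simp add: vimage_def)
  qed
  \<comment> \<open>An implication with an open premise and a closed conclusion is a closed
    condition. This is why the boundary is reached by rescaling vectors with form above 1 instead of
    requiring form equal to 1.\<close>
  have 2: "open {p. 1 < c \<bullet> (?Q p *v c)}" for c :: "real^'nx"
    by (intro open_Collect_less continuous_intros)
  show ?thesis
    unfolding eq
    by (intro closed_Int closed_Collect_all closed_Collect_imp[OF open_Collect_const] closed_Collect_imp 1 2 closed_Collect_le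
        continuous_intros vel)
qed

lemma feedback_gains_control:
  assumes "((q, Q, D, u), (N, C)) \<in> feedback_gains f G q\<^sub>w W U" "psd Q" "y \<in> ellipsoid q Q"
  shows "u + N *v (y - q) \<in> U"
proof -
  obtain z where z: "y = q + Q *v z" "z \<bullet> (Q *v z) \<le> 1" using ellipsoidE[OF assms(2,3)] .
  have "\<forall>z. u + N *v (Q *v rescale Q z) \<in> U" using assms(1) by (simp add: feedback_gains_def)
  from this[rule_format, of z] show ?thesis using z by (simp add: rescale_id)
qed

lemma feedback_gains_boundary:
  assumes "((q, Q, D, u), (N, C)) \<in> feedback_gains f G q\<^sub>w W U" "e \<bullet> (Q *v e) = 1" "w \<in> W"
  shows "2 * (e \<bullet> velocity f G q\<^sub>w q u N (q + Q *v e) w) \<le> e \<bullet> (D *v e)"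
proof -
  \<comment> \<open>Doubling moves \<open>e\<close> into the open region of the defining condition;
    \<open>rescale\<close> brings it back.\<close>
  let ?c = "2 *\<^sub>R e"
  have form: "?c \<bullet> (Q *v ?c) = 2^2" using assms(2) by (simp add: matrix_vector_mult_scaleR)
  have "rescale Q ?c = e" unfolding rescale_def form by simp
  moreover have "2 * (rescale Q ?c \<bullet> velocity f G q\<^sub>w q u N (q + Q *v rescale Q ?c) w)
          \<le> rescale Q ?c \<bullet> (D *v rescale Q ?c)"
    using assms(1,3) form by (auto simp: feedback_gains_def simp del: scaleR_2)
  ultimately show ?thesis by simp
qed

lemma feedback_gains_kernel:
  assumes "((q, Q, D, u), (N, C)) \<in> feedback_gains f G q\<^sub>w W U" "psd Q" "w \<in> W"
    "Q *v c = 0" "q + Q *v z \<in> ellipsoid q Q"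
  shows "c \<bullet> velocity f G q\<^sub>w q u N (q + Q *v z) w \<le> z \<bullet> (D *v c)"
proof -
  obtain z' where z': "Q *v z = Q *v z'" "z' \<bullet> (Q *v z') \<le> 1"
    using ellipsoidE[OF assms(2,5)] by auto
  \<comment> \<open>The form at \<open>z\<close> depends only on \<open>Q *v z\<close>, so every
    representative of a point of the ellipsoid is fixed by \<open>rescale\<close>.\<close>
  have "z \<bullet> (Q *v z) = z' \<bullet> (Q *v z')"
    using z'(1) psd_dot_swap[OF assms(2), of z z'] by (simp add: inner_commute)
  then have r: "rescale Q z = z" using z'(2) by (simp add: rescale_id)
  have "\<forall>c z. \<forall>w\<in>W. c \<bullet> velocity f G q\<^sub>w q u N (q + Q *v rescale Q z) w - rescale Q z \<bullet> (D *v c)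
        \<le> C * ((1 + norm z) * norm (Q *v c))"
    using assms(1) by (simp add: feedback_gains_def)
  from this[rule_format, OF assms(3), of c z] show ?thesis unfolding r using assms(4) by simp
qed

section \<open>Existence of feedback gains\<close>

lemma loewner_le_form: "M \<preceq> N \<Longrightarrow> c \<bullet> (M *v c) \<le> c \<bullet> (N *v c)"
  by (simp add: loewner_le_def psd_def matrix_vector_mult_diff_rdistrib inner_diff_right)

lemma loewner_le_kernel:
  assumes "M \<preceq> N" "c \<bullet> (M *v c) = c \<bullet> (N *v c)"
  shows "M *v c = N *v c"
proof -
  have "c \<bullet> ((N - M) *v c) = 0"
    using assms(2) by (simp add: matrix_vector_mult_diff_rdistrib inner_diff_right)
  then have "(N - M) *v c = 0" using assms(1) by (simp add: loewner_le_def psd_form_eq_0_iff)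
  then show ?thesis by (simp add: matrix_vector_mult_diff_rdistrib)
qed

lemma feedback_term_mult:
  "feedback_term Q S R M *v c = psd_sqrt Q *v (S *v (psd_sqrt R *v (transpose M *v c)))
     + M *v (psd_sqrt R *v (transpose S *v (psd_sqrt Q *v c)))"
  by (simp only: feedback_term_def matrix_vector_mult_add_rdistrib matrix_vector_mul_assoc[symmetric])

lemma feedback_term_form:
  assumes "psd Q" "psd R"
  shows "c \<bullet> (feedback_term Q S R M *v c)
     = 2 * (c \<bullet> (M *v (psd_sqrt R *v (transpose S *v (psd_sqrt Q *v c)))))"
proof -
  have "c \<bullet> (psd_sqrt Q *v (S *v (psd_sqrt R *v (transpose M *v c))))
      = c \<bullet> (M *v (psd_sqrt R *v (transpose S *v (psd_sqrt Q *v c))))"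
    by (simp only: psd_dot_swap[OF psd_psd_sqrt[OF assms(1)]] dot_transpose[of _ S]
        psd_dot_swap[OF psd_psd_sqrt[OF assms(2)]] transpose_dot) (simp add: inner_commute)
  then show ?thesis by (simp add: feedback_term_mult inner_add_right)
qed

lemma Phi_g_mult:
  "Phi_g f G q\<^sub>w Q\<^sub>w \<Omega>\<^sub>n \<Omega>\<^sub>G u q Q S R lam kap *v c =
     lin_A f G q\<^sub>w q u *v (Q *v c) + Q *v (transpose (lin_A f G q\<^sub>w q u) *v c)
     + feedback_term Q S R (G q) *v c + (1 / lam + 1 / kap) *\<^sub>R (Q *v c) + \<Omega>\<^sub>G q Q R S *v c
     + lam *\<^sub>R (lin_B f q\<^sub>w q *v (Q\<^sub>w *v (transpose (lin_B f q\<^sub>w q) *v c))) + kap *\<^sub>R (\<Omega>\<^sub>n q Q *v c)"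
  by (simp only: Phi_g_def matrix_vector_mult_add_rdistrib matrix_vector_mul_assoc[symmetric]
      scaleR_matrix_vector_assoc[symmetric])

lemma Phi_g_form:
  assumes "psd Q"
  shows "c \<bullet> (Phi_g f G q\<^sub>w Q\<^sub>w \<Omega>\<^sub>n \<Omega>\<^sub>G u q Q S R lam kap *v c) =
     2 * (c \<bullet> (lin_A f G q\<^sub>w q u *v (Q *v c)))
     + c \<bullet> (feedback_term Q S R (G q) *v c) + (1 / lam + 1 / kap) * (c \<bullet> (Q *v c)) + c \<bullet> (\<Omega>\<^sub>G q Q R S *v c)
     + lam * ((transpose (lin_B f q\<^sub>w q) *v c) \<bullet> (Q\<^sub>w *v (transpose (lin_B f q\<^sub>w q) *v c)))
     + kap * (c \<bullet> (\<Omega>\<^sub>n q Q *v c))"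
proof -
  let ?A = "lin_A f G q\<^sub>w q u" and ?B = "lin_B f q\<^sub>w q"
  have "c \<bullet> (Q *v (transpose ?A *v c)) = c \<bullet> (?A *v (Q *v c))"
    by (simp only: psd_dot_swap[OF assms] transpose_dot) (rule inner_commute)
  moreover have "c \<bullet> (?B *v y) = (transpose ?B *v c) \<bullet> y" for y by (rule dot_transpose)
  ultimately show ?thesis by (simp only: Phi_g_mult inner_add_right inner_scaleR_right)
qed

lemma psd_support_eq_0:
  assumes "psd Q" "Q *v c = 0" "v \<in> ellipsoid 0 Q"
  shows "c \<bullet> v = 0"
proof -
  obtain z where "v = 0 + Q *v z" using ellipsoidE[OF assms(1,3)] by blast
  then show ?thesis using psd_dot_swap[OF assms(1), of c z] assms(2) by simp
qed

text \<open>Young's inequality, the origin of the weights \<open>lam\<close>, \<open>kap\<close> and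
  their reciprocals in \<open>Phi_g\<close>.\<close>

lemma twice_le_scaled_square_add_inverse:
  fixes r l :: real
  assumes "0 < l" "0 \<le> X" "y \<le> sqrt X"
  shows "2 * y \<le> l * X + 1 / l"
proof -
  have "0 \<le> (l * sqrt X - 1)^2 / l" using assms by simp
  also have "\<dots> = l * (sqrt X)^2 - 2 * sqrt X + 1 / l"
    using assms(1) by (simp add: power2_eq_square field_simps)
  finally show ?thesis using assms by simp
qed

text \<open>The data frozen at a time where Q_x is differentiable with derivative \<open>D\<close>.
  The assumption \<open>kernel\<close> reflects that semidefinite forms along the path are minimal
  where they vanish.\<close>

locale tube_at_instant =
  fixes f :: "(real^'nx) \<times> (real^'nw) \<Rightarrow> real^'nx" and G :: "real^'nx \<Rightarrow> real^'nu^'nx"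
    and q\<^sub>w :: "real^'nw" and Q\<^sub>w :: "real^'nw^'nw" and q\<^sub>u :: "real^'nu" and Q\<^sub>u :: "real^'nu^'nu"
    and u :: "real^'nu" and g :: real and R :: "real^'nu^'nu"
    and q :: "real^'nx" and Q :: "real^'nx^'nx" and S :: "real^'nu^'nx" and lam kap :: real
    and \<Omega>\<^sub>n :: "real^'nx \<Rightarrow> real^'nx^'nx \<Rightarrow> real^'nx^'nx"
    and \<Omega>\<^sub>G :: "real^'nx \<Rightarrow> real^'nx^'nx \<Rightarrow> real^'nu^'nu \<Rightarrow> real^'nu^'nx \<Rightarrow> real^'nx^'nx"
    and D :: "real^'nx^'nx"
  assumes cont_f: "continuous_on UNIV f" and cont_G: "continuous_on UNIV G"
    and Q\<^sub>w: "psd Q\<^sub>w" and Q\<^sub>u: "psd Q\<^sub>u" and u: "u \<in> ellipsoid q\<^sub>u Q\<^sub>u" and g: "0 < g" "g \<le> 1"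
    and R_def: "R = (1 - g) *\<^sub>R Q\<^sub>u + (1 - inverse g) *\<^sub>R outer (u - q\<^sub>u) (u - q\<^sub>u)"
    and R: "psd R" and Q: "psd Q"
    and \<Omega>\<^sub>n: "psd (\<Omega>\<^sub>n q Q)" and \<Omega>\<^sub>G: "psd (\<Omega>\<^sub>G q Q R S)"
    and n_bound: "\<And>\<xi> \<omega> \<nu>. \<lbrakk>\<xi> \<in> ellipsoid 0 Q; \<omega> \<in> ellipsoid 0 Q\<^sub>w; \<nu> \<in> ellipsoid 0 Q\<^sub>u\<rbrakk> \<Longrightarrow>
          remainder f G q\<^sub>w q u \<xi> \<omega> \<nu> \<in> ellipsoid 0 (\<Omega>\<^sub>n q Q)"
    and G_bound: "\<And>y. y \<in> ellipsoid q Q \<Longrightarrow>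
          feedback_term Q S R (G y) - feedback_term Q S R (G q) \<preceq> \<Omega>\<^sub>G q Q R S"
    and pos: "0 < lam" "0 < kap" and S: "S ** transpose S \<preceq> mat 1"
    and Phi_le: "Phi_g f G q\<^sub>w Q\<^sub>w \<Omega>\<^sub>n \<Omega>\<^sub>G u q Q S R lam kap \<preceq> D"
    and kernel: "\<And>k. Q *v k = 0 \<Longrightarrow> k \<bullet> (D *v k) = 0"
begin

abbreviation "A \<equiv> lin_A f G q\<^sub>w q u"
abbreviation "B \<equiv> lin_B f q\<^sub>w q"

text \<open>The correction encoded by \<open>S\<close>, in terms of a representative z of the point
  q + Q z. Pairing its image under G with z gives half the form of \<open>feedback_term\<close>; the
  bound on \<open>S\<close> makes its transpose a contraction, which keeps the correction in the
  ellipsoid of \<open>R\<close>.\<close>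

definition control :: "real^'nx \<Rightarrow> real^'nu" where
  "control z = psd_sqrt R *v (transpose S *v (psd_sqrt Q *v z))"

lemma control_in:
  assumes "z \<bullet> (Q *v z) \<le> 1"
  shows "control z \<in> ellipsoid 0 R"
proof -
  let ?p = "psd_sqrt Q *v z"
  have "(transpose S *v ?p) \<bullet> (transpose S *v ?p) = ?p \<bullet> ((S ** transpose S) *v ?p)"
    by (simp add: matrix_vector_mul_assoc[symmetric] dot_transpose[of ?p S])
  also have "\<dots> \<le> ?p \<bullet> (mat 1 *v ?p)" by (rule loewner_le_form[OF S])
  also have "\<dots> = (norm ?p)^2" by (simp add: power2_norm_eq_inner)
  also have "\<dots> = z \<bullet> (Q *v z)" using psd_nonneg[OF Q, of z] by (simp add: norm_psd_sqrt_mult[OF Q])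
  finally show ?thesis using assms unfolding ellipsoid_def control_def by auto
qed

lemma velocity_eq:
  assumes z: "z \<bullet> (Q *v z) \<le> 1" and w: "w \<in> ellipsoid q\<^sub>w Q\<^sub>w" and N: "N *v (Q *v z) = control z"
  obtains n where "n \<in> ellipsoid 0 (\<Omega>\<^sub>n q Q)"
    "velocity f G q\<^sub>w q u N (q + Q *v z) w
       = A *v (Q *v z) + B *v (w - q\<^sub>w) + G (q + Q *v z) *v control z + n"
proof -
  let ?n = "remainder f G q\<^sub>w q u (Q *v z) (w - q\<^sub>w) (control z)"
  have "control z \<in> ellipsoid 0 Q\<^sub>u"
    by (rule ellipsoid_control_split(2)[OF Q\<^sub>u R u g R_def control_in[OF z]])
  moreover have "Q *v z \<in> ellipsoid 0 Q" using ellipsoidI[OF Q z, of 0] by simp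
  moreover have "w - q\<^sub>w \<in> ellipsoid 0 Q\<^sub>w" using w by (simp add: ellipsoid_0_iff)
  ultimately have "?n \<in> ellipsoid 0 (\<Omega>\<^sub>n q Q)" by (intro n_bound)
  moreover have "velocity f G q\<^sub>w q u N (q + Q *v z) w
       = A *v (Q *v z) + B *v (w - q\<^sub>w) + G (q + Q *v z) *v control z + ?n"
    by (simp add: velocity_def remainder_def N)
  ultimately show thesis by (rule that)
qed

text \<open>Disturbance and remainder are bounded by their support functions and then by Young's
  inequality, the variation of G by its bounder. Because e \<bullet> Q e = 1, the reciprocals of the
  weights match the multiple of Q, and the sum is exactly the form of \<open>Phi_g\<close> at
  e.\<close>

lemma velocity_boundary:
  assumes e: "e \<bullet> (Q *v e) = 1" and w: "w \<in> ellipsoid q\<^sub>w Q\<^sub>w" and N: "N *v (Q *v e) = control e"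
  shows "2 * (e \<bullet> velocity f G q\<^sub>w q u N (q + Q *v e) w) \<le> e \<bullet> (D *v e)"
proof -
  let ?y = "q + Q *v e"
  obtain n where n: "n \<in> ellipsoid 0 (\<Omega>\<^sub>n q Q)"
    "velocity f G q\<^sub>w q u N ?y w = A *v (Q *v e) + B *v (w - q\<^sub>w) + G ?y *v control e + n"
    using velocity_eq[OF _ w N] e by auto
  let ?b = "transpose B *v e"
  have "e \<bullet> (B *v (w - q\<^sub>w)) = ?b \<bullet> (w - q\<^sub>w)" by (rule dot_transpose)
  also have "\<dots> \<le> sqrt (?b \<bullet> (Q\<^sub>w *v ?b))" by (rule ellipsoid_support_le[OF Q\<^sub>w w])
  finally have 1: "2 * (e \<bullet> (B *v (w - q\<^sub>w))) \<le> lam * (?b \<bullet> (Q\<^sub>w *v ?b)) + 1 / lam"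
    by (intro twice_le_scaled_square_add_inverse pos psd_nonneg[OF Q\<^sub>w])
  have "e \<bullet> n \<le> sqrt (e \<bullet> (\<Omega>\<^sub>n q Q *v e))"
    using ellipsoid_support_le[OF \<Omega>\<^sub>n n(1), of e] by simp
  then have 2: "2 * (e \<bullet> n) \<le> kap * (e \<bullet> (\<Omega>\<^sub>n q Q *v e)) + 1 / kap"
    by (intro twice_le_scaled_square_add_inverse pos psd_nonneg[OF \<Omega>\<^sub>n])
  have "?y \<in> ellipsoid q Q" using e by (intro ellipsoidI[OF Q]) simp
  from loewner_le_form[OF G_bound[OF this], of e]
  have 3: "2 * (e \<bullet> (G ?y *v control e)) \<le> e \<bullet> (feedback_term Q S R (G q) *v e) + e \<bullet> (\<Omega>\<^sub>G q Q R S *v e)"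
    by (simp add: matrix_vector_mult_diff_rdistrib inner_diff_right feedback_term_form[OF Q R, of e S "G ?y"] control_def)
  have "2 * (e \<bullet> velocity f G q\<^sub>w q u N ?y w) = 2 * (e \<bullet> (A *v (Q *v e))) + 2 * (e \<bullet> (B *v (w - q\<^sub>w)))
      + 2 * (e \<bullet> (G ?y *v control e)) + 2 * (e \<bullet> n)"
    by (simp add: n(2) inner_add_right)
  also have "\<dots> \<le> e \<bullet> (Phi_g f G q\<^sub>w Q\<^sub>w \<Omega>\<^sub>n \<Omega>\<^sub>G u q Q S R lam kap *v e)"
    using 1 2 3 by (simp add: Phi_g_form[OF Q] e)
  also have "\<dots> \<le> e \<bullet> (D *v e)" by (rule loewner_le_form[OF Phi_le])
  finally show ?thesis .
qed

text \<open>In the form of \<open>Phi_g\<close> at c only semidefinite terms survive, and their sum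
  is at most c \<bullet> D c = 0. Hence each of them annihilates c, disturbance and remainder are
  invisible in this direction, and \<open>Phi_g\<close> and D agree on c. Pairing with z leaves the
  linear part and the feedback.\<close>

lemma velocity_kernel:
  assumes c: "Q *v c = 0" and z: "z \<bullet> (Q *v z) \<le> 1" and w: "w \<in> ellipsoid q\<^sub>w Q\<^sub>w"
    and N: "N *v (Q *v z) = control z"
  shows "c \<bullet> velocity f G q\<^sub>w q u N (q + Q *v z) w = z \<bullet> (D *v c)"
proof -
  let ?y = "q + Q *v z" and ?b = "transpose B *v c"
    and ?\<Phi> = "Phi_g f G q\<^sub>w Q\<^sub>w \<Omega>\<^sub>n \<Omega>\<^sub>G u q Q S R lam kap"
  have Pc: "psd_sqrt Q *v c = 0" by (simp add: psd_sqrt_mult_eq_0_iff[OF Q] c)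
  have ft0: "c \<bullet> (feedback_term Q S R M *v c) = 0" for M
    by (simp add: feedback_term_form[OF Q R] Pc)
  have "c \<bullet> (?\<Phi> *v c) = c \<bullet> (\<Omega>\<^sub>G q Q R S *v c) + lam * (?b \<bullet> (Q\<^sub>w *v ?b)) + kap * (c \<bullet> (\<Omega>\<^sub>n q Q *v c))"
    by (simp add: Phi_g_form[OF Q] c ft0)
  moreover have "c \<bullet> (?\<Phi> *v c) \<le> 0" using loewner_le_form[OF Phi_le, of c] kernel[OF c] by simp
  moreover have "0 \<le> c \<bullet> (\<Omega>\<^sub>G q Q R S *v c)" "0 \<le> lam * (?b \<bullet> (Q\<^sub>w *v ?b))" "0 \<le> kap * (c \<bullet> (\<Omega>\<^sub>n q Q *v c))"
    using pos psd_nonneg[OF \<Omega>\<^sub>G] psd_nonneg[OF Q\<^sub>w] psd_nonneg[OF \<Omega>\<^sub>n] by auto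
  ultimately have "c \<bullet> (?\<Phi> *v c) = 0" and zero: "c \<bullet> (\<Omega>\<^sub>G q Q R S *v c) = 0"
      "lam * (?b \<bullet> (Q\<^sub>w *v ?b)) = 0" "kap * (c \<bullet> (\<Omega>\<^sub>n q Q *v c)) = 0" by linarith+
  then have Dc: "?\<Phi> *v c = D *v c" using kernel[OF c] by (intro loewner_le_kernel[OF Phi_le]) simp
  have k: "\<Omega>\<^sub>G q Q R S *v c = 0" "Q\<^sub>w *v ?b = 0" "\<Omega>\<^sub>n q Q *v c = 0"
    using zero pos psd_form_eq_0_iff[OF \<Omega>\<^sub>G, of c] psd_form_eq_0_iff[OF Q\<^sub>w, of ?b] psd_form_eq_0_iff[OF \<Omega>\<^sub>n, of c]
    by auto
  have "?y \<in> ellipsoid q Q" by (rule ellipsoidI[OF Q z])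
  \<comment> \<open>The G bound also degenerates to an equality on c, so G at the centre may be
    replaced by G at the actual point.\<close>
  from loewner_le_kernel[OF G_bound[OF this], of c]
  have ft: "feedback_term Q S R (G ?y) *v c = feedback_term Q S R (G q) *v c"
    using k(1) ft0 by (simp add: matrix_vector_mult_diff_rdistrib inner_diff_right)
  have "D *v c = Q *v (transpose A *v c) + feedback_term Q S R (G ?y) *v c"
    by (simp only: Dc[symmetric] Phi_g_mult c k ft matrix_vector_mult_0_right scaleR_zero_right
        add_0_left add_0_right)
  then have "z \<bullet> (D *v c) = z \<bullet> (Q *v (transpose A *v c)) + z \<bullet> (feedback_term Q S R (G ?y) *v c)"
    by (simp add: inner_add_right)
  also have "z \<bullet> (Q *v (transpose A *v c)) = c \<bullet> (A *v (Q *v z))"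
    by (simp only: psd_dot_swap[OF Q] transpose_dot) (rule inner_commute)
  also have "z \<bullet> (feedback_term Q S R (G ?y) *v c) = z \<bullet> (psd_sqrt Q *v (S *v (psd_sqrt R *v (transpose (G ?y) *v c))))"
    by (simp add: feedback_term_mult Pc)
  also have "\<dots> = c \<bullet> (G ?y *v control z)"
    unfolding control_def
    by (simp only: psd_dot_swap[OF psd_psd_sqrt[OF Q]] dot_transpose[of _ S]
        psd_dot_swap[OF psd_psd_sqrt[OF R]] transpose_dot) (rule inner_commute)
  finally have zD: "z \<bullet> (D *v c) = c \<bullet> (A *v (Q *v z)) + c \<bullet> (G ?y *v control z)" .
  obtain n where n: "n \<in> ellipsoid 0 (\<Omega>\<^sub>n q Q)"
    "velocity f G q\<^sub>w q u N ?y w = A *v (Q *v z) + B *v (w - q\<^sub>w) + G ?y *v control z + n"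
    using velocity_eq[OF z w N] by blast
  have "c \<bullet> (B *v (w - q\<^sub>w)) = ?b \<bullet> (w - q\<^sub>w)" by (rule dot_transpose)
  also have "\<dots> = 0" using w by (intro psd_support_eq_0[OF Q\<^sub>w k(2)]) (simp add: ellipsoid_0_iff)
  finally show ?thesis using psd_support_eq_0[OF \<Omega>\<^sub>n k(3) n(1)]
    by (simp add: n(2) inner_add_right zD)
qed

text \<open>The factor Y recovers the root from Q, so a linear gain acting on the deviation Q z
  realises \<open>control z\<close>. The remaining task is the slack constant.\<close>

theorem feedback_gains_nonempty:
  "\<exists>N C. ((q, Q, D, u), (N, C)) \<in> feedback_gains f G q\<^sub>w (ellipsoid q\<^sub>w Q\<^sub>w) (ellipsoid q\<^sub>u Q\<^sub>u)"
proof -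
  obtain Y where Y: "Y ** Q = psd_sqrt Q" using psd_sqrt_left_factor[OF Q] .
  define N where "N = psd_sqrt R ** transpose S ** Y"
  have N: "N *v (Q *v z) = control z" for z
  proof -
    have "Y *v (Q *v z) = psd_sqrt Q *v z" by (simp only: matrix_vector_mul_assoc Y)
    then show ?thesis unfolding N_def control_def by (simp only: matrix_vector_mul_assoc[symmetric])
  qed
  obtain X where X: "\<And>v. Q *v (X *v (Q *v v)) = Q *v v" using psd_generalized_inverse[OF Q] by blast
  let ?vel = "velocity f G q\<^sub>w q u N"
  have "continuous_on (ellipsoid q Q \<times> ellipsoid q\<^sub>w Q\<^sub>w) (\<lambda>(y, w). ?vel y w)"
    unfolding velocity_def case_prod_unfold
    by (intro continuous_intros continuous_on_compose2[OF cont_f] continuous_on_compose2[OF cont_G]) auto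
  from compact_continuous_image[OF this compact_Times[OF compact_ellipsoid compact_ellipsoid]]
  obtain V where V: "\<And>y w. y \<in> ellipsoid q Q \<Longrightarrow> w \<in> ellipsoid q\<^sub>w Q\<^sub>w \<Longrightarrow> norm (?vel y w) \<le> V"
  proof -
    assume "compact ((\<lambda>(y, w). ?vel y w) ` (ellipsoid q Q \<times> ellipsoid q\<^sub>w Q\<^sub>w))"
    then obtain V where "\<forall>v\<in>(\<lambda>(y, w). ?vel y w) ` (ellipsoid q Q \<times> ellipsoid q\<^sub>w Q\<^sub>w). norm v \<le> V"
      using compact_imp_bounded bounded_iff by metis
    then show thesis by (intro that[of V]) auto
  qed
  have V0: "0 \<le> V" using V[OF center_in_ellipsoid center_in_ellipsoid] norm_ge_zero order_trans by blast
  \<comment> \<open>Subtracting X Q c from c leaves a kernel vector, for which the condition is an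
    equality. The subtracted part has norm at most norm X * norm (Q c), and is paired with the
    velocity, bounded by V, and with D.\<close>
  let ?C = "norm X * (V + norm D)"
  have "c \<bullet> ?vel (q + Q *v z) w - z \<bullet> (D *v c) \<le> ?C * ((1 + r) * norm (Q *v c))"
    if w: "w \<in> ellipsoid q\<^sub>w Q\<^sub>w" and z: "z \<bullet> (Q *v z) \<le> 1" "norm z \<le> r" for c w z r
  proof -
    let ?a = "X *v (Q *v c)" and ?y = "q + Q *v z"
    have r: "0 \<le> r" using z(2) norm_ge_zero order_trans by blast
    have "Q *v (c - ?a) = 0" by (simp add: matrix_vector_mult_diff_distrib X)
    from velocity_kernel[OF this z(1) w N]
    have "c \<bullet> ?vel ?y w - z \<bullet> (D *v c) = ?a \<bullet> ?vel ?y w - z \<bullet> (D *v ?a)"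
      by (simp add: matrix_vector_mult_diff_distrib inner_diff_left inner_diff_right algebra_simps)
    also have "\<dots> \<le> norm ?a * V + r * norm D * norm ?a"
    proof -
      have "?a \<bullet> ?vel ?y w \<le> norm ?a * norm (?vel ?y w)" by (rule norm_cauchy_schwarz)
      also have "\<dots> \<le> norm ?a * V" by (intro mult_left_mono V w ellipsoidI[OF Q z(1)]) simp
      finally have "?a \<bullet> ?vel ?y w \<le> norm ?a * V" .
      moreover have "- (z \<bullet> (D *v ?a)) \<le> norm z * norm D * norm ?a"
        using dot_matrix_vector_mult_le[of z D ?a] by linarith
      moreover have "norm z * norm D * norm ?a \<le> r * norm D * norm ?a"
        using z(2) by (intro mult_right_mono) auto
      ultimately show ?thesis by linarith
    qed
    also have "\<dots> = norm ?a * (V + r * norm D)" by (simp add: algebra_simps)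
    also have "\<dots> \<le> (norm X * norm (Q *v c)) * ((V + norm D) * (1 + r))"
    proof (rule mult_mono)
      show "V + r * norm D \<le> (V + norm D) * (1 + r)"
        using V0 r by (simp add: algebra_simps)
    qed (use norm_matrix_vector_mult_le[of X "Q *v c"] V0 r in auto)
    also have "\<dots> = ?C * ((1 + r) * norm (Q *v c))" by simp
    finally show ?thesis .
  qed
  note slack = this
  have "((q, Q, D, u), (N, ?C)) \<in> feedback_gains f G q\<^sub>w (ellipsoid q\<^sub>w Q\<^sub>w) (ellipsoid q\<^sub>u Q\<^sub>u)"
    unfolding feedback_gains_def
  proof (clarsimp, intro conjI allI ballI impI)
    show "u + N *v (Q *v rescale Q z) \<in> ellipsoid q\<^sub>u Q\<^sub>u" for z
      unfolding N by (rule ellipsoid_control_split(1)[OF Q\<^sub>u R u g R_def control_in[OF rescale_form_le[OF Q]]])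
    show "2 * (rescale Q c \<bullet> ?vel (q + Q *v rescale Q c) w) \<le> rescale Q c \<bullet> (D *v rescale Q c)"
      if "w \<in> ellipsoid q\<^sub>w Q\<^sub>w" "1 < c \<bullet> (Q *v c)" for c w
    proof (rule velocity_boundary[OF _ that(1) N])
      have "1 < sqrt (c \<bullet> (Q *v c))" using that(2) by simp
      then have "rescale Q c = c /\<^sub>R sqrt (c \<bullet> (Q *v c))" by (simp add: rescale_def max_absorb2)
      then show "rescale Q c \<bullet> (Q *v rescale Q c) = 1"
        using that(2) by (simp add: matrix_vector_mult_scaleR field_simps)
    qed
    show "c \<bullet> ?vel (q + Q *v rescale Q z) w - rescale Q z \<bullet> (D *v c)
        \<le> ?C * ((1 + norm z) * norm (Q *v c))" if "w \<in> ellipsoid q\<^sub>w Q\<^sub>w" for c z w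
      by (rule slack[OF that rescale_form_le[OF Q] norm_rescale_le])
  qed
  then show ?thesis by blast
qed

end

text \<open>The actual velocity is compared with the one at the projection under the same control
  value. The difference costs L times the distance, and the conditions on the gain apply at the
  projection.\<close>

lemma (in moving_ellipsoid) admissibleI:
  assumes t: "t \<in> {a..b}"
    and dxq: "((\<lambda>s. x s - q s) has_vector_derivative g) (at t within {a..b})"
    and dQ: "(Q has_vector_derivative D) (at t within {a..b})"
    and sym: "transpose D = D" and ker: "\<And>k. Q t *v k = 0 \<Longrightarrow> k \<bullet> (D *v k) = 0"
    and K: "((q t, Q t, D, u), (N, C)) \<in> feedback_gains f G q\<^sub>w W U" and w: "w \<in> W"
    and g: "g = f (x t, w) + G (x t) *v (u + N *v (proj t - q t)) - (f (q t, q\<^sub>w) + G (q t) *v u)"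
    and gV: "norm g \<le> V" and velV: "\<And>y. y \<in> E t \<Longrightarrow> norm (velocity f G q\<^sub>w (q t) u N y w) \<le> V"
    and lip: "\<And>y m. y \<in> E t \<Longrightarrow> m \<in> U \<Longrightarrow>
      norm (f (x t, w) + G (x t) *v m - (f (y, w) + G y *v m)) \<le> L * norm (x t - y)"
  shows "admissible t g D"
proof -
  note psd = psd_Q[OF t]
  let ?vel = "velocity f G q\<^sub>w (q t) u N"
  have unit: "(c /\<^sub>R s) \<bullet> (Q t *v (c /\<^sub>R s)) = 1" if "s = sqrt (c \<bullet> (Q t *v c))" "0 < c \<bullet> (Q t *v c)" for c s
    using that by (simp add: matrix_vector_mult_scaleR field_simps)
  have bd: "2 * s * (c \<bullet> ?vel (q t + Q t *v (c /\<^sub>R s)) w) \<le> c \<bullet> (D *v c)"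
    if s: "s = sqrt (c \<bullet> (Q t *v c))" "0 < c \<bullet> (Q t *v c)" for c s
  proof -
    have s0: "0 < s" using s by simp
    have "2 * ((c /\<^sub>R s) \<bullet> ?vel (q t + Q t *v (c /\<^sub>R s)) w) \<le> (c /\<^sub>R s) \<bullet> (D *v (c /\<^sub>R s))"
      by (rule feedback_gains_boundary[OF K unit[OF s] w])
    then have "2 * (c \<bullet> ?vel (q t + Q t *v (c /\<^sub>R s)) w) / s \<le> (c \<bullet> (D *v c)) / (s * s)"
      by (simp add: matrix_vector_mult_scaleR divide_inverse ac_simps)
    then have "2 * (c \<bullet> ?vel (q t + Q t *v (c /\<^sub>R s)) w) / s * (s * s) \<le> c \<bullet> (D *v c)"
      using s0 by (simp add: pos_le_divide_eq)
    then show ?thesis using s0 by (simp add: ac_simps)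
  qed
  \<comment> \<open>The boundary condition read as a lower bound on D: at the support point in
    direction c the ellipsoid must keep up with a velocity of norm at most V.\<close>
  have lower: "- (c \<bullet> (D *v c)) \<le> 2 * V * sqrt (c \<bullet> (Q t *v c))" if c: "norm c = 1" for c
  proof (cases "Q t *v c = 0")
    case True
    then show ?thesis using ker V_nonneg by simp
  next
    case False
    then have pos: "0 < c \<bullet> (Q t *v c)"
      using psd_nonneg[OF psd, of c] psd_form_eq_0_iff[OF psd, of c] by simp
    define s where "s = sqrt (c \<bullet> (Q t *v c))"
    define y where "y = q t + Q t *v (c /\<^sub>R s)"
    have "y \<in> E t" unfolding y_def E_def using unit[OF s_def pos] by (intro ellipsoidI psd) simp
    then have "norm (?vel y w) \<le> V" by (rule velV)
    moreover have "\<bar>c \<bullet> ?vel y w\<bar> \<le> norm (?vel y w)"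
      using Cauchy_Schwarz_ineq2[of c "?vel y w"] c by simp
    ultimately have "- (c \<bullet> ?vel y w) \<le> V" by linarith
    then have "2 * s * (- (c \<bullet> ?vel y w)) \<le> 2 * s * V"
      by (rule mult_left_mono) (simp add: s_def psd_nonneg[OF psd])
    moreover have "2 * s * (c \<bullet> ?vel y w) \<le> c \<bullet> (D *v c)" using bd[OF s_def pos] by (simp only: y_def)
    ultimately show ?thesis by (simp add: s_def algebra_simps)
  qed
  define c where "c = (x t - proj t) /\<^sub>R dist_E t"
  have out: "(0 < c \<bullet> (Q t *v c) \<longrightarrow> c \<bullet> g \<le> L * dist_E t + (c \<bullet> (D *v c)) / (2 * sqrt (c \<bullet> (Q t *v c)))) \<and>
        (\<forall>z. Q t *v c = 0 \<longrightarrow> proj t = q t + Q t *v z \<longrightarrow> c \<bullet> g \<le> L * dist_E t + z \<bullet> (D *v c))"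
    if xE: "x t \<notin> E t"
  proof -
    note supp = closest_point_ellipsoid_support[OF psd xE[unfolded E_def],
        folded E_def, folded proj_def, folded dist_E_def, folded c_def]
    let ?m = "u + N *v (proj t - q t)"
    have m: "?m \<in> U"
      by (rule feedback_gains_control[OF K psd]) (use proj_in[of t] in \<open>simp add: E_def\<close>)
    let ?\<Delta> = "f (x t, w) + G (x t) *v ?m - (f (proj t, w) + G (proj t) *v ?m)"
    have "g = ?vel (proj t) w + ?\<Delta>" by (simp add: g velocity_def)
    then have "c \<bullet> g = c \<bullet> ?vel (proj t) w + c \<bullet> ?\<Delta>" by (simp only: inner_add_right)
    moreover have "c \<bullet> ?\<Delta> \<le> norm ?\<Delta>" using norm_cauchy_schwarz[of c ?\<Delta>] supp(1) by simp
    moreover have "norm ?\<Delta> \<le> L * dist_E t" unfolding dist_E_def by (rule lip[OF proj_in m])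
    ultimately have cg: "c \<bullet> g \<le> L * dist_E t + c \<bullet> ?vel (proj t) w" by linarith
    show ?thesis
    proof (intro conjI impI allI)
      assume pos: "0 < c \<bullet> (Q t *v c)"
      have "2 * sqrt (c \<bullet> (Q t *v c)) * (c \<bullet> ?vel (proj t) w) \<le> c \<bullet> (D *v c)"
        using bd[OF refl pos] supp(4)[OF pos] by simp
      then have "c \<bullet> ?vel (proj t) w \<le> (c \<bullet> (D *v c)) / (2 * sqrt (c \<bullet> (Q t *v c)))"
        using pos by (simp add: pos_le_divide_eq ac_simps)
      then show "c \<bullet> g \<le> L * dist_E t + (c \<bullet> (D *v c)) / (2 * sqrt (c \<bullet> (Q t *v c)))"
        using cg by linarith
    next
      fix z assume z: "Q t *v c = 0" "proj t = q t + Q t *v z"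
      have "c \<bullet> ?vel (proj t) w \<le> z \<bullet> (D *v c)"
        unfolding z(2) using proj_in[of t] z(2)
        by (intro feedback_gains_kernel[OF K psd w z(1)]) (simp add: E_def)
      then show "c \<bullet> g \<le> L * dist_E t + z \<bullet> (D *v c)" using cg by linarith
    qed
  qed
  show ?thesis
    unfolding admissible_def Let_def c_def[symmetric]
    using dxq dQ sym gV lower ker out by blast
qed

section \<open>Regularity of the data and Borel versions\<close>

lemma twice_cont_diff_continuous:
  assumes "twice_cont_diff f"
  shows "continuous_on S f"
proof -
  obtain f' where d: "\<And>x. (f has_derivative blinfun_apply (f' x)) (at x)"
    using assms unfolding twice_cont_diff_def by blast
  show ?thesis by (intro continuous_at_imp_continuous_on ballI has_derivative_continuous[OF d])
qed

lemma twice_cont_diff_lipschitz: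
  fixes f :: "'a::euclidean_space \<Rightarrow> 'b::euclidean_space"
  assumes f: "twice_cont_diff f" and K: "compact K" "convex K"
  obtains L where "0 \<le> L" "\<And>x y. x \<in> K \<Longrightarrow> y \<in> K \<Longrightarrow> norm (f x - f y) \<le> L * norm (x - y)"
proof -
  obtain f' f'' where d: "\<And>x. (f has_derivative blinfun_apply (f' x)) (at x)"
    "\<And>x. (f' has_derivative blinfun_apply (f'' x)) (at x)"
    using f unfolding twice_cont_diff_def by metis
  have "continuous_on K f'" by (intro continuous_at_imp_continuous_on ballI has_derivative_continuous[OF d(2)])
  then have "bounded (f' ` K)" using K(1) compact_continuous_image compact_imp_bounded by blast
  then obtain L where L: "0 < L" "\<And>x. x \<in> K \<Longrightarrow> norm (f' x) \<le> L"
    unfolding bounded_pos by blast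
  have "norm (f x - f y) \<le> L * norm (x - y)" if "x \<in> K" "y \<in> K" for x y
    by (rule differentiable_bound[OF K(2) has_derivative_at_withinI[OF d(1)] _ that])
       (use L in \<open>auto simp: norm_blinfun.rep_eq[symmetric]\<close>)
  then show thesis using L(1) that[of L] by auto
qed

lemma borel_version_on_interval:
  fixes u :: "real \<Rightarrow> 'a::euclidean_space"
  assumes "u absolutely_integrable_on {a..b}"
  obtains v where "v \<in> borel_measurable borel" "AE t in lebesgue. t \<in> {a..b} \<longrightarrow> v t = u t"
proof -
  let ?h = "\<lambda>t. indicator {a..b} t *\<^sub>R u t"
  have h: "?h \<in> borel_measurable (completion lborel)"
    using assms unfolding set_integrable_def by (rule borel_measurable_integrable)
  have "\<exists>g\<in>borel_measurable lborel. AE t in lborel. ?h t \<bullet> i = g t" for i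
    by (rule completion_ex_borel_measurable_real) (use h in measurable)
  then obtain g where g: "\<And>i. g i \<in> borel_measurable lborel" "\<And>i. AE t in lborel. ?h t \<bullet> i = g i t"
    by metis
  define v where "v t = (\<Sum>i\<in>Basis. g i t *\<^sub>R i)" for t
  have "AE t in lborel. \<forall>i\<in>Basis. ?h t \<bullet> i = g i t" using g(2) by (intro AE_finite_allI) auto
  then have "AE t in lebesgue. \<forall>i\<in>Basis. ?h t \<bullet> i = g i t" by (rule AE_completion)
  then have "AE t in lebesgue. t \<in> {a..b} \<longrightarrow> v t = u t"
  proof eventually_elim
    case (elim t)
    then have "v t = (\<Sum>i\<in>Basis. (?h t \<bullet> i) *\<^sub>R i)" by (simp add: v_def)
    then show ?case by (simp only: euclidean_representation) simp
  qed
  moreover have "v \<in> borel_measurable borel"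
    unfolding v_def using g(1) by (intro borel_measurable_sum borel_measurable_scaleR) auto
  ultimately show thesis by (rule that[rotated])
qed

text \<open>The limit of difference quotients along a fixed sequence of steps is Borel on the whole
  line and is the derivative wherever one exists.\<close>

lemma borel_derivative:
  fixes F :: "real \<Rightarrow> 'a::euclidean_space"
  assumes "continuous_on UNIV F"
  obtains F' where "F' \<in> borel_measurable borel"
    "\<And>t D. (F has_vector_derivative D) (at t) \<Longrightarrow> F' t = D"
proof -
  define h where "h n = 1 / real (Suc n)" for n
  have h0: "h n \<noteq> 0" for n by (simp add: h_def)
  have "h \<longlonglongrightarrow> 0" unfolding h_def by (rule LIMSEQ_Suc[OF lim_const_over_n])
  then have h: "filterlim h (at 0) sequentially" using h0 by (simp add: filterlim_at)
  define F' where "F' t = lim (\<lambda>n. (F (t + h n) - F t) /\<^sub>R h n)" for t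
  have "F' \<in> borel_measurable borel"
    unfolding F'_def
    by (intro borel_measurable_lim_metric borel_measurable_continuous_onI continuous_intros
        continuous_on_compose2[OF assms]) (auto simp: h0)
  moreover have "F' t = D" if "(F has_vector_derivative D) (at t)" for t D
  proof -
    have "(\<lambda>s. (F (t + s) - F t) /\<^sub>R s) \<midarrow>0\<rightarrow> D"
    proof -
      have "(\<lambda>s. norm (F (t + s) - F t - s *\<^sub>R D) / norm s) \<midarrow>0\<rightarrow> 0"
        using that by (simp add: has_vector_derivative_def has_derivative_at)
      moreover have "norm (F (t + s) - F t - s *\<^sub>R D) / norm s = norm ((F (t + s) - F t) /\<^sub>R s - D)"
        if "s \<noteq> 0" for s
      proof -
        have "F (t + s) - F t - s *\<^sub>R D = s *\<^sub>R ((F (t + s) - F t) /\<^sub>R s - D)"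
          using that by (simp add: scaleR_diff_right)
        then show ?thesis using that by simp
      qed
      ultimately have "(\<lambda>s. norm ((F (t + s) - F t) /\<^sub>R s - D)) \<midarrow>0\<rightarrow> 0"
        by (rule Lim_transform_within[OF _ zero_less_one]) simp
      then show ?thesis by (simp only: tendsto_norm_zero_iff LIM_zero_iff)
    qed
    then have "(\<lambda>n. (F (t + h n) - F t) /\<^sub>R h n) \<longlonglongrightarrow> D" by (rule filterlim_compose[OF _ h])
    then show ?thesis unfolding F'_def by (rule limI)
  qed
  ultimately show thesis by (rule that)
qed

section \<open>The feedback law\<close>

text \<open>Symmetry is inherited by differentiating the symmetric bilinear forms. For a kernel
  vector the form is nonnegative nearby and 0 at t, an interior minimum.\<close>

lemma psd_path_derivative:
  fixes Q :: "real \<Rightarrow> real^'n^'n"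
  assumes dQ: "(Q has_vector_derivative D) (at t)" and t: "a < t" "t < b"
    and psd: "\<And>s. s \<in> {a..b} \<Longrightarrow> psd (Q s)"
  shows "transpose D = D" "Q t *v k = 0 \<Longrightarrow> k \<bullet> (D *v k) = 0"
proof -
  have form: "((\<lambda>s. c \<bullet> (Q s *v d)) has_real_derivative c \<bullet> (D *v d)) (at t)" for c d
  proof -
    have "((\<lambda>s. Q s *v d) has_vector_derivative D *v d) (at t)"
      by (rule bounded_linear.has_vector_derivative[OF
            bounded_bilinear.bounded_linear_left[OF bounded_bilinear_matrix_vector_mult] dQ])
    from bounded_linear.has_vector_derivative[OF bounded_linear_inner_right this]
    show ?thesis by (simp add: has_real_derivative_iff_has_vector_derivative)
  qed
  have "c \<bullet> (D *v d) = d \<bullet> (D *v c)" for c d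
  proof (rule DERIV_unique[OF form])
    show "((\<lambda>s. c \<bullet> (Q s *v d)) has_real_derivative d \<bullet> (D *v c)) (at t)"
    proof (rule has_field_derivative_transform_within_open[OF form open_greaterThanLessThan])
      fix s assume "s \<in> {a<..<b}"
      then show "d \<bullet> (Q s *v c) = c \<bullet> (Q s *v d)"
        using psd_dot_swap[OF psd, of s c d] by (simp add: inner_commute)
    qed (use t in auto)
  qed
  note swap = this
  have "d \<bullet> (transpose D *v c) = d \<bullet> (D *v c)" for c d
    unfolding transpose_dot inner_commute[of "D *v d"] by (rule swap)
  then have "transpose D *v c = D *v c" for c
    using vector_eq_ldot[of "transpose D *v c" "D *v c"] by blast
  then show "transpose D = D" by (simp add: matrix_eq)
  assume k: "Q t *v k = 0"
  show "k \<bullet> (D *v k) = 0"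
  proof (rule DERIV_local_min[OF form])
    show "0 < min (t - a) (b - t)" using t by simp
    show "\<forall>s. \<bar>t - s\<bar> < min (t - a) (b - t) \<longrightarrow> k \<bullet> (Q t *v k) \<le> k \<bullet> (Q s *v k)"
    proof (intro allI impI)
      fix s assume "\<bar>t - s\<bar> < min (t - a) (b - t)"
      then have "s \<in> {a..b}" by auto
      then show "k \<bullet> (Q t *v k) \<le> k \<bullet> (Q s *v k)" using k psd_nonneg[OF psd] by simp
    qed
  qed
qed

lemma dynamics_bounds:
  fixes f :: "(real^'nx) \<times> (real^'nw) \<Rightarrow> real^'nx" and G :: "real^'nx \<Rightarrow> real^'nu^'nx"
  assumes f: "twice_cont_diff f" and G: "twice_cont_diff G"
    and X: "compact X" "convex X" and W: "compact W" "convex W" and U: "compact U"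
  obtains L V where "0 \<le> L" "0 \<le> V"
    "\<And>x y w m. \<lbrakk>x \<in> X; y \<in> X; w \<in> W; m \<in> U\<rbrakk> \<Longrightarrow>
       norm (f (x, w) + G x *v m - (f (y, w) + G y *v m)) \<le> L * norm (x - y)"
    "\<And>x w m. \<lbrakk>x \<in> X; w \<in> W; m \<in> U\<rbrakk> \<Longrightarrow> norm (f (x, w) + G x *v m) \<le> V"
proof -
  obtain M where M: "0 < M" "\<And>m. m \<in> U \<Longrightarrow> norm m \<le> M"
    using compact_imp_bounded[OF U] by (auto simp: bounded_pos)
  obtain Lf where Lf: "0 \<le> Lf"
    "\<And>p p'. p \<in> X \<times> W \<Longrightarrow> p' \<in> X \<times> W \<Longrightarrow> norm (f p - f p') \<le> Lf * norm (p - p')"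
    using twice_cont_diff_lipschitz[OF f compact_Times[OF X(1) W(1)] convex_Times[OF X(2) W(2)]] by metis
  obtain LG where LG: "0 \<le> LG" "\<And>x y. x \<in> X \<Longrightarrow> y \<in> X \<Longrightarrow> norm (G x - G y) \<le> LG * norm (x - y)"
    using twice_cont_diff_lipschitz[OF G X] by metis
  have cf: "continuous_on UNIV f" and cG: "continuous_on UNIV G"
    by (rule twice_cont_diff_continuous, fact)+
  have "continuous_on (X \<times> W \<times> U) (\<lambda>(x, w, m). f (x, w) + G x *v m)"
    unfolding case_prod_unfold
    by (intro continuous_intros continuous_on_compose2[OF cf] continuous_on_compose2[OF cG]) auto
  then have "compact ((\<lambda>(x, w, m). f (x, w) + G x *v m) ` (X \<times> W \<times> U))"
    by (rule compact_continuous_image) (intro compact_Times X W U)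
  then obtain V where V: "0 < V" "\<forall>v\<in>(\<lambda>(x, w, m). f (x, w) + G x *v m) ` (X \<times> W \<times> U). norm v \<le> V"
    by (auto dest!: compact_imp_bounded simp only: bounded_pos)
  show thesis
  proof (rule that)
    show "0 \<le> Lf + LG * M" "0 \<le> V" using Lf(1) LG(1) M(1) V(1) by auto
    show "norm (f (x, w) + G x *v m) \<le> V" if "x \<in> X" "w \<in> W" "m \<in> U" for x w m
      using V(2) that by fastforce
    fix x y w m assume *: "x \<in> X" "y \<in> X" "w \<in> W" "m \<in> U"
    have "norm (f (x, w) - f (y, w)) \<le> Lf * norm (x - y)"
      using Lf(2)[of "(x, w)" "(y, w)"] * by (simp add: norm_Pair)
    moreover have "norm ((G x - G y) *v m) \<le> LG * norm (x - y) * M"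
      by (rule order_trans[OF norm_matrix_vector_mult_le mult_mono]) (use * LG M in auto)
    moreover have "f (x, w) + G x *v m - (f (y, w) + G y *v m) = (f (x, w) - f (y, w)) + (G x - G y) *v m"
      by (simp add: matrix_vector_mult_diff_rdistrib)
    ultimately show "norm (f (x, w) + G x *v m - (f (y, w) + G y *v m)) \<le> (Lf + LG * M) * norm (x - y)"
      using norm_triangle_ineq[of "f (x, w) - f (y, w)" "(G x - G y) *v m"] by (simp add: algebra_simps)
  qed
qed

lemma borel_measurable_matrix_vector_mult [measurable (raw)]:
  fixes A :: "'a \<Rightarrow> real^'n^'m"
  assumes "A \<in> borel_measurable M" "v \<in> borel_measurable M"
  shows "(\<lambda>x. A x *v v x) \<in> borel_measurable M"
  by (rule borel_measurable_continuous_Pair[OF assms]) (intro continuous_intros)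

lemma borel_bounded_absolutely_integrable:
  fixes h :: "'a::euclidean_space \<Rightarrow> 'b::euclidean_space"
  assumes "h \<in> borel_measurable borel" "S \<in> lmeasurable" "\<And>x. x \<in> S \<Longrightarrow> norm (h x) \<le> B"
  shows "h absolutely_integrable_on S"
proof (rule measurable_bounded_by_integrable_imp_absolutely_integrable)
  have "h \<in> borel_measurable lborel" using assms(1) by simp
  then have "h \<in> borel_measurable lebesgue" by (rule measurable_completion)
  then show "h \<in> borel_measurable (lebesgue_on S)" by (rule measurable_restrict_space1)
qed (use assms integrable_on_const in auto)

text \<open>The selection is composed with a Borel path of data that agrees with the given data
  almost everywhere. Nonemptiness at an instant is passed in through \<open>k\<close>.\<close>

lemma measurable_feedback_exists:
  fixes f :: "(real^'nx) \<times> (real^'nw) \<Rightarrow> real^'nx" and G :: "real^'nx \<Rightarrow> real^'nu^'nx"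
    and q :: "real \<Rightarrow> real^'nx" and U :: "(real^'nu) set"
  assumes ab: "a \<le> b" and f: "continuous_on UNIV f" and G: "continuous_on UNIV G"
    and U: "compact U" "convex U" "U \<noteq> {}"
    and q: "continuous_on {a..b} q" and Q: "continuous_on {a..b} Q"
    and psd: "\<And>t. t \<in> {a..b} \<Longrightarrow> psd (Q t)" and u: "u absolutely_integrable_on {a..b}"
  obtains \<mu> N where "integrable_feedback a b U \<mu>"
    "AE t in lebesgue. t \<in> {a..b} \<longrightarrow> (\<forall>D k. (Q has_vector_derivative D) (at t) \<longrightarrow>
        ((q t, Q t, D, u t), k) \<in> feedback_gains f G q\<^sub>w W U \<longrightarrow>
        (\<exists>C. ((q t, Q t, D, u t), (N t, C)) \<in> feedback_gains f G q\<^sub>w W U) \<and>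
        (\<forall>x. \<mu> t x = u t + N t *v (closest_point (ellipsoid (q t) (Q t)) x - q t)))"
proof -
  let ?K = "feedback_gains f G q\<^sub>w W U"
  obtain \<sigma> where \<sigma>: "\<sigma> \<in> borel_measurable borel" "\<And>p k. (p, k) \<in> ?K \<Longrightarrow> (p, \<sigma> p) \<in> ?K"
    and dom: "{p. \<exists>k. (p, k) \<in> ?K} \<in> sets borel"
    using borel_min_norm_selection[OF closed_feedback_gains[OF f G compact_imp_closed[OF U(1)]]
        convex_feedback_gains[OF U(2)]] by metis
  obtain m0 where m0: "m0 \<in> U" using U(3) by blast
  obtain B where B: "\<And>m. m \<in> U \<Longrightarrow> norm m \<le> B"
    using compact_imp_bounded[OF U(1)] bounded_iff by blast
  \<comment> \<open>Clamping time to the interval extends the continuous data to the whole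
    line.\<close>
  define cl where "cl t = max a (min b t)" for t
  have cl: "cl t \<in> {a..b}" "t \<in> {a..b} \<Longrightarrow> cl t = t" for t using ab by (auto simp: cl_def)
  have cont_cl: "continuous_on UNIV cl" unfolding cl_def by (intro continuous_intros)
  define q' Q' where "q' t = q (cl t)" and "Q' t = Q (cl t)" for t
  have cont_q': "continuous_on UNIV q'" and cont_Q': "continuous_on UNIV Q'"
    unfolding q'_def Q'_def using cl
    by (auto intro!: continuous_on_compose2[OF q cont_cl] continuous_on_compose2[OF Q cont_cl])
  define Y where "Y p = closest_point (ellipsoid (q' (fst p)) (Q' (fst p))) (snd p)" for p
  have cont_Y: "continuous_on UNIV Y"
  proof -
    have "continuous_on UNIV (\<lambda>p. (\<lambda>(t, x). closest_point (ellipsoid (q t) (Q t)) x) (cl (fst p), snd p))"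
    proof (rule continuous_on_compose2[OF continuous_on_closest_point_ellipsoid])
      show "continuous_on UNIV (\<lambda>p. (cl (fst p), snd p :: real^'nx))"
        by (intro continuous_intros continuous_on_compose2[OF cont_cl]) auto
    qed (use q Q psd cl in auto)
    then show ?thesis by (simp add: Y_def q'_def Q'_def)
  qed
  have YE: "Y (t, x) \<in> ellipsoid (q' t) (Q' t)" for t x
    unfolding Y_def by (simp add: closest_point_ellipsoid_in)
  obtain D' where D': "D' \<in> borel_measurable borel"
    "\<And>t D. (Q' has_vector_derivative D) (at t) \<Longrightarrow> D' t = D"
    using borel_derivative[OF cont_Q'] by metis
  obtain v where v: "v \<in> borel_measurable borel" "AE t in lebesgue. t \<in> {a..b} \<longrightarrow> v t = u t"
    using borel_version_on_interval[OF u] by metis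
  define p where "p t = (q' t, Q' t, D' t, v t)" for t
  have p: "p \<in> borel_measurable borel"
    unfolding p_def
    by (intro borel_measurable_Pair D'(1) v(1) borel_measurable_continuous_onI cont_q' cont_Q')
  define T where "T = {t. \<exists>k. (p t, k) \<in> ?K}"
  have T: "T \<in> sets borel"
    using measurable_sets[OF p dom] by (simp add: T_def vimage_def)
  define N where "N t = fst (\<sigma> (p t))" for t
  have NK: "(p t, (N t, snd (\<sigma> (p t)))) \<in> ?K" if "t \<in> T" for t
  proof -
    obtain k where "(p t, k) \<in> ?K" using \<open>t \<in> T\<close> unfolding T_def by blast
    then have "(p t, \<sigma> (p t)) \<in> ?K" by (rule \<sigma>(2))
    then show ?thesis by (simp only: N_def prod.collapse)
  qed
  have N: "N \<in> borel_measurable borel"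
    unfolding N_def using measurable_compose[OF p \<sigma>(1)]
    by (intro borel_measurable_continuous_on[of fst]) (auto intro: continuous_intros)
  \<comment> \<open>Instants without a suitable gain get a fixed control value, so the feedback is
    bounded and takes values in \<open>U\<close> everywhere.\<close>
  define \<mu> where "\<mu> t x = (if t \<in> T then v t + N t *v (Y (t, x) - q' t) else m0)" for t x
  have muU: "\<mu> t x \<in> U" for t x
  proof (cases "t \<in> T")
    case True
    have "v t + N t *v (Y (t, x) - q' t) \<in> U"
      by (rule feedback_gains_control[OF NK[OF True, unfolded p_def] _ YE])
         (use psd cl in \<open>auto simp: Q'_def\<close>)
    then show ?thesis using True by (simp add: \<mu>_def)
  qed (simp add: \<mu>_def m0)
  have mu: "(\<lambda>p. \<mu> (fst p) (snd p)) \<in> borel_measurable borel"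
  proof -
    have fst: "fst \<in> borel_measurable (borel :: (real \<times> (real^'nx)) measure)"
      by (intro borel_measurable_continuous_onI continuous_intros)
    have "Measurable.pred borel (\<lambda>p :: real \<times> (real^'nx). fst p \<in> T)"
      using measurable_sets[OF fst T] by (simp add: vimage_def pred_def)
    moreover have "q' \<in> borel_measurable borel" by (rule borel_measurable_continuous_onI[OF cont_q'])
    moreover have "Y \<in> borel_measurable borel" by (rule borel_measurable_continuous_onI[OF cont_Y])
    ultimately show ?thesis
      unfolding \<mu>_def prod.collapse
      by (intro measurable_If borel_measurable_add borel_measurable_matrix_vector_mult borel_measurable_diff
          measurable_compose[OF fst] v(1) N) auto
  qed
  have "integrable_feedback a b U \<mu>"
    unfolding integrable_feedback_def
  proof (intro conjI ballI allI impI)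
    show "\<mu> t x \<in> U" for t x by (rule muU)
    show "(\<lambda>(t, x). \<mu> t x) absolutely_integrable_on ({a..b} \<times> K)" if "compact K" for K
      using borel_bounded_absolutely_integrable[OF mu lmeasurable_compact[OF compact_Times[OF compact_Icc that]], of a b B] B muU
      by (simp add: case_prod_unfold)
    fix x :: "real \<Rightarrow> real^'nx" assume x: "continuous_on {a..b} x"
    have "continuous_on UNIV (\<lambda>t. (t, x (cl t)))"
      by (intro continuous_intros continuous_on_compose2[OF x cont_cl]) (use cl in auto)
    then have "(\<lambda>t. (t, x (cl t))) \<in> borel_measurable borel" by (rule borel_measurable_continuous_onI)
    from measurable_compose[OF this mu]
    have "(\<lambda>t. \<mu> t (x (cl t))) absolutely_integrable_on {a..b}"
      using B muU by (intro borel_bounded_absolutely_integrable[where B = B]) auto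
    then show "(\<lambda>t. \<mu> t (x t)) absolutely_integrable_on {a..b}"
      by (rule absolutely_integrable_spike[OF _ negligible_empty]) (use cl(2) in auto)
  qed
  \<comment> \<open>At interior times the clamped path coincides with \<open>Q\<close> nearby and so
    has the same derivative.\<close>
  moreover have "AE t in lebesgue. t \<noteq> a \<and> t \<noteq> b"
    by (rule AE_completion) (use AE_lborel_singleton in auto)
  with v(2) have "AE t in lebesgue. t \<in> {a..b} \<longrightarrow> (\<forall>D k. (Q has_vector_derivative D) (at t) \<longrightarrow>
        ((q t, Q t, D, u t), k) \<in> ?K \<longrightarrow>
        (\<exists>C. ((q t, Q t, D, u t), (N t, C)) \<in> ?K) \<and>
        (\<forall>x. \<mu> t x = u t + N t *v (closest_point (ellipsoid (q t) (Q t)) x - q t)))"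
  proof eventually_elim
    case (elim t)
    show ?case
    proof (intro impI allI)
      fix D k assume t: "t \<in> {a..b}" and dQ: "(Q has_vector_derivative D) (at t)"
        and k: "((q t, Q t, D, u t), k) \<in> ?K"
      have "(Q' has_vector_derivative D) (at t)"
        by (rule has_vector_derivative_transform_within_open[OF dQ open_greaterThanLessThan[of a b]])
           (use t elim cl(2) in \<open>auto simp: Q'_def\<close>)
      then have pt: "p t = (q t, Q t, D, u t)"
        using D'(2) elim t cl(2)[OF t] by (simp add: p_def q'_def Q'_def)
      have "(p t, k) \<in> ?K" unfolding pt by (rule k)
      then have tT: "t \<in> T" unfolding T_def by blast
      show "(\<exists>C. ((q t, Q t, D, u t), (N t, C)) \<in> ?K) \<and>
        (\<forall>x. \<mu> t x = u t + N t *v (closest_point (ellipsoid (q t) (Q t)) x - q t))"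
        using NK[OF tT] tT elim t cl(2)[OF t] by (auto simp: pt \<mu>_def Y_def q'_def Q'_def)
    qed
  qed
  ultimately show thesis by (rule that)
qed

theorem theorem5:
  fixes f :: "(real^'nx) \<times> (real^'nw) \<Rightarrow> real^'nx"
    and G :: "real^'nx \<Rightarrow> real^'nu^'nx"
    and U :: "(real^'nu) set" and W :: "(real^'nw) set"
    and q\<^sub>w :: "real^'nw" and Q\<^sub>w :: "real^'nw^'nw"
    and q\<^sub>u :: "real^'nu" and Q\<^sub>u :: "real^'nu^'nu"
    and u\<^sub>x :: "real \<Rightarrow> real^'nu" and \<gamma> :: "real \<Rightarrow> real" and R\<^sub>u :: "real \<Rightarrow> real^'nu^'nu"
    and t1 t2 :: real
    and q\<^sub>x :: "real \<Rightarrow> real^'nx" and Q\<^sub>x :: "real \<Rightarrow> real^'nx^'nx"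
    and lam kap :: "real \<Rightarrow> real" and S :: "real \<Rightarrow> real^'nu^'nx"
    and \<Omega>\<^sub>n :: "real^'nx \<Rightarrow> real^'nx^'nx \<Rightarrow> real^'nx^'nx"
    and \<Omega>\<^sub>G :: "real^'nx \<Rightarrow> real^'nx^'nx \<Rightarrow> real^'nu^'nu \<Rightarrow> real^'nu^'nx \<Rightarrow> real^'nx^'nx"
  assumes "twice_cont_diff f" and "twice_cont_diff G"
    and "psd Q\<^sub>w" and "W \<subseteq> ellipsoid q\<^sub>w Q\<^sub>w"
    and "psd Q\<^sub>u" and "ellipsoid q\<^sub>u Q\<^sub>u \<subseteq> U"
    and "u\<^sub>x \<in> signals U" and "\<And>t. u\<^sub>x t \<in> ellipsoid q\<^sub>u Q\<^sub>u"
    and "\<And>t. 0 < \<gamma> t \<and> \<gamma> t \<le> 1"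
    and "\<And>t. R\<^sub>u t = (1 - \<gamma> t) *\<^sub>R Q\<^sub>u + (1 - inverse (\<gamma> t)) *\<^sub>R outer (u\<^sub>x t - q\<^sub>u) (u\<^sub>x t - q\<^sub>u)"
    and "\<And>t. psd (R\<^sub>u t)"
    and Omega_n_psd: "\<And>q Q. psd Q \<Longrightarrow> psd (\<Omega>\<^sub>n q Q)"
    and Omega_n_bound: "\<And>t \<xi> \<omega> \<nu>. \<lbrakk>t \<in> {t1..t2}; \<xi> \<in> ellipsoid 0 (Q\<^sub>x t);
            \<omega> \<in> ellipsoid 0 Q\<^sub>w; \<nu> \<in> ellipsoid 0 Q\<^sub>u\<rbrakk> \<Longrightarrow>
          remainder f G q\<^sub>w (q\<^sub>x t) (u\<^sub>x t) \<xi> \<omega> \<nu> \<in> ellipsoid 0 (\<Omega>\<^sub>n (q\<^sub>x t) (Q\<^sub>x t))"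
    and Omega_G_psd: "\<And>q Q R S\<^sub>0. \<lbrakk>psd Q; psd R\<rbrakk> \<Longrightarrow> psd (\<Omega>\<^sub>G q Q R S\<^sub>0)"
    and Omega_G_bound: "\<And>t \<xi> S\<^sub>0. \<lbrakk>t \<in> {t1..t2}; \<xi> \<in> ellipsoid (q\<^sub>x t) (Q\<^sub>x t);
            S\<^sub>0 ** transpose S\<^sub>0 \<preceq> mat 1\<rbrakk> \<Longrightarrow>
          feedback_term (Q\<^sub>x t) S\<^sub>0 (R\<^sub>u t) (G \<xi>) - feedback_term (Q\<^sub>x t) S\<^sub>0 (R\<^sub>u t) (G (q\<^sub>x t))
            \<preceq> \<Omega>\<^sub>G (q\<^sub>x t) (Q\<^sub>x t) (R\<^sub>u t) S\<^sub>0"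
    and "\<And>t. t \<in> {t1..t2} \<Longrightarrow> lam t > 0 \<and> kap t > 0"
    and "\<And>t. t \<in> {t1..t2} \<Longrightarrow> S t ** transpose (S t) \<preceq> mat 1"
    and "\<And>t. t \<in> {t1..t2} \<Longrightarrow> psd (Q\<^sub>x t)"
    and "caratheodory_solution t1 t2 (\<lambda>t q. f (q, q\<^sub>w) + G q *v u\<^sub>x t) q\<^sub>x"
    and "abs_continuous_on {t1..t2} Q\<^sub>x"
    and "AE t\<in>{t1..t2} in lebesgue. \<exists>D.
           (Q\<^sub>x has_vector_derivative D) (at t within {t1..t2}) \<and>
           Phi_g f G q\<^sub>w Q\<^sub>w \<Omega>\<^sub>n \<Omega>\<^sub>G (u\<^sub>x t) (q\<^sub>x t) (Q\<^sub>x t) (S t) (R\<^sub>u t) (lam t) (kap t) \<preceq> D"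
  shows "RFIT f G U W t1 t2 (\<lambda>t. ellipsoid (q\<^sub>x t) (Q\<^sub>x t))"
proof (cases "t1 \<le> t2")
  case False
  then have empty: "{t1..t2} = {}" by simp
  have "q\<^sub>u \<in> U" using assms(6) center_in_ellipsoid by blast
  then have "integrable_feedback t1 t2 U (\<lambda>_ _. q\<^sub>u)"
    by (simp add: integrable_feedback_def empty)
  then show ?thesis unfolding RFIT_def by (intro exI[of _ "\<lambda>_ _. q\<^sub>u"]) (simp add: empty)
next
  case True
  \<comment> \<open>The feedback takes values in the inner ellipsoid, which is compact and convex
    while \<open>U\<close> is arbitrary, and is robust against the whole outer ellipsoid of
    disturbance values.\<close>
  let ?W = "ellipsoid q\<^sub>w Q\<^sub>w" and ?U = "ellipsoid q\<^sub>u Q\<^sub>u" and ?I = "{t1..t2}"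
  have cont_f: "continuous_on UNIV f" and cont_G: "continuous_on UNIV G"
    by (intro twice_cont_diff_continuous assms(1,2))+
  have ac_q: "abs_continuous_on ?I q\<^sub>x" using assms(19) by (simp add: caratheodory_solution_def)
  have cont_q: "continuous_on ?I q\<^sub>x" and cont_Q: "continuous_on ?I Q\<^sub>x"
    by (rule abs_continuous_on_imp_continuous_on, fact)+
  have nonempty: "?U \<noteq> {}" using center_in_ellipsoid by blast
  have ux: "u\<^sub>x absolutely_integrable_on ?I" using assms(7) by (simp add: signals_def)
  obtain \<mu> N where mu: "integrable_feedback t1 t2 ?U \<mu>"
    and sel: "AE t in lebesgue. t \<in> ?I \<longrightarrow> (\<forall>D k. (Q\<^sub>x has_vector_derivative D) (at t) \<longrightarrow>
        ((q\<^sub>x t, Q\<^sub>x t, D, u\<^sub>x t), k) \<in> feedback_gains f G q\<^sub>w ?W ?U \<longrightarrow>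
        (\<exists>C. ((q\<^sub>x t, Q\<^sub>x t, D, u\<^sub>x t), (N t, C)) \<in> feedback_gains f G q\<^sub>w ?W ?U) \<and>
        (\<forall>x. \<mu> t x = u\<^sub>x t + N t *v (closest_point (ellipsoid (q\<^sub>x t) (Q\<^sub>x t)) x - q\<^sub>x t)))"
    by (rule measurable_feedback_exists[OF True cont_f cont_G compact_ellipsoid convex_ellipsoid nonempty
        cont_q cont_Q assms(18) ux]) (assumption | rule that)+
  show ?thesis
    unfolding RFIT_def
  proof (intro exI[of _ \<mu>] conjI ballI allI impI)
    show "integrable_feedback t1 t2 U \<mu>" using mu assms(6) unfolding integrable_feedback_def by blast
    fix w x t t'
    assume w: "w \<in> signals W" and sol: "caratheodory_solution t1 t2 (\<lambda>t y. f (y, w t) + G y *v \<mu> t y) x"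
      and t: "t \<in> ?I" "t' \<in> ?I" "t \<le> t' \<and> x t \<in> ellipsoid (q\<^sub>x t) (Q\<^sub>x t)"
    have wW: "w t \<in> ?W" for t using w assms(4) by (auto simp: signals_def)
    have ac_x: "abs_continuous_on ?I x" using sol by (simp add: caratheodory_solution_def)
    have "continuous_on ?I (\<lambda>t. norm (x t) + (norm (q\<^sub>x t) + sqrt (norm (Q\<^sub>x t))))"
      by (intro continuous_intros abs_continuous_on_imp_continuous_on[OF ac_x] cont_q cont_Q)
    then have "bounded ((\<lambda>t. norm (x t) + (norm (q\<^sub>x t) + sqrt (norm (Q\<^sub>x t)))) ` ?I)"
      by (intro compact_imp_bounded compact_continuous_image) auto
    \<comment> \<open>The constants derived from \<open>r\<close> may depend on the trajectory,
      since the feedback is already fixed.\<close>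
    then obtain r where r: "\<And>t. t \<in> ?I \<Longrightarrow> norm (x t) + (norm (q\<^sub>x t) + sqrt (norm (Q\<^sub>x t))) \<le> r"
    proof -
      assume "bounded ((\<lambda>t. norm (x t) + (norm (q\<^sub>x t) + sqrt (norm (Q\<^sub>x t)))) ` ?I)"
      then obtain r where "\<forall>v\<in>(\<lambda>t. norm (x t) + (norm (q\<^sub>x t) + sqrt (norm (Q\<^sub>x t)))) ` ?I. norm v \<le> r"
        unfolding bounded_iff by blast
      then show thesis by (intro that[of r]) (fastforce dest: abs_le_D1)
    qed
    have xr: "x t \<in> cball 0 r" if "t \<in> ?I" for t
    proof -
      have "0 \<le> norm (q\<^sub>x t) + sqrt (norm (Q\<^sub>x t))" by simp
      then have "norm (x t) \<le> r" using r[OF that] by linarith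
      then show ?thesis by simp
    qed
    have Er: "y \<in> cball 0 r" if "t \<in> ?I" "y \<in> ellipsoid (q\<^sub>x t) (Q\<^sub>x t)" for t y
      unfolding mem_cball dist_0_norm
      using r[OF that(1)] ellipsoid_norm_le[OF assms(18)[OF that(1)] that(2)]
        norm_triangle_sub[of y "q\<^sub>x t"] norm_ge_zero[of "x t"] by linarith
    obtain L V where LV: "0 \<le> L" "0 \<le> V"
      "\<And>x y w m. \<lbrakk>x \<in> cball 0 r; y \<in> cball 0 r; w \<in> ?W; m \<in> ?U\<rbrakk> \<Longrightarrow>
         norm (f (x, w) + G x *v m - (f (y, w) + G y *v m)) \<le> L * norm (x - y)"
      "\<And>x w m. \<lbrakk>x \<in> cball 0 r; w \<in> ?W; m \<in> ?U\<rbrakk> \<Longrightarrow> norm (f (x, w) + G x *v m) \<le> V"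
      using dynamics_bounds[OF assms(1,2) compact_cball convex_cball compact_ellipsoid convex_ellipsoid
          compact_ellipsoid] by metis
    \<comment> \<open>A relative velocity is a difference of two velocities of norm at most
      V.\<close>
    interpret moving_ellipsoid t1 t2 x q\<^sub>x Q\<^sub>x L "2 * V"
      by unfold_locales (use ac_x ac_q assms(18,20) LV in auto)
    have "AE t in lebesgue. t \<noteq> t1 \<and> t \<noteq> t2"
      by (rule AE_completion) (use AE_lborel_singleton in auto)
    moreover have "AE t in lebesgue. t \<in> ?I \<longrightarrow>
        (x has_vector_derivative f (x t, w t) + G (x t) *v \<mu> t (x t)) (at t within ?I)"
      using sol by (simp add: caratheodory_solution_def)
    moreover have "AE t in lebesgue. t \<in> ?I \<longrightarrow>
        (q\<^sub>x has_vector_derivative f (q\<^sub>x t, q\<^sub>w) + G (q\<^sub>x t) *v u\<^sub>x t) (at t within ?I)"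
      using assms(19) by (simp add: caratheodory_solution_def)
    ultimately have "AE t in lebesgue. t \<in> ?I \<longrightarrow> (\<exists>g D. admissible t g D)"
      using assms(21) sel
    proof eventually_elim
      case (elim t)
      show ?case
      proof
        assume tI: "t \<in> ?I"
        then have t12: "t1 < t" "t < t2" using elim(1) by auto
        obtain D where D: "(Q\<^sub>x has_vector_derivative D) (at t within ?I)"
          "Phi_g f G q\<^sub>w Q\<^sub>w \<Omega>\<^sub>n \<Omega>\<^sub>G (u\<^sub>x t) (q\<^sub>x t) (Q\<^sub>x t) (S t) (R\<^sub>u t) (lam t) (kap t) \<preceq> D"
          using elim(4) tI by blast
        have Dt: "(Q\<^sub>x has_vector_derivative D) (at t)" using D(1) t12 by (simp add: at_within_Icc_at)
        have D_sym: "transpose D = D" and D_ker: "\<And>k. Q\<^sub>x t *v k = 0 \<Longrightarrow> k \<bullet> (D *v k) = 0"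
          using psd_path_derivative[OF Dt t12 assms(18)] by blast+
        interpret tube_at_instant f G q\<^sub>w Q\<^sub>w q\<^sub>u Q\<^sub>u "u\<^sub>x t" "\<gamma> t" "R\<^sub>u t" "q\<^sub>x t" "Q\<^sub>x t" "S t" "lam t" "kap t"
          \<Omega>\<^sub>n \<Omega>\<^sub>G D
        proof
          show "continuous_on UNIV f" "continuous_on UNIV G" "psd Q\<^sub>w" "psd Q\<^sub>u" by fact+
          show "u\<^sub>x t \<in> ?U" "psd (R\<^sub>u t)" by fact+
          show "R\<^sub>u t = (1 - \<gamma> t) *\<^sub>R Q\<^sub>u + (1 - inverse (\<gamma> t)) *\<^sub>R outer (u\<^sub>x t - q\<^sub>u) (u\<^sub>x t - q\<^sub>u)"
            by fact
          show "0 < \<gamma> t" "\<gamma> t \<le> 1" using assms(9) by auto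
          show psd: "psd (Q\<^sub>x t)" by (rule assms(18)[OF tI])
          show "psd (\<Omega>\<^sub>n (q\<^sub>x t) (Q\<^sub>x t))" by (rule Omega_n_psd[OF psd])
          show "psd (\<Omega>\<^sub>G (q\<^sub>x t) (Q\<^sub>x t) (R\<^sub>u t) (S t))" by (rule Omega_G_psd[OF psd assms(11)])
          show SS: "S t ** transpose (S t) \<preceq> mat 1" by (rule assms(17)[OF tI])
          show "0 < lam t" "0 < kap t" using assms(16)[OF tI] by auto
          show "feedback_term (Q\<^sub>x t) (S t) (R\<^sub>u t) (G y) - feedback_term (Q\<^sub>x t) (S t) (R\<^sub>u t) (G (q\<^sub>x t))
              \<preceq> \<Omega>\<^sub>G (q\<^sub>x t) (Q\<^sub>x t) (R\<^sub>u t) (S t)" if "y \<in> ellipsoid (q\<^sub>x t) (Q\<^sub>x t)" for y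
            by (rule Omega_G_bound[OF tI that SS])
        qed (fact Omega_n_bound[OF tI] D(2) D_ker)+
        obtain C where K: "((q\<^sub>x t, Q\<^sub>x t, D, u\<^sub>x t), (N t, C)) \<in> feedback_gains f G q\<^sub>w ?W ?U"
          and mu_t: "\<And>y. \<mu> t y = u\<^sub>x t + N t *v (closest_point (ellipsoid (q\<^sub>x t) (Q\<^sub>x t)) y - q\<^sub>x t)"
        proof -
          obtain N\<^sub>0 C\<^sub>0 where "((q\<^sub>x t, Q\<^sub>x t, D, u\<^sub>x t), (N\<^sub>0, C\<^sub>0)) \<in> feedback_gains f G q\<^sub>w ?W ?U"
            using feedback_gains_nonempty by blast
          from elim(5)[rule_format, OF tI Dt this] show thesis using that by blast
        qed
        have muU: "\<mu> t (x t) \<in> ?U" using mu tI by (simp add: integrable_feedback_def)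
        have qV: "norm (f (q\<^sub>x t, q\<^sub>w) + G (q\<^sub>x t) *v u\<^sub>x t) \<le> V"
          by (intro LV(4) Er[OF tI] center_in_ellipsoid assms(8))
        have diff: "norm (v - (f (q\<^sub>x t, q\<^sub>w) + G (q\<^sub>x t) *v u\<^sub>x t)) \<le> 2 * V" if "norm v \<le> V" for v
          using norm_triangle_ineq4[of v "f (q\<^sub>x t, q\<^sub>w) + G (q\<^sub>x t) *v u\<^sub>x t"] that qV by linarith
        let ?g = "f (x t, w t) + G (x t) *v \<mu> t (x t) - (f (q\<^sub>x t, q\<^sub>w) + G (q\<^sub>x t) *v u\<^sub>x t)"
        have "admissible t ?g D"
        proof (rule admissibleI[OF tI _ D(1) D_sym D_ker K wW])
          show "((\<lambda>s. x s - q\<^sub>x s) has_vector_derivative ?g) (at t within ?I)"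
            using elim(2,3) tI by (intro has_vector_derivative_diff) auto
          show "?g = f (x t, w t) + G (x t) *v (u\<^sub>x t + N t *v (proj t - q\<^sub>x t))
              - (f (q\<^sub>x t, q\<^sub>w) + G (q\<^sub>x t) *v u\<^sub>x t)"
            by (simp add: mu_t proj_def E_def)
          show "norm ?g \<le> 2 * V" by (intro diff LV(4) xr tI wW muU)
          show "norm (velocity f G q\<^sub>w (q\<^sub>x t) (u\<^sub>x t) (N t) y (w t)) \<le> 2 * V" if "y \<in> E t" for y
            unfolding velocity_def using that
            by (intro diff LV(4) Er[OF tI] wW feedback_gains_control[OF K Q]) (simp_all add: E_def)
          show "norm (f (x t, w t) + G (x t) *v m - (f (y, w t) + G y *v m)) \<le> L * norm (x t - y)"
            if "y \<in> E t" "m \<in> ?U" for y m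
            using that by (intro LV(3) xr tI Er[OF tI] wW) (simp_all add: E_def)
        qed
        then show "\<exists>g D. admissible t g D" by blast
      qed
    qed
    from invariant[OF this t(1,2)] t(3) show "x t' \<in> ellipsoid (q\<^sub>x t') (Q\<^sub>x t')"
      by (simp add: E_def)
  qed
qed

end
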